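(* Let $c_0\in(0,\tfrac12)$ and let $\tilde\omega\in C^2[0,\infty)$ be a function independent of $\Lambda$ with $\tilde\omega(0)=0$. For $\Lambda>1$ define $\omega=\omega(\Lambda)$ by $$\frac{\omega}{\Lambda-1}=c_0+\tilde\omega\left(\frac{1}{\sqrt{\Lambda-1}}\right).$$ Then, for every sufficiently large $\Lambda$, there exists a positive solution $(u_\Lambda,v_\Lambda)$ on $\mathbb R$ of $$u''=u^3-u+\Lambda v^2u-\omega v,\qquad v''=v^3-v+\Lambda u^2v-\omega u,$$ with $$(u,v)\to(\bar u,\bar v)\ \text{as } x\to-\infty,\qquad (u,v)\to(\bar v,\bar u)\ \text{as } x\to+\infty,$$ where $$\bar u=\sqrt{\frac{1-\sqrt{1-\frac{4\omega^2}{(\Lambda-1)^2}}}{2}},\qquad \bar v=\sqrt{\frac{1+\sqrt{1-\frac{4\omega^2}{(\Lambda-1)^2}}}{2}},$$ such that $$u_\Lambda(-x)=v_\Lambda(x)\quad\text{for all }x\in\mathbb R,\qquad u_\Lambda'>0\ \text{ on }\mathbb R,$$ and, uniformly in $x\in\mathbb R$ as $\Lambda\to\infty$, $$u_\Lambda(x)-u_0(x)=O\left(\frac1{\sqrt\Lambda}\right),$$ $$|u_\Lambda(x)-\bar u|\cdot|u_\Lambda(x)-\bar v|+|u_\Lambda'(x)|=O(1)\,e^{-\left(\sqrt2\sqrt{1-4c_0^2}+O\left(\frac1{\sqrt\Lambda}\right)\right)|x|},$$ where $u_0$ is the unique solution of $$u'=\frac{u^2-u^4-c_0^2}{\sqrt2\sqrt{u^4+c_0^2}},\qquad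 u(0)=\sqrt{c_0}.$$ Furthermore, $$u_\Lambda(x)v_\Lambda(x)-\frac{\omega}{\Lambda-1}=O\left(\frac1\Lambda\right)e^{-\left(\sqrt2\sqrt{1-4c_0^2}+O\left(\frac1{\sqrt\Lambda}\right)\right)|x|}$$ uniformly in $x\in\mathbb R$ as $\Lambda\to\infty$.
   Context: Primes denote derivatives with respect to $x\in\mathbb R$. All $O(\cdot)$ constants depend only on $c_0$ and $\tilde\omega$, not on $x$ or $\Lambda$. A bound of the form $f(x)=O(a_\Lambda)e^{-(\kappa+O(\delta_\Lambda))|x|}$ means that there is a constant $C>0$ such that $|f(x)|\le C a_\Lambda e^{-(\kappa-C\delta_\Lambda)|x|}$ for all $x\in\mathbb R$ and all sufficiently large $\Lambda$. *)

theory Defs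
  imports "HOL-Analysis.Analysis"
begin

definition C2_halfline :: "(real \<Rightarrow> real) \<Rightarrow> bool" where
  "C2_halfline f \<longleftrightarrow> (\<exists>f' f''.
     (\<forall>x\<ge>0. (f has_real_derivative f' x) (at x within {0..})) \<and>
     (\<forall>x\<ge>0. (f' has_real_derivative f'' x) (at x within {0..})) \<and>
     continuous_on {0..} f'')"

definition GP_solution :: "real \<Rightarrow> real \<Rightarrow> (real \<Rightarrow> real) \<Rightarrow> (real \<Rightarrow> real) \<Rightarrow> bool" where
  "GP_solution \<Lambda> \<omega> u v \<longleftrightarrow> (\<forall>x.
     u differentiable (at x) \<and> v differentiable (at x) \<and>
     (deriv u has_real_derivative
        ((u x)^3 - u x + \<Lambda> * (v x)^2 * u x - \<omega> * v x)) (at x) \<and>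
     (deriv v has_real_derivative
        ((v x)^3 - v x + \<Lambda> * (u x)^2 * v x - \<omega> * u x)) (at x))"

definition ubar :: "real \<Rightarrow> real \<Rightarrow> real" where
  "ubar \<Lambda> \<omega> = sqrt ((1 - sqrt (1 - 4 * \<omega>^2 / (\<Lambda> - 1)^2)) / 2)"

definition vbar :: "real \<Rightarrow> real \<Rightarrow> real" where
  "vbar \<Lambda> \<omega> = sqrt ((1 + sqrt (1 - 4 * \<omega>^2 / (\<Lambda> - 1)^2)) / 2)"

definition limit_profile :: "real \<Rightarrow> (real \<Rightarrow> real) \<Rightarrow> bool" where
  "limit_profile c0 u \<longleftrightarrow>
     (\<forall>x. (u has_real_derivative
        (((u x)^2 - (u x)^4 - c0^2) / (sqrt 2 * sqrt ((u x)^4 + c0^2)))) (at x)) \<and>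
     u 0 = sqrt c0"

text \<open>The convention \<open>f(x) = O(a) e^{-(\<kappa> + O(\<delta>)) |x|}\<close>: a single constant \<open>C\<close>,
  independent of \<open>x\<close> and \<open>\<Lambda>\<close>, serves both occurrences of \<open>O\<close>.\<close>

definition exp_decay_bound ::
  "(real \<Rightarrow> real \<Rightarrow> real) \<Rightarrow> (real \<Rightarrow> real) \<Rightarrow> real \<Rightarrow> (real \<Rightarrow> real) \<Rightarrow> bool" where
  "exp_decay_bound f a \<kappa> \<delta> \<longleftrightarrow> (\<exists>C>0. \<forall>\<^sub>F \<Lambda> in at_top. \<forall>x.
     \<bar>f \<Lambda> x\<bar> \<le> C * a \<Lambda> * exp (- (\<kappa> - C * \<delta> \<Lambda>) * \<bar>x\<bar>))"

end

(* With c = omega/(Lambda-1), eps = 1/sqrt(Lambda-1), w = uv - c and r = u^2 + v^2, the system is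
   Hamiltonian with potential (1-r)^2/4 + w^2/(2 eps^2), and the heteroclinic has energy zero. The
   normal coordinate satisfies w'' = r w/eps^2 + 2uv(r-1) + 2u'v', which is uniformly hyperbolic with a
   forcing of size O(1-r) because |u'v'| is bounded by the kinetic energy, that is, by the potential.
   Hence the region |w + eps w'| < K eps^2 (1-r), |w - eps w'| < K2 eps^2 (1-r) can only be left through
   the faces |w + eps w'| = K eps^2 (1-r), and a one-parameter shooting among the symmetric data u = v,
   u' = -v' of energy zero produces an orbit that stays inside for all x >= 0; reflection gives the
   whole line. Inside the region the tangential speed is positive, equal to that on the hyperbola up to
   O(eps), and 1-r obeys a differential inequality with rate sqrt 2 (u^2-v^2) + O(eps). This gives
   monotonicity, convergence and exponential decay; comparing the ratio v/u with the ratio for the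
   limit profile gives the O(eps) closeness. *)

theory Submission
  imports Defs "HOL-Real_Asymp.Real_Asymp"
begin

section \<open>Lipschitz differential equations\<close>

lemma has_vector_derivative_reflect:
  assumes "(G has_vector_derivative d) (at (- t))"
  shows "((\<lambda>t. G (- t)) has_vector_derivative - d) (at t)"
proof -
  have "(uminus has_vector_derivative - 1) (at t)"
    by (auto intro!: derivative_eq_intros)
  from vector_diff_chain_at[OF this assms] show ?thesis
    by (simp add: o_def)
qed

lemma exp_growth_antiderivative:
  fixes G :: "real \<Rightarrow> 'a::real_normed_vector"
  assumes G: "\<And>t. (G has_vector_derivative f t) (at t)" and "G 0 = 0" and "0 < k"
    and f: "\<And>t. norm (f t) \<le> M * exp (k * \<bar>t\<bar>)"
  shows "norm (G t) \<le> M / k * exp (k * \<bar>t\<bar>)"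
proof -
  have M: "0 \<le> M"
    using order_trans[OF norm_ge_zero f[of 0]] by simp
  have *: "norm (H b) \<le> M / k * exp (k * b)"
    if H: "\<And>t. (H has_vector_derivative h t) (at t)" and "H 0 = 0"
      and h: "\<And>t. 0 < t \<Longrightarrow> norm (h t) \<le> M * exp (k * t)" and "0 < b"
    for H h :: "real \<Rightarrow> 'a" and b
  proof -
    have "norm (H b - H 0) \<le> M / k * exp (k * b) - M / k * exp (k * 0)"
    proof (rule differentiable_bound_general[OF \<open>0 < b\<close>, where f' = h and \<phi>' = "\<lambda>t. M * exp (k * t)"])
      show "continuous_on {0..b} (\<lambda>t. M / k * exp (k * t))"
        using \<open>0 < k\<close> by (intro continuous_intros)  auto
      show "continuous_on {0..b} H"
        using H by (meson continuous_at_imp_continuous_on has_vector_derivative_continuous)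
      show "((\<lambda>t. M / k * exp (k * t)) has_vector_derivative M * exp (k * x)) (at x)" for x
        unfolding has_real_derivative_iff_has_vector_derivative[symmetric]
        using \<open>0 < k\<close> by (auto intro!: derivative_eq_intros)
    qed (use H h in \<open>auto intro!: continuous_intros\<close>)
    then show ?thesis
      using M \<open>0 < k\<close> \<open>H 0 = 0\<close> by (simp add: divide_nonneg_pos order_trans)
  qed
  consider "t = 0" | "t > 0" | "t < 0" by linarith
  then show ?thesis
  proof cases
    case 1
    then show ?thesis using M assms by simp
  next
    case 2
    then show ?thesis
      using *[OF G \<open>G 0 = 0\<close>, of t] f by (metis abs_of_pos)
  next
    case 3
    have "((\<lambda>t. G (- t)) has_vector_derivative - f (- t)) (at t)" for t
      by (rule has_vector_derivative_reflect[OF G])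
    from *[OF this, of "- t"] show ?thesis
      using 3 \<open>G 0 = 0\<close> f by (smt (verit) minus_minus norm_minus_cancel minus_zero)
  qed
qed

text \<open>The integral operator is a contraction in the norm weighted by \<open>exp (2 L |t|)\<close>.\<close>

proposition lipschitz_ode_exists:
  fixes F :: "'a::euclidean_space \<Rightarrow> 'a"
  assumes lip: "L-lipschitz_on UNIV F"
  shows "\<exists>X. X 0 = x0 \<and> (\<forall>t. (X has_vector_derivative F (X t)) (at t))"
proof -
  define K where "K = L + 1"
  have K: "0 < K" and KL: "L \<le> K"
    using lipschitz_on_nonneg[OF lip] by (auto simp: K_def)
  have lipF: "norm (F x - F y) \<le> K * norm (x - y)" for x y
    using lipschitz_on_normD[OF lip, of x y] mult_right_mono[OF KL norm_ge_zero[of "x - y"]] by simp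
  have contF: "continuous_on UNIV F"
    by (rule lipschitz_on_continuous_on[OF lip])
  define e where "e t = exp (2 * K * \<bar>t\<bar>)" for t :: real
  have e: "0 < e t" "1 \<le> e t" for t
    using K by (auto simp: e_def)
  have ei: "inverse (e t) \<le> 1" "0 < inverse (e t)" for t
    using e[of t] by (auto simp: inverse_le_1_iff)
  have conte: "continuous_on UNIV e"
    unfolding e_def by (intro continuous_intros)
  have contFe: "isCont (\<lambda>s. F (e s *\<^sub>R apply_bcontfun Y s)) t" for Y t
  proof -
    have "continuous_on UNIV (\<lambda>s. F (e s *\<^sub>R apply_bcontfun Y s))"
      by (intro continuous_on_compose2[OF contF] continuous_intros conte) auto
    then show ?thesis by (simp add: continuous_on_eq_continuous_at)
  qed
  have "\<exists>G. G 0 = 0 \<and> (\<forall>t. (G has_vector_derivative F (e t *\<^sub>R apply_bcontfun Y t)) (at t))" for Y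
  proof -
    obtain H where H: "\<And>t. (H has_vector_derivative F (e t *\<^sub>R apply_bcontfun Y t)) (at t)"
      using einterval_antiderivative[of "-\<infinity>" \<infinity>, OF _ contFe[where Y = Y]] by auto
    show ?thesis
      by (rule exI[of _ "\<lambda>t. H t - H 0"]) (auto intro!: derivative_eq_intros H)
  qed
  then obtain A where A0: "\<And>Y. A Y 0 = 0"
    and A: "\<And>Y t. (A Y has_vector_derivative F (e t *\<^sub>R apply_bcontfun Y t)) (at t)"
    by metis
  have contA: "continuous_on UNIV (A Y)" for Y
    using A by (meson continuous_at_imp_continuous_on has_vector_derivative_continuous)
  define P where "P Y t = inverse (e t) *\<^sub>R (x0 + A Y t)" for Y t
  have Pb: "P Y \<in> bcontfun" for Y
  proof -
    have "norm (F (e t *\<^sub>R apply_bcontfun Y t)) \<le> (norm (F 0) + K * norm Y) * exp ((2*K) * \<bar>t\<bar>)" for t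
    proof -
      have "norm (F (e t *\<^sub>R apply_bcontfun Y t)) \<le> norm (F 0) + K * norm (e t *\<^sub>R apply_bcontfun Y t)"
        using norm_triangle_ineq2[of "F (e t *\<^sub>R apply_bcontfun Y t)" "F 0"]
          lipF[of "e t *\<^sub>R apply_bcontfun Y t" 0] by simp
      also have "norm (e t *\<^sub>R apply_bcontfun Y t) \<le> e t * norm Y"
        using e[of t] norm_bounded[where f = Y] by simp
      also have "norm (F 0) \<le> norm (F 0) * e t"
        using e(2)[of t] by (metis mult_left_mono mult.right_neutral norm_ge_zero)
      finally show ?thesis
        using K by (simp add: e_def algebra_simps)
    qed
    then have b: "norm (A Y t) \<le> (norm (F 0) + K * norm Y) / (2*K) * e t" for t
      using exp_growth_antiderivative[OF A A0, of "2 * K" Y] K by (simp add: e_def)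
    have "norm (P Y t) \<le> norm x0 + (norm (F 0) + K * norm Y) / (2*K)" for t
    proof -
      have "norm (P Y t) \<le> inverse (e t) * (norm x0 + norm (A Y t))"
        unfolding P_def using ei[of t] by (simp add: mult_left_mono norm_triangle_ineq)
      also have "\<dots> \<le> inverse (e t) * (norm x0 + (norm (F 0) + K * norm Y) / (2*K) * e t)"
        using b[of t] ei[of t] by (intro mult_left_mono) auto
      also have "\<dots> = inverse (e t) * norm x0 + (norm (F 0) + K * norm Y) / (2*K)"
        using e(1)[of t] by (simp add: field_simps)
      also have "inverse (e t) * norm x0 \<le> norm x0"
        using ei[of t] by (simp add: mult_left_le_one_le)
      finally show ?thesis by simp
    qed
    then show ?thesis
      unfolding P_def using e
      by (intro bcontfun_normI[where b = "norm x0 + (norm (F 0) + K * norm Y) / (2*K)"]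
        continuous_intros conte contA) (auto simp: order_less_imp_not_eq2)
  qed
  have ap: "apply_bcontfun (Bcontfun (P Y)) = P Y" for Y
    by (rule Bcontfun_inverse[OF Pb])
  have "dist (Bcontfun (P Y)) (Bcontfun (P Z)) \<le> 1/2 * dist Y Z" for Y Z
  proof (rule dist_bound)
    fix t
    have "norm (F (e t *\<^sub>R apply_bcontfun Y t) - F (e t *\<^sub>R apply_bcontfun Z t))
        \<le> K * dist Y Z * exp (2 * K * \<bar>t\<bar>)" for t
    proof -
      have "norm (F (e t *\<^sub>R apply_bcontfun Y t) - F (e t *\<^sub>R apply_bcontfun Z t))
        \<le> K * norm (e t *\<^sub>R (apply_bcontfun Y t - apply_bcontfun Z t))"
        using lipF by (metis scaleR_diff_right)
      also have "\<dots> \<le> K * (e t * dist Y Z)"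
        using K e[of t] dist_bounded[where f = Y and g = Z] by (simp add: dist_norm mult_left_mono)
      finally show ?thesis by (simp add: e_def mult_ac)
    qed
    then have "norm (A Y t - A Z t) \<le> K * dist Y Z / (2 * K) * e t"
      unfolding e_def[of t] using K
      by (intro exp_growth_antiderivative[where G = "\<lambda>t. A Y t - A Z t"])
        (auto intro!: derivative_eq_intros A simp: A0)
    then have "norm (A Y t - A Z t) \<le> 1/2 * dist Y Z * e t"
      using K by simp
    then have "inverse (e t) * norm (A Y t - A Z t) \<le> inverse (e t) * (1/2 * dist Y Z * e t)"
      using ei[of t] by (intro mult_left_mono) auto
    also have "\<dots> = 1/2 * dist Y Z" using e(1)[of t] by (simp add: field_simps)
    also have "inverse (e t) * norm (A Y t - A Z t) = norm (P Y t - P Z t)"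
      unfolding P_def using ei(2)[of t] by (simp add: scaleR_diff_right[symmetric] del: scaleR_diff_right)
    finally show "dist (apply_bcontfun (Bcontfun (P Y)) t) (apply_bcontfun (Bcontfun (P Z)) t) \<le> 1/2 * dist Y Z"
      by (simp add: ap dist_norm)
  qed
  then obtain Y where "Bcontfun (P Y) = Y"
    using banach_fix_type[of "1/2" "\<lambda>Y. Bcontfun (P Y)"] by auto
  then have Y: "apply_bcontfun Y t = P Y t" for t
    by (metis ap)
  have YA: "e t *\<^sub>R apply_bcontfun Y t = x0 + A Y t" for t
    using e(1)[of t] unfolding Y P_def by simp
  show ?thesis
    using A[of Y] A0[of Y] unfolding YA
    by (intro exI[of _ "\<lambda>t. x0 + A Y t"]) (auto intro!: derivative_eq_intros)
qed

lemma lipschitz_ode_dist: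
  fixes X Y :: "real \<Rightarrow> 'a::real_inner"
  assumes "0 \<le> T" and lip: "L-lipschitz_on S F"
    and X: "\<And>t. 0 \<le> t \<Longrightarrow> t \<le> T \<Longrightarrow> (X has_vector_derivative F (X t)) (at t)"
    and Y: "\<And>t. 0 \<le> t \<Longrightarrow> t \<le> T \<Longrightarrow> (Y has_vector_derivative F (Y t)) (at t)"
    and S: "\<And>t. 0 \<le> t \<Longrightarrow> t \<le> T \<Longrightarrow> X t \<in> S \<and> Y t \<in> S"
  shows "norm (X T - Y T) \<le> exp (L * T) * norm (X 0 - Y 0)"
proof -
  define h where "h t = exp (- 2 * L * t) * ((X t - Y t) \<bullet> (X t - Y t))" for t
  have "h T \<le> h 0"
  proof (rule DERIV_nonpos_imp_nonincreasing[OF \<open>0 \<le> T\<close>])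
    fix t assume t: "0 \<le> t" "t \<le> T"
    define d where "d = X t - Y t"
    define d' where "d' = F (X t) - F (Y t)"
    have "((\<lambda>t. X t - Y t) has_vector_derivative d') (at t)"
      unfolding d'_def using X[OF t] Y[OF t] by (auto intro!: derivative_eq_intros)
    then have i: "((\<lambda>t. (X t - Y t) \<bullet> (X t - Y t)) has_real_derivative 2 * (d \<bullet> d')) (at t)"
      unfolding has_real_derivative_iff_has_vector_derivative d_def
      using bounded_bilinear.has_vector_derivative[OF bounded_bilinear_inner]
      by (fastforce simp: inner_commute)
    have "(h has_real_derivative exp (- 2 * L * t) * (2 * (d \<bullet> d')) + exp (- 2 * L * t) * (- 2 * L) * (d \<bullet> d)) (at t)"
      unfolding h_def by (rule derivative_eq_intros i refl | simp add: d_def)+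
    moreover have "d \<bullet> d' \<le> L * (d \<bullet> d)"
    proof -
      have "d \<bullet> d' \<le> norm d * norm d'" by (rule norm_cauchy_schwarz)
      also have "\<dots> \<le> norm d * (L * norm d)"
        unfolding d_def d'_def using lipschitz_on_normD[OF lip] S[OF t] by (intro mult_left_mono) auto
      finally show ?thesis by (simp add: power2_norm_eq_inner[symmetric] power2_eq_square mult_ac)
    qed
    then have "exp (- 2 * L * t) * (2 * (d \<bullet> d') - 2 * L * (d \<bullet> d)) \<le> 0"
      by (intro mult_nonneg_nonpos) auto
    ultimately show "\<exists>y. (h has_real_derivative y) (at t) \<and> y \<le> 0"
      by (auto simp: algebra_simps)
  qed
  then have "exp (2 * L * T) * h T \<le> exp (2 * L * T) * h 0"
    by (intro mult_left_mono) auto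
  then have "(norm (X T - Y T))\<^sup>2 \<le> exp (2 * L * T) * (norm (X 0 - Y 0))\<^sup>2"
    by (simp add: h_def exp_minus power2_norm_eq_inner field_simps)
  also have "exp (2 * L * T) = (exp (L * T))\<^sup>2"
    by (simp add: exp_double[symmetric] mult_ac)
  finally show ?thesis
    by (simp add: power_mult_distrib[symmetric] power2_le_iff_abs_le)
qed

corollary lipschitz_ode_unique:
  fixes X Y :: "real \<Rightarrow> 'a::real_inner"
  assumes lip: "L-lipschitz_on S F"
    and X: "\<And>t. \<bar>t\<bar> \<le> T \<Longrightarrow> (X has_vector_derivative F (X t)) (at t)"
    and Y: "\<And>t. \<bar>t\<bar> \<le> T \<Longrightarrow> (Y has_vector_derivative F (Y t)) (at t)"
    and S: "\<And>t. \<bar>t\<bar> \<le> T \<Longrightarrow> X t \<in> S \<and> Y t \<in> S"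
    and "X 0 = Y 0" and t: "\<bar>t\<bar> \<le> T"
  shows "X t = Y t"
proof (cases "0 \<le> t")
  case True
  then show ?thesis
    using lipschitz_ode_dist[OF True lip, of X Y] assms by auto
next
  case False
  have lip': "L-lipschitz_on S (\<lambda>x. - F x)"
    using lip by (simp add: lipschitz_on_def dist_minus)
  have "norm (X (- (- t)) - Y (- (- t))) \<le> exp (L * - t) * norm (X (- 0) - Y (- 0))"
    by (rule lipschitz_ode_dist[where X = "\<lambda>t. X (- t)" and Y = "\<lambda>t. Y (- t)", OF _ lip'])
      (use False t X Y S in \<open>auto intro!: has_vector_derivative_reflect\<close>)
  then show ?thesis using \<open>X 0 = Y 0\<close> by simp
qed

lemma lipschitz_on_clamp:
  fixes F :: "'a::euclidean_space \<Rightarrow> 'b::metric_space"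
  assumes "L-lipschitz_on (cbox a b) F" and "\<And>i. i \<in> Basis \<Longrightarrow> a \<bullet> i \<le> b \<bullet> i"
  shows "L-lipschitz_on UNIV (\<lambda>x. F (clamp a b x))"
proof (rule lipschitz_onI)
  fix x y
  have "dist (F (clamp a b x)) (F (clamp a b y)) \<le> L * dist (clamp a b x) (clamp a b y)"
    using assms by (intro lipschitz_onD[OF assms(1)] clamp_in_interval) auto
  also have "\<dots> \<le> L * dist x y"
    by (intro mult_left_mono dist_clamps_le_dist_args lipschitz_on_nonneg[OF assms(1)])
  finally show "dist (F (clamp a b x)) (F (clamp a b y)) \<le> L * dist x y" .
qed (rule lipschitz_on_nonneg[OF assms(1)])

lemma C1_imp_lipschitz_on_interval:
  fixes f :: "real \<Rightarrow> real"
  assumes f: "\<And>x. x \<in> {a..b} \<Longrightarrow> (f has_real_derivative f' x) (at x)"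
    and f': "continuous_on {a..b} f'"
  shows "\<exists>L. L-lipschitz_on {a..b} f"
proof -
  obtain B where B: "0 < B" "\<And>x. x \<in> {a..b} \<Longrightarrow> \<bar>f' x\<bar> \<le> B"
    using compact_imp_bounded[OF compact_continuous_image[OF f' compact_Icc]]
    unfolding bounded_pos by (auto simp: image_iff)
  have "B-lipschitz_on {a..b} f"
  proof (rule lipschitz_onI)
    fix x y assume xy: "x \<in> {a..b}" "y \<in> {a..b}"
    show "dist (f x) (f y) \<le> B * dist x y"
      unfolding dist_norm
      by (rule field_differentiable_bound[of "{a..b}" f f' B x y])
        (use f B xy in \<open>auto intro: DERIV_subset\<close>)
  qed (use B in auto)
  then show ?thesis by blast
qed

lemma lipschitz_on_mult_bounded:
  fixes f g :: "'a::euclidean_space \<Rightarrow> real"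
  assumes S: "bounded S" and f: "\<exists>L. L-lipschitz_on S f" and g: "\<exists>L. L-lipschitz_on S g"
  shows "\<exists>L. L-lipschitz_on S (\<lambda>x. f x * g x)"
proof -
  obtain L M where L: "L-lipschitz_on S f" and M: "M-lipschitz_on S g" using f g by blast
  have "bounded (f ` S)" "bounded (g ` S)"
    using bounded_uniformly_continuous_image[OF lipschitz_on_uniformly_continuous S] L M by blast+
  then obtain a b where a: "0 < a" "\<And>x. x \<in> S \<Longrightarrow> \<bar>f x\<bar> \<le> a" and b: "0 < b" "\<And>x. x \<in> S \<Longrightarrow> \<bar>g x\<bar> \<le> b"
    unfolding bounded_pos by auto
  have "(a * M + b * L)-lipschitz_on S (\<lambda>x. f x * g x)"
  proof (rule lipschitz_onI)
    fix x y assume xy: "x \<in> S" "y \<in> S"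
    have "\<bar>f x * g x - f y * g y\<bar> \<le> \<bar>f x * (g x - g y)\<bar> + \<bar>(f x - f y) * g y\<bar>"
      by (rule order_trans[OF _ abs_triangle_ineq]) (simp add: algebra_simps)
    also have "\<dots> \<le> a * (M * dist x y) + (L * dist x y) * b"
      unfolding abs_mult using lipschitz_onD[OF L xy] lipschitz_onD[OF M xy] a b xy
      by (intro add_mono mult_mono) (auto simp: dist_real_def)
    finally show "dist (f x * g x) (f y * g y) \<le> (a * M + b * L) * dist x y"
      by (simp add: dist_real_def algebra_simps)
  qed (use a b lipschitz_on_nonneg[OF L] lipschitz_on_nonneg[OF M] in auto)
  then show ?thesis by blast
qed

lemma lipschitz_on_add_ex:
  fixes f g :: "'a::metric_space \<Rightarrow> real"
  assumes f: "\<exists>L. L-lipschitz_on S f" and g: "\<exists>L. L-lipschitz_on S g"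
  shows "\<exists>L. L-lipschitz_on S (\<lambda>x. f x + g x)"
  using f g by (blast intro: lipschitz_on_add)

lemma lipschitz_on_Pair_ex:
  fixes f :: "'a::metric_space \<Rightarrow> 'b::metric_space" and g :: "'a \<Rightarrow> 'c::metric_space"
  assumes f: "\<exists>L. L-lipschitz_on S f" and g: "\<exists>L. L-lipschitz_on S g"
  shows "\<exists>L. L-lipschitz_on S (\<lambda>x. (f x, g x))"
  using f g by (blast intro: lipschitz_on_Pair)

lemma lipschitz_on_const_ex: "\<exists>L. L-lipschitz_on S (\<lambda>x. k)"
  by (auto intro!: exI[of _ 0] lipschitz_onI)

lemma lipschitz_on_fst_ex:
  "\<exists>L. L-lipschitz_on S f \<Longrightarrow> \<exists>L. L-lipschitz_on S (\<lambda>x. fst (f x))"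
  by (auto simp: lipschitz_on_def intro: order_trans[OF dist_fst_le])

lemma lipschitz_on_snd_ex:
  "\<exists>L. L-lipschitz_on S f \<Longrightarrow> \<exists>L. L-lipschitz_on S (\<lambda>x. snd (f x))"
  by (auto simp: lipschitz_on_def intro: order_trans[OF dist_snd_le])

lemma lipschitz_on_ident_ex: "\<exists>L. L-lipschitz_on S (\<lambda>x. x)"
  by (auto simp: lipschitz_on_def intro!: exI[of _ 1])

section \<open>One-parameter shooting\<close>

lemma exit_set_openin:
  fixes X :: "'p::metric_space \<Rightarrow> real \<Rightarrow> 'a::heine_borel"
  assumes dep: "\<And>s s' t. 0 \<le> t \<Longrightarrow> dist (X s t) (X s' t) \<le> exp (L * t) * dist (X s 0) (X s' 0)"
    and init: "continuous_on S (\<lambda>s. X s 0)"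
    and cont: "\<And>s. continuous_on UNIV (X s)"
    and "0 \<le> L" "open U" "open V"
  shows "openin (top_of_set S) {s \<in> S. \<exists>t\<ge>0. X s t \<in> U \<and> (\<forall>\<tau>\<in>{0..t}. X s \<tau> \<in> V)}"
proof (subst openin_euclidean_subtopology_iff, intro conjI ballI)
  fix s assume "s \<in> {s \<in> S. \<exists>t\<ge>0. X s t \<in> U \<and> (\<forall>\<tau>\<in>{0..t}. X s \<tau> \<in> V)}"
  then obtain t where s: "s \<in> S" and t: "0 \<le> t" "X s t \<in> U" "X s ` {0..t} \<subseteq> V" by auto
  have "compact (X s ` {0..t})"
    by (intro compact_continuous_image continuous_on_subset[OF cont]) auto
  moreover have "X s ` {0..t} \<noteq> {}" using t by auto
  ultimately obtain e1 where e1: "0 < e1" "{x. infdist x (X s ` {0..t}) \<le> e1} \<subseteq> V"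
    using compact_in_open_separated[OF _ _ \<open>open V\<close> t(3)] by blast
  obtain e2 where e2: "0 < e2" "\<And>x. dist x (X s t) < e2 \<Longrightarrow> x \<in> U"
    using \<open>open U\<close> t(2) unfolding open_dist by blast
  define e where "e = min e1 e2 / exp (L * t)"
  have "0 < e" using e1 e2 by (auto simp: e_def)
  then obtain d where d: "0 < d" "\<And>s'. s' \<in> S \<Longrightarrow> dist s' s < d \<Longrightarrow> dist (X s' 0) (X s 0) < e"
    using init s unfolding continuous_on_iff by blast
  show "\<exists>e>0. \<forall>x'\<in>S. dist x' s < e \<longrightarrow> x' \<in> {s \<in> S. \<exists>t\<ge>0. X s t \<in> U \<and> (\<forall>\<tau>\<in>{0..t}. X s \<tau> \<in> V)}"
  proof (intro exI[of _ d] conjI ballI impI d(1))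
    fix s' assume s': "s' \<in> S" "dist s' s < d"
    have close: "dist (X s' \<tau>) (X s \<tau>) < min e1 e2" if "\<tau> \<in> {0..t}" for \<tau>
    proof -
      have "dist (X s' \<tau>) (X s \<tau>) \<le> exp (L * \<tau>) * dist (X s' 0) (X s 0)"
        using dep that by auto
      also have "\<dots> \<le> exp (L * t) * dist (X s' 0) (X s 0)"
        using that \<open>0 \<le> L\<close> by (intro mult_right_mono) (auto intro: mult_left_mono)
      also have "\<dots> < exp (L * t) * e"
        using d(2)[OF s'] by simp
      also have "\<dots> = min e1 e2" by (simp add: e_def)
      finally show ?thesis .
    qed
    have "X s' \<tau> \<in> V" if "\<tau> \<in> {0..t}" for \<tau>
    proof -
      have "infdist (X s' \<tau>) (X s ` {0..t}) \<le> dist (X s' \<tau>) (X s \<tau>)"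
        using that by (intro infdist_le) auto
      then show ?thesis using close[OF that] e1(2) by (auto simp: subset_iff)
    qed
    moreover have "X s' t \<in> U" using close[of t] t(1) e2(2) by auto
    ultimately show "s' \<in> {s \<in> S. \<exists>t\<ge>0. X s t \<in> U \<and> (\<forall>\<tau>\<in>{0..t}. X s \<tau> \<in> V)}"
      using s' t(1) by blast
  qed
qed auto

text \<open>One-parameter Wazewski principle: the two exit sets are open, disjoint and nonempty, so they
  cannot cover the parameter interval.\<close>

lemma shooting:
  fixes X :: "real \<Rightarrow> real \<Rightarrow> 'a::heine_borel"
  assumes "a \<le> b"
    and dep: "\<And>s s' t. 0 \<le> t \<Longrightarrow> dist (X s t) (X s' t) \<le> exp (L * t) * dist (X s 0) (X s' 0)"
    and init: "continuous_on {a..b} (\<lambda>s. X s 0)"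
    and cont: "\<And>s. continuous_on UNIV (X s)" and "0 \<le> L"
    and op: "open U1" "open V1" "open U2" "open V2"
    and disj: "U1 \<inter> V2 = {}" "U2 \<inter> V1 = {}"
    and ends: "X b 0 \<in> U1 \<inter> V1" "X a 0 \<in> U2 \<inter> V2"
  shows "\<exists>s\<in>{a..b}. \<not> (\<exists>t\<ge>0. X s t \<in> U1 \<and> (\<forall>\<tau>\<in>{0..t}. X s \<tau> \<in> V1)) \<and>
                   \<not> (\<exists>t\<ge>0. X s t \<in> U2 \<and> (\<forall>\<tau>\<in>{0..t}. X s \<tau> \<in> V2))"
proof (rule ccontr)
  define E where "E U V = {s \<in> {a..b}. \<exists>t\<ge>0. X s t \<in> U \<and> (\<forall>\<tau>\<in>{0..t}. X s \<tau> \<in> V)}" for U V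
  assume "\<not> ?thesis"
  then have cover: "{a..b} \<subseteq> E U1 V1 \<union> E U2 V2"
    unfolding E_def by blast
  have "openin (top_of_set {a..b}) (E U1 V1)" "openin (top_of_set {a..b}) (E U2 V2)"
    unfolding E_def using exit_set_openin[OF dep init cont \<open>0 \<le> L\<close>] op by blast+
  moreover have "E U1 V1 \<inter> E U2 V2 = {}"
  proof (rule ccontr)
    assume "E U1 V1 \<inter> E U2 V2 \<noteq> {}"
    then obtain s t1 t2 where "0 \<le> t1" "X s t1 \<in> U1" "\<forall>\<tau>\<in>{0..t1}. X s \<tau> \<in> V1"
      "0 \<le> t2" "X s t2 \<in> U2" "\<forall>\<tau>\<in>{0..t2}. X s \<tau> \<in> V2"
      unfolding E_def by blast
    then show False using disj by (cases "t1 \<le> t2") (auto simp: disjoint_iff)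
  qed
  moreover have "b \<in> E U1 V1" "a \<in> E U2 V2"
    unfolding E_def using ends \<open>a \<le> b\<close> by (auto intro!: exI[of _ 0])
  ultimately show False
    using connected_Icc[of a b] cover unfolding connected_openin by blast
qed

section \<open>The isolating block\<close>

text \<open>Here \<open>c\<close> stands for \<open>\<omega> / (\<Lambda> - 1)\<close> and \<open>\<epsilon>\<close> for \<open>1 / sqrt (\<Lambda> - 1)\<close>.\<close>

locale gp_block =
  fixes c \<epsilon> :: real
  assumes c: "0 < c" "c < 1/2" and \<epsilon>: "0 < \<epsilon>" "\<epsilon> \<le> c^3 / 100"
begin

text \<open>\<open>K\<close> is the width of the block in the unstable direction, \<open>K2\<close> in the stable one, and \<open>K'\<close>
  lies in between and bounds the shooting parameter. Taking \<open>K2 = K\<close> would not do: the factor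
  \<open>1 + c\<close> leaves a margin at the stable faces at the initial time, and any larger constant factor
  would destroy the outward crossing of the unstable faces when \<open>r\<close> is small.\<close>

definition "K = 8 / c"
definition "K' = K * (1 + c/2)"
definition "K2 = K * (1 + c)"

lemma K_bounds: "0 < K" "K < K'" "K' < K2" "c * K = 8" "K2 \<le> 12 / c"
  using c by (auto simp: K_def K'_def K2_def field_simps)

lemma K2_small: "K2 * \<epsilon> \<le> 3/25 * c^2" "K2 * \<epsilon> \<le> 3/100" "K * \<epsilon> \<le> 3/100" "K2 * \<epsilon>^2 \<le> c / 4" "\<epsilon> \<le> 1/800"
proof -
  have "K2 * \<epsilon> \<le> 12 / c * (c^3 / 100)"
    using K_bounds \<epsilon> c by (intro mult_mono) auto
  also have "\<dots> = 3/25 * c^2" using c by (simp add: field_simps power2_eq_square power3_eq_cube)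
  finally show 1: "K2 * \<epsilon> \<le> 3/25 * c^2" .
  have c2: "c^2 \<le> 1/4" using power_mono[of c "1/2" 2] c by (simp add: power2_eq_square)
  then show 2: "K2 * \<epsilon> \<le> 3/100" using 1 by simp
  have "K * \<epsilon> \<le> K2 * \<epsilon>" using K_bounds \<epsilon> by (intro mult_right_mono) auto
  then show "K * \<epsilon> \<le> 3/100" using 2 by simp
  have "c^3 \<le> 1/8" using power_mono[of c "1/2" 3] c by (simp add: power3_eq_cube)
  then show e: "\<epsilon> \<le> 1/800" using \<epsilon> by simp
  have "K2 * \<epsilon>^2 = K2 * \<epsilon> * \<epsilon>" by (simp add: power2_eq_square)
  also have "\<dots> \<le> 3/25 * c^2 * 1"
    by (rule mult_mono[OF 1]) (use e \<epsilon> in auto)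
  also have "\<dots> \<le> c/4" using c by (simp add: power2_eq_square)
  finally show "K2 * \<epsilon>^2 \<le> c / 4" .
qed

lemma block_bounds:
  fixes u v p q :: real
  defines "w \<equiv> u * v - c" and "y \<equiv> p * v + q * u" and "g \<equiv> 1 - u^2 - v^2"
  assumes energy: "p^2 + q^2 = g^2 / 2 + w^2 / \<epsilon>^2"
    and A: "\<bar>w + \<epsilon> * y\<bar> \<le> K2 * \<epsilon>^2 * g" and B: "\<bar>w - \<epsilon> * y\<bar> \<le> K2 * \<epsilon>^2 * g"
  shows "0 \<le> g" "\<bar>w\<bar> \<le> K2 * \<epsilon>^2 * g" "\<bar>y\<bar> \<le> K2 * \<epsilon> * g" "w^2 / \<epsilon>^2 \<le> (K2 * \<epsilon> * g)^2"
    "3/4 * c \<le> u * v" "c \<le> u^2 + v^2" "p^2 + q^2 \<le> g^2"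
    "\<bar>2 * p * q - 2 * u * v * g\<bar> \<le> 2 * g" "\<bar>2 * (u * p + v * q)\<bar> \<le> 2 * g"
proof -
  have "0 \<le> K2 * \<epsilon>^2 * g" using A by linarith
  moreover have "0 < K2 * \<epsilon>^2" using K_bounds \<epsilon> by simp
  ultimately show g: "0 \<le> g" by (simp add: zero_le_mult_iff)
  then have g1: "g \<le> 1" by (simp add: g_def)
  show w: "\<bar>w\<bar> \<le> K2 * \<epsilon>^2 * g" using A B by linarith
  have "\<epsilon> * \<bar>y\<bar> = \<bar>\<epsilon> * y\<bar>" using \<epsilon> by (simp add: abs_mult)
  also have "\<dots> \<le> K2 * \<epsilon>^2 * g" using A B by linarith
  also have "\<dots> = \<epsilon> * (K2 * \<epsilon> * g)" by (simp add: power2_eq_square)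
  finally have "\<epsilon> * \<bar>y\<bar> \<le> \<epsilon> * (K2 * \<epsilon> * g)" .
  then show y: "\<bar>y\<bar> \<le> K2 * \<epsilon> * g" using \<epsilon> by simp
  have "w^2 \<le> (K2 * \<epsilon>^2 * g)^2"
    using power_mono[OF w, of 2] by simp
  then show w2: "w^2 / \<epsilon>^2 \<le> (K2 * \<epsilon> * g)^2"
    using \<epsilon> by (simp add: field_simps power_mult_distrib)
  have "K2 * \<epsilon>^2 * g \<le> c / 4 * 1"
    using K2_small(4) g g1 c K_bounds by (intro mult_mono) auto
  then show uv_lower: "3/4 * c \<le> u * v" using w by (simp add: w_def)
  have "2 * (u * v) \<le> u^2 + v^2" using sum_squares_bound[of u v] by simp
  then show r: "c \<le> u^2 + v^2" using uv_lower c by linarith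
  have "(K2 * \<epsilon> * g)^2 \<le> (3/100 * g)^2"
    using K2_small(2) g K_bounds \<epsilon> by (intro power_mono mult_right_mono) auto
  also have "\<dots> = 9/10000 * g^2" by (simp add: power_mult_distrib power_divide)
  finally have "w^2 / \<epsilon>^2 \<le> g^2 / 2" using w2 zero_le_power2[of g] by linarith
  then show pq: "p^2 + q^2 \<le> g^2" using energy by linarith
  have gg: "g^2 \<le> g" using g g1 by (simp add: power2_eq_square mult_left_le)
  have "\<bar>2 * p * q\<bar> \<le> p^2 + q^2"
    using sum_squares_bound[of p q] sum_squares_bound[of p "-q"] by auto
  moreover have "\<bar>2 * u * v * g\<bar> \<le> 1 * g"
  proof -
    have "\<bar>2 * u * v\<bar> \<le> u^2 + v^2"
      using sum_squares_bound[of u v] sum_squares_bound[of u "-v"] by auto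
    also have "\<dots> \<le> 1" using g by (simp add: g_def)
    finally have "\<bar>2 * u * v\<bar> * g \<le> 1 * g"
      using g by (intro mult_right_mono) auto
    then show ?thesis using g by (simp add: abs_mult)
  qed
  ultimately show "\<bar>2 * p * q - 2 * u * v * g\<bar> \<le> 2 * g" using pq gg by linarith
  have "(u * p + v * q)^2 + (u * q - v * p)^2 = (u^2 + v^2) * (p^2 + q^2)"
    by (simp add: power2_eq_square algebra_simps)
  also have "\<dots> \<le> 1 * g^2"
    using pq g by (intro mult_mono) (auto simp: g_def)
  finally have "(u * p + v * q)^2 \<le> g^2"
    using zero_le_power2[of "u * q - v * p"] by linarith
  then have "\<bar>u * p + v * q\<bar> \<le> g"
    using g by (metis abs_le_square_iff abs_of_nonneg)
  then show "\<bar>2 * (u * p + v * q)\<bar> \<le> 2 * g" unfolding abs_mult by simp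
qed

lemma face_derivs:
  fixes u v p q \<sigma> :: real
  defines "w \<equiv> u * v - c" and "y \<equiv> p * v + q * u" and "g \<equiv> 1 - u^2 - v^2"
  defines "y' \<equiv> (u^2 + v^2) * w / \<epsilon>^2 + (2 * p * q - 2 * u * v * g)" and "g' \<equiv> - 2 * (u * p + v * q)"
  assumes energy: "p^2 + q^2 = g^2 / 2 + w^2 / \<epsilon>^2" and "0 < g" and \<sigma>: "\<sigma> = 1 \<or> \<sigma> = -1"
    and A: "\<bar>w + \<epsilon> * y\<bar> \<le> K * \<epsilon>^2 * g" and B: "\<bar>w - \<epsilon> * y\<bar> \<le> K2 * \<epsilon>^2 * g"
  shows "\<sigma> * (w + \<epsilon> * y) = K * \<epsilon>^2 * g \<Longrightarrow> K * \<epsilon>^2 * g' < \<sigma> * (y + \<epsilon> * y')"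
    and "\<sigma> * (w - \<epsilon> * y) = K2 * \<epsilon>^2 * g \<Longrightarrow> \<sigma> * (y - \<epsilon> * y') < K2 * \<epsilon>^2 * g'"
proof -
  define r where "r = u^2 + v^2"
  define f where "f = 2 * p * q - 2 * u * v * g"
  have "K * \<epsilon>^2 * g \<le> K2 * \<epsilon>^2 * g"
    using K_bounds \<open>0 < g\<close> by (intro mult_right_mono) auto
  then have A': "\<bar>w + \<epsilon> * y\<bar> \<le> K2 * \<epsilon>^2 * g" using A by linarith
  note bb = block_bounds[OF energy[unfolded w_def g_def] A'[unfolded w_def y_def g_def] B[unfolded w_def y_def g_def],
      folded w_def y_def g_def]
  have f: "\<bar>f\<bar> \<le> 2 * g" using bb(8) by (simp add: f_def)
  have g': "\<bar>g'\<bar> \<le> 2 * g" using bb(9) by (simp add: g'_def)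
  have r: "c \<le> r" "r \<le> 1" using bb(6) \<open>0 < g\<close> by (auto simp: r_def g_def)
  have f\<sigma>: "- (2 * g) \<le> \<sigma> * f" "\<sigma> * f \<le> 2 * g" using f \<sigma> by auto
  have e2: "0 < \<epsilon>^2 * g" using \<epsilon> \<open>0 < g\<close> by simp
  have yeq: "\<epsilon> * y' = r * w / \<epsilon> + \<epsilon> * f"
    using \<epsilon> by (simp add: y'_def r_def f_def field_simps power2_eq_square)
  have eqA: "2 * \<epsilon> * (y + \<epsilon> * y') = (1 + r) * (w + \<epsilon> * y) - (1 - r) * (w - \<epsilon> * y) + 2 * \<epsilon>^2 * f"
    and eqB: "2 * \<epsilon> * (y - \<epsilon> * y') = (1 - r) * (w + \<epsilon> * y) - (1 + r) * (w - \<epsilon> * y) - 2 * \<epsilon>^2 * f"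
    unfolding yeq using \<epsilon> by (simp_all add: field_simps power2_eq_square)
  have small: "K * \<epsilon> \<le> 3/100" "K2 * \<epsilon> \<le> 3/100" by (rule K2_small)+
  {
    assume face: "\<sigma> * (w + \<epsilon> * y) = K * \<epsilon>^2 * g"
    have "\<sigma> * (w - \<epsilon> * y) \<le> K2 * \<epsilon>^2 * g" using B \<sigma> by auto
    then have "(1 - r) * (\<sigma> * (w - \<epsilon> * y)) \<le> (1 - r) * (K2 * \<epsilon>^2 * g)"
      using r by (intro mult_left_mono) auto
    moreover have "2 * \<epsilon>^2 * - (2 * g) \<le> 2 * \<epsilon>^2 * (\<sigma> * f)"
      by (rule mult_left_mono[OF f\<sigma>(1)]) simp
    moreover have "2 * \<epsilon> * (\<sigma> * (y + \<epsilon> * y')) =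
        (1 + r) * (\<sigma> * (w + \<epsilon> * y)) - (1 - r) * (\<sigma> * (w - \<epsilon> * y)) + 2 * \<epsilon>^2 * (\<sigma> * f)"
    proof -
      have "2 * \<epsilon> * (\<sigma> * (y + \<epsilon> * y')) = \<sigma> * (2 * \<epsilon> * (y + \<epsilon> * y'))"
        by (simp only: mult_ac)
      also note eqA
      finally show ?thesis by (simp only: algebra_simps)
    qed
    ultimately have "2 * \<epsilon> * (\<sigma> * (y + \<epsilon> * y')) \<ge>
        (1 + r) * (K * \<epsilon>^2 * g) - (1 - r) * (K2 * \<epsilon>^2 * g) - 2 * \<epsilon>^2 * (2 * g)"
      unfolding face by linarith
    also have "(1 + r) * (K * \<epsilon>^2 * g) - (1 - r) * (K2 * \<epsilon>^2 * g) - 2 * \<epsilon>^2 * (2 * g)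
        = \<epsilon>^2 * g * (K * (2 * r - c + r * c) - 4)"
      by (simp add: K2_def algebra_simps)
    also have "\<epsilon>^2 * g * (K * (2 * r - c + r * c) - 4) \<ge> \<epsilon>^2 * g * 4"
    proof (rule mult_left_mono)
      have "0 \<le> r * c" using r c by auto
      then have "K * c \<le> K * (2 * r - c + r * c)"
        using r K_bounds by (intro mult_left_mono) auto
      then show "4 \<le> K * (2 * r - c + r * c) - 4" using K_bounds(4) by (simp add: mult.commute)
    qed (use e2 in simp)
    finally have 1: "\<epsilon>^2 * g * 4 \<le> 2 * \<epsilon> * (\<sigma> * (y + \<epsilon> * y'))" .
    have "2 * \<epsilon> * (K * \<epsilon>^2 * g') = 2 * (K * \<epsilon>) * \<epsilon>^2 * g'" by simp
    also have "\<dots> \<le> 2 * (K * \<epsilon>) * \<epsilon>^2 * (2 * g)"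
      using g' K_bounds \<epsilon> by (intro mult_left_mono) auto
    also have "\<dots> \<le> 2 * (3/100) * \<epsilon>^2 * (2 * g)"
      using small \<open>0 < g\<close> by (intro mult_right_mono mult_left_mono) auto
    also have "\<dots> < \<epsilon>^2 * g * 4" using e2 by (simp add: mult.commute)
    finally have "2 * \<epsilon> * (K * \<epsilon>^2 * g') < 2 * \<epsilon> * (\<sigma> * (y + \<epsilon> * y'))" using 1 by linarith
    then show "K * \<epsilon>^2 * g' < \<sigma> * (y + \<epsilon> * y')" using \<epsilon> by simp
  }
  {
    assume face: "\<sigma> * (w - \<epsilon> * y) = K2 * \<epsilon>^2 * g"
    have "\<sigma> * (w + \<epsilon> * y) \<le> K * \<epsilon>^2 * g" using A \<sigma> by auto
    then have "(1 - r) * (\<sigma> * (w + \<epsilon> * y)) \<le> (1 - r) * (K * \<epsilon>^2 * g)"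
      using r by (intro mult_left_mono) auto
    moreover have "2 * \<epsilon>^2 * - (2 * g) \<le> 2 * \<epsilon>^2 * (\<sigma> * f)"
      by (rule mult_left_mono[OF f\<sigma>(1)]) simp
    moreover have "2 * \<epsilon> * (\<sigma> * (y - \<epsilon> * y')) =
        (1 - r) * (\<sigma> * (w + \<epsilon> * y)) - (1 + r) * (\<sigma> * (w - \<epsilon> * y)) - 2 * \<epsilon>^2 * (\<sigma> * f)"
    proof -
      have "2 * \<epsilon> * (\<sigma> * (y - \<epsilon> * y')) = \<sigma> * (2 * \<epsilon> * (y - \<epsilon> * y'))"
        by (simp only: mult_ac)
      also note eqB
      finally show ?thesis by (simp only: algebra_simps)
    qed
    ultimately have "2 * \<epsilon> * (\<sigma> * (y - \<epsilon> * y')) \<le>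
        (1 - r) * (K * \<epsilon>^2 * g) - (1 + r) * (K2 * \<epsilon>^2 * g) + 2 * \<epsilon>^2 * (2 * g)"
      unfolding face by linarith
    also have "\<dots> = \<epsilon>^2 * g * (4 - K * (2 * r + c + r * c))"
      by (simp add: K2_def algebra_simps)
    also have "\<dots> \<le> \<epsilon>^2 * g * (- 4)"
    proof (rule mult_left_mono)
      have "0 \<le> r * c" using r c by auto
      then have "K * c \<le> K * (2 * r + c + r * c)"
        using r K_bounds c by (intro mult_left_mono) auto
      then show "4 - K * (2 * r + c + r * c) \<le> - 4" using K_bounds(4) by (simp add: mult.commute)
    qed (use e2 in simp)
    finally have 1: "2 * \<epsilon> * (\<sigma> * (y - \<epsilon> * y')) \<le> \<epsilon>^2 * g * (- 4)" .
    have "2 * \<epsilon> * (K2 * \<epsilon>^2 * - g') = 2 * (K2 * \<epsilon>) * \<epsilon>^2 * (- g')" by simp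
    also have "\<dots> \<le> 2 * (K2 * \<epsilon>) * \<epsilon>^2 * (2 * g)"
      using g' K_bounds \<epsilon> by (intro mult_left_mono) auto
    also have "\<dots> \<le> 2 * (3/100) * \<epsilon>^2 * (2 * g)"
      using small \<open>0 < g\<close> by (intro mult_right_mono mult_left_mono) auto
    also have "\<dots> < \<epsilon>^2 * g * 4" using e2 by (simp add: mult.commute)
    finally have "2 * \<epsilon> * (\<sigma> * (y - \<epsilon> * y')) < 2 * \<epsilon> * (K2 * \<epsilon>^2 * g')" using 1 by linarith
    then show "\<sigma> * (y - \<epsilon> * y') < K2 * \<epsilon>^2 * g'" using \<epsilon> by simp
  }
qed

definition accel :: "real \<Rightarrow> real \<Rightarrow> real" where
  "accel u v = (u^2 + v^2 - 1) * u + (u * v - c) * v / \<epsilon>^2"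

definition field :: "real \<times> real \<times> real \<times> real \<Rightarrow> real \<times> real \<times> real \<times> real" where
  "field z = (fst (snd (snd z)), snd (snd (snd z)),
     accel (fst z) (fst (snd z)), accel (fst (snd z)) (fst z))"

text \<open>Clamping the state makes the field globally Lipschitz; inside the block the clamp is inactive.\<close>

definition box_lo :: "real \<times> real \<times> real \<times> real" where "box_lo = (-2, -2, -2, -2)"
definition box_hi :: "real \<times> real \<times> real \<times> real" where "box_hi = (2, 2, 2, 2)"

lemma in_box_iff:
  "(u, v, p, q) \<in> cbox box_lo box_hi \<longleftrightarrow> \<bar>u\<bar> \<le> 2 \<and> \<bar>v\<bar> \<le> 2 \<and> \<bar>p\<bar> \<le> 2 \<and> \<bar>q\<bar> \<le> 2"
  by (auto simp: box_lo_def box_hi_def cbox_Pair_eq abs_le_iff)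

definition cfield :: "real \<times> real \<times> real \<times> real \<Rightarrow> real \<times> real \<times> real \<times> real" where
  "cfield z = field (clamp box_lo box_hi z)"

lemma cfield_lipschitz: "\<exists>L. L-lipschitz_on UNIV cfield"
proof -
  define S where "S = cbox box_lo box_hi"
  have S: "bounded S" by (simp add: S_def bounded_cbox)
  have "\<exists>L. L-lipschitz_on S (\<lambda>z. (fst (snd (snd z)), snd (snd (snd z)),
      (fst z * fst z + fst (snd z) * fst (snd z) + (-1)) * fst z + (fst z * fst (snd z) + (-c)) * (fst (snd z) * (1 / \<epsilon>^2)),
      (fst (snd z) * fst (snd z) + fst z * fst z + (-1)) * fst (snd z) + (fst (snd z) * fst z + (-c)) * (fst z * (1 / \<epsilon>^2))))"
    by (intro lipschitz_on_Pair_ex lipschitz_on_add_ex lipschitz_on_mult_bounded[OF S] lipschitz_on_const_ex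
      lipschitz_on_fst_ex lipschitz_on_snd_ex lipschitz_on_ident_ex)
  also have "(\<lambda>z. (fst (snd (snd z)), snd (snd (snd z)),
      (fst z * fst z + fst (snd z) * fst (snd z) + (-1)) * fst z + (fst z * fst (snd z) + (-c)) * (fst (snd z) * (1 / \<epsilon>^2)),
      (fst (snd z) * fst (snd z) + fst z * fst z + (-1)) * fst (snd z) + (fst (snd z) * fst z + (-c)) * (fst z * (1 / \<epsilon>^2)))) = field"
    by (auto simp: field_def accel_def power2_eq_square intro!: ext)
  finally obtain L where L: "L-lipschitz_on S field" by blast
  have "L-lipschitz_on UNIV cfield"
    unfolding cfield_def
    by (rule lipschitz_on_clamp[OF L[unfolded S_def]])
      (auto simp: box_lo_def box_hi_def Basis_prod_def)
  then show ?thesis by blast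
qed

definition gap :: "real \<times> real \<times> real \<times> real \<Rightarrow> real" where
  "gap z = 1 - (fst z)^2 - (fst (snd z))^2"

text \<open>With \<open>w = u v - c\<close>, the equation \<open>w'' = (u\<^sup>2 + v\<^sup>2) w / \<epsilon>\<^sup>2 + O(gap)\<close> makes \<open>w + \<epsilon> w'\<close>
  expand and \<open>w - \<epsilon> w'\<close> contract on the time scale \<open>\<epsilon>\<close>.\<close>

definition unst :: "real \<times> real \<times> real \<times> real \<Rightarrow> real" where
  "unst z = (fst z * fst (snd z) - c) + \<epsilon> * (fst (snd (snd z)) * fst (snd z) + snd (snd (snd z)) * fst z)"

definition stab :: "real \<times> real \<times> real \<times> real \<Rightarrow> real" where
  "stab z = (fst z * fst (snd z) - c) - \<epsilon> * (fst (snd (snd z)) * fst (snd z) + snd (snd (snd z)) * fst z)"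

definition zero_energy :: "real \<times> real \<times> real \<times> real \<Rightarrow> bool" where
  "zero_energy z \<longleftrightarrow> (fst (snd (snd z)))^2 + (snd (snd (snd z)))^2 = (gap z)^2 / 2 + (fst z * fst (snd z) - c)^2 / \<epsilon>^2"

definition tube :: "(real \<times> real \<times> real \<times> real) set" where
  "tube = {z. \<bar>stab z\<bar> < K2 * \<epsilon>^2 * gap z \<and> \<bar>fst (snd (snd z))\<bar> < 2 \<and> \<bar>snd (snd (snd z))\<bar> < 2}"

definition above :: "real \<Rightarrow> (real \<times> real \<times> real \<times> real) set" where
  "above \<sigma> = {z. K * \<epsilon>^2 * gap z < \<sigma> * unst z}"

definition below :: "real \<Rightarrow> (real \<times> real \<times> real \<times> real) set" where
  "below \<sigma> = {z. \<sigma> * unst z < K * \<epsilon>^2 * gap z}"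

lemma open_sets: "open tube" "open (above \<sigma>)" "open (below \<sigma>)"
  unfolding tube_def above_def below_def gap_def unst_def stab_def
  by (intro open_Collect_conj open_Collect_less continuous_intros)+

lemma tube_gap: "z \<in> tube \<Longrightarrow> 0 < gap z"
proof -
  assume "z \<in> tube"
  then have "0 < K2 * \<epsilon>^2 * gap z" by (auto simp: tube_def)
  moreover have "0 < K2 * \<epsilon>^2" using K_bounds \<epsilon> by simp
  ultimately show "0 < gap z" by (simp add: zero_less_mult_iff)
qed

lemma gap_in_box:
  assumes "0 < gap z" "\<bar>fst (snd (snd z))\<bar> < 2" "\<bar>snd (snd (snd z))\<bar> < 2"
  shows "cfield z = field z"
proof -
  obtain u v p q where z: "z = (u, v, p, q)" by (cases z)
  have "u^2 < 1" "v^2 < 1"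
    using assms(1) zero_le_power2[of u] zero_le_power2[of v] unfolding z gap_def fst_conv snd_conv by linarith+
  then have "\<bar>u\<bar> \<le> 2" "\<bar>v\<bar> \<le> 2"
    by (auto simp: abs_square_less_1)
  then have "z \<in> cbox box_lo box_hi" using assms unfolding z by (auto simp: in_box_iff)
  then show ?thesis by (simp add: cfield_def)
qed

lemma coords_deriv:
  assumes X: "(X has_vector_derivative field (X t)) (at t)"
  defines "u \<equiv> \<lambda>t. fst (X t)" and "v \<equiv> \<lambda>t. fst (snd (X t))"
    and "p \<equiv> \<lambda>t. fst (snd (snd (X t)))" and "q \<equiv> \<lambda>t. snd (snd (snd (X t)))"
  shows "(u has_real_derivative p t) (at t)" "(v has_real_derivative q t) (at t)"
    "(p has_real_derivative accel (u t) (v t)) (at t)" "(q has_real_derivative accel (v t) (u t)) (at t)"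
proof -
  note * = bounded_linear.has_vector_derivative[OF bounded_linear_fst]
    bounded_linear.has_vector_derivative[OF bounded_linear_snd]
  have 1: "(u has_vector_derivative fst (field (X t))) (at t)"
    unfolding u_def by (rule *[OF X])
  have 2: "(v has_vector_derivative fst (snd (field (X t)))) (at t)"
    unfolding v_def by (rule * X)+
  have 3: "(p has_vector_derivative fst (snd (snd (field (X t))))) (at t)"
    unfolding p_def by (rule * X)+
  have 4: "(q has_vector_derivative snd (snd (snd (field (X t))))) (at t)"
    unfolding q_def by (rule * X)+
  from 1 2 3 4 show "(u has_real_derivative p t) (at t)" "(v has_real_derivative q t) (at t)"
    "(p has_real_derivative accel (u t) (v t)) (at t)" "(q has_real_derivative accel (v t) (u t)) (at t)"
    by (simp_all add: has_real_derivative_iff_has_vector_derivative field_def u_def v_def p_def q_def)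
qed

lemma derived_derivs:
  fixes u v p q :: "real \<Rightarrow> real"
  assumes d: "(u has_real_derivative p t) (at t)" "(v has_real_derivative q t) (at t)"
    "(p has_real_derivative accel (u t) (v t)) (at t)" "(q has_real_derivative accel (v t) (u t)) (at t)"
  defines "g \<equiv> \<lambda>t. 1 - (u t)^2 - (v t)^2" and "w \<equiv> \<lambda>t. u t * v t - c" and "y \<equiv> \<lambda>t. p t * v t + q t * u t"
  shows "(g has_real_derivative - 2 * (u t * p t + v t * q t)) (at t)"
    "(w has_real_derivative y t) (at t)"
    "(y has_real_derivative ((u t)^2 + (v t)^2) * w t / \<epsilon>^2 + (2 * p t * q t - 2 * u t * v t * g t)) (at t)"
    "((\<lambda>t. (p t)^2 + (q t)^2 - (g t)^2 / 2 - (w t)^2 / \<epsilon>^2) has_real_derivative 0) (at t)"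
proof -
  show g: "(g has_real_derivative - 2 * (u t * p t + v t * q t)) (at t)"
    unfolding g_def using d by (auto intro!: derivative_eq_intros simp: algebra_simps)
  show w: "(w has_real_derivative y t) (at t)"
    unfolding w_def y_def using d by (auto intro!: derivative_eq_intros simp: algebra_simps)
  show "(y has_real_derivative ((u t)^2 + (v t)^2) * w t / \<epsilon>^2 + (2 * p t * q t - 2 * u t * v t * g t)) (at t)"
    unfolding y_def using d \<epsilon>
    by (auto intro!: derivative_eq_intros simp: accel_def g_def w_def field_simps power2_eq_square)
  have "((\<lambda>t. (p t)^2 + (q t)^2 - (g t)^2 / 2 - k * (w t)^2) has_real_derivative
      2 * p t * accel (u t) (v t) + 2 * q t * accel (v t) (u t) - g t * (- 2 * (u t * p t + v t * q t)) - k * (2 * w t * y t)) (at t)" for k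
    using d g w by (auto intro!: derivative_eq_intros)
  from this[of "1 / \<epsilon>^2"] have "((\<lambda>t. (p t)^2 + (q t)^2 - (g t)^2 / 2 - (w t)^2 / \<epsilon>^2) has_real_derivative
      2 * p t * accel (u t) (v t) + 2 * q t * accel (v t) (u t) - g t * (- 2 * (u t * p t + v t * q t)) - 2 * w t * y t / \<epsilon>^2) (at t)"
    by simp
  moreover have "2 * p t * accel (u t) (v t) + 2 * q t * accel (v t) (u t) - g t * (- 2 * (u t * p t + v t * q t)) - 2 * w t * y t / \<epsilon>^2 = 0"
    using \<epsilon> by (simp add: accel_def g_def w_def y_def field_simps power2_eq_square)
  ultimately show "((\<lambda>t. (p t)^2 + (q t)^2 - (g t)^2 / 2 - (w t)^2 / \<epsilon>^2) has_real_derivative 0) (at t)"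
    by simp
qed

section \<open>The trapped orbit\<close>

lemma trapped:
  assumes X: "\<And>t. (X has_vector_derivative cfield (X t)) (at t)"
    and E0: "zero_energy (X 0)" and AB: "unst (X 0) = stab (X 0)" and Q0: "X 0 \<in> tube"
    and noexit: "\<And>\<sigma>. \<sigma> = 1 \<or> \<sigma> = -1 \<Longrightarrow>
      \<not> (\<exists>t\<ge>0. X t \<in> above \<sigma> \<and> (\<forall>\<tau>\<in>{0..t}. X \<tau> \<in> below (-\<sigma>) \<inter> tube))"
    and "0 \<le> t"
  shows "X t \<in> below 1 \<inter> below (-1) \<inter> tube \<and> zero_energy (X t)"
proof -
  define Good where "Good = below 1 \<inter> below (-1) \<inter> tube"
  have op: "open Good" unfolding Good_def by (intro open_Int open_sets)
  have contX: "continuous_on S X" for S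
    using X by (meson continuous_at_imp_continuous_on has_vector_derivative_continuous)
  define u v p q where "u t = fst (X t)" and "v t = fst (snd (X t))"
    and "p t = fst (snd (snd (X t)))" and "q t = snd (snd (snd (X t)))" for t
  define g w y where "g t = 1 - (u t)^2 - (v t)^2" and "w t = u t * v t - c" and "y t = p t * v t + q t * u t" for t
  define g' y' where "g' t = - 2 * (u t * p t + v t * q t)"
    and "y' t = ((u t)^2 + (v t)^2) * w t / \<epsilon>^2 + (2 * p t * q t - 2 * u t * v t * g t)" for t
  have tr: "gap (X t) = g t" "unst (X t) = w t + \<epsilon> * y t" "stab (X t) = w t - \<epsilon> * y t"
    "zero_energy (X t) \<longleftrightarrow> (p t)^2 + (q t)^2 = (g t)^2 / 2 + (w t)^2 / \<epsilon>^2" for t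
    by (simp_all add: gap_def unst_def stab_def zero_energy_def u_def v_def p_def q_def g_def w_def y_def)
  have pq: "fst (snd (snd (X t))) = p t" "snd (snd (snd (X t))) = q t" for t
    by (simp_all add: p_def q_def)
  define En where "En t = (p t)^2 + (q t)^2 - (g t)^2 / 2 - (w t)^2 / \<epsilon>^2" for t
  have cont: "continuous_on S u" "continuous_on S v" "continuous_on S p" "continuous_on S q" for S
    unfolding u_def v_def p_def q_def by (intro continuous_intros contX)+
  have cont': "continuous_on S g" "continuous_on S w" "continuous_on S y" "continuous_on S En" for S
    unfolding En_def g_def w_def y_def by (intro continuous_intros cont; use \<epsilon> in simp)+
  have der: "(g has_real_derivative g' t) (at t)" "(w has_real_derivative y t) (at t)"
    "(y has_real_derivative y' t) (at t)" "(En has_real_derivative 0) (at t)"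
    if "0 < g t" "\<bar>p t\<bar> < 2" "\<bar>q t\<bar> < 2" for t
  proof -
    have "cfield (X t) = field (X t)"
      using that by (intro gap_in_box) (simp_all add: tr pq)
    then have "(X has_vector_derivative field (X t)) (at t)" using X[of t] by simp
    note 1 = coords_deriv[OF this, folded u_def v_def p_def q_def, unfolded pq]
    have "(u has_real_derivative p t) (at t)" "(v has_real_derivative q t) (at t)"
    "(p has_real_derivative accel (u t) (v t)) (at t)" "(q has_real_derivative accel (v t) (u t)) (at t)"
      using 1 by (simp_all add: u_def[abs_def] v_def[abs_def] p_def[abs_def] q_def[abs_def])
    note 2 = derived_derivs[OF this]
    show "(g has_real_derivative g' t) (at t)" "(w has_real_derivative y t) (at t)"
      "(y has_real_derivative y' t) (at t)" "(En has_real_derivative 0) (at t)"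
      using 2 unfolding g_def[abs_def] w_def[abs_def] y_def[abs_def] g'_def y'_def En_def[abs_def] by simp_all
  qed
  have energy_imp: "\<bar>p t\<bar> < 2 \<and> \<bar>q t\<bar> < 2"
    if "En t = 0" "\<bar>w t + \<epsilon> * y t\<bar> \<le> K * \<epsilon>^2 * g t" "\<bar>w t - \<epsilon> * y t\<bar> \<le> K2 * \<epsilon>^2 * g t" "0 < g t" for t
  proof -
    have "K * \<epsilon>^2 * g t \<le> K2 * \<epsilon>^2 * g t"
      using K_bounds \<open>0 < g t\<close> by (intro mult_right_mono) auto
    then have "(p t)^2 + (q t)^2 \<le> (g t)^2"
      using that by (intro block_bounds(7)[of "p t" "q t" "u t" "v t", folded g_def w_def y_def]) (auto simp: En_def)
    also have "\<dots> \<le> 1"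
      using that(4) zero_le_power2[of "u t"] zero_le_power2[of "v t"] by (intro power_le_one) (auto simp: g_def simp del: zero_le_power2)
    finally have "(p t)^2 < 4" "(q t)^2 < 4"
      using zero_le_power2[of "p t"] zero_le_power2[of "q t"] by linarith+
    then show ?thesis
      using power_less_imp_less_base[of "\<bar>p t\<bar>" 2 2] power_less_imp_less_base[of "\<bar>q t\<bar>" 2 2] by simp
  qed
  have good_imp: "0 < g t" "\<bar>p t\<bar> < 2" "\<bar>q t\<bar> < 2" "\<bar>w t + \<epsilon> * y t\<bar> < K * \<epsilon>^2 * g t" "\<bar>w t - \<epsilon> * y t\<bar> < K2 * \<epsilon>^2 * g t"
    if "X t \<in> Good" for t
    using that tube_gap[of "X t"] by (auto simp: Good_def tube_def below_def tr pq abs_less_iff)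
  have En_const: "En s = 0" if "0 \<le> s" "\<And>t. 0 \<le> t \<Longrightarrow> t < s \<Longrightarrow> X t \<in> Good" for s
  proof (cases "s = 0")
    case True then show ?thesis using E0 by (simp add: En_def tr)
  next
    case False
    then have "0 < s" using that by simp
    have "En s = En 0"
      by (rule DERIV_isconst_end[OF \<open>0 < s\<close> cont'(4)]) (use der(4) good_imp that in auto)
    then show ?thesis using E0 by (simp add: En_def tr)
  qed
  have all_good: "X t \<in> Good" if "0 \<le> t" for t
  proof (rule ccontr)
    assume bad: "X t \<notin> Good"
    define T where "T = {0..} \<inter> X -` (- Good)"
    have "closed T"
      unfolding T_def by (intro continuous_closed_preimage contX) (use op in auto)
    moreover have Tne: "T \<noteq> {}" and bd: "bdd_below T" using bad that by (auto simp: T_def)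
    ultimately have "Inf T \<in> T" by (intro closed_contains_Inf)
    define s where "s = Inf T"
    have s: "0 \<le> s" "X s \<notin> Good" using \<open>Inf T \<in> T\<close> by (auto simp: T_def s_def)
    have before: "X \<tau> \<in> Good" if "0 \<le> \<tau>" "\<tau> < s" for \<tau>
      using that cInf_lower[OF _ bd, of \<tau>] by (force simp: T_def s_def)
    have Es: "En s = 0" using En_const s before by blast
    have Qs: "X s \<in> tube"
    proof (cases "s = 0")
      case True then show ?thesis using Q0 by simp
    next
      case False
      then have "0 < s" using s by simp
      have lim: "0 \<le> f s" if f: "continuous_on UNIV f" "\<And>t. 0 \<le> t \<Longrightarrow> t < s \<Longrightarrow> 0 \<le> f t" for f :: "real \<Rightarrow> real"
      proof (rule tendsto_lowerbound)
        show "(f \<longlongrightarrow> f s) (at_left s)"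
          using f(1) by (simp add: continuous_on_eq_continuous_at isCont_def filterlim_at_split)
        show "\<forall>\<^sub>F x in at_left s. 0 \<le> f x"
          using eventually_at_left_real[OF \<open>0 < s\<close>] by eventually_elim (use f in auto)
      qed simp
      have A: "\<bar>w s + \<epsilon> * y s\<bar> \<le> K * \<epsilon>^2 * g s"
        using lim[of "\<lambda>t. K * \<epsilon>^2 * g t - \<bar>w t + \<epsilon> * y t\<bar>"] before good_imp(4)
        by (force intro!: continuous_intros cont')
      have B: "\<bar>w s - \<epsilon> * y s\<bar> \<le> K2 * \<epsilon>^2 * g s"
        using lim[of "\<lambda>t. K2 * \<epsilon>^2 * g t - \<bar>w t - \<epsilon> * y t\<bar>"] before good_imp(5)
        by (force intro!: continuous_intros cont')
      have "exp (2 * 0) * g 0 \<le> exp (2 * s) * g s"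
      proof (rule DERIV_nonneg_imp_increasing_open[OF s(1)])
        fix t assume t: "0 < t" "t < s"
        then have G: "X t \<in> Good" using before by auto
        note gi = good_imp[OF G]
        have "K * \<epsilon>^2 * g t \<le> K2 * \<epsilon>^2 * g t"
          using K_bounds gi(1) by (intro mult_right_mono) auto
        moreover have "En t = 0" using En_const t before by auto
        ultimately have "\<bar>2 * (u t * p t + v t * q t)\<bar> \<le> 2 * g t"
          using gi by (intro block_bounds(9)[of "p t" "q t" "u t" "v t", folded g_def w_def y_def]) (auto simp: En_def)
        then have "0 \<le> g' t + 2 * g t" by (simp add: g'_def)
        moreover have "((\<lambda>t. exp (2 * t) * g t) has_real_derivative exp (2 * t) * (g' t + 2 * g t)) (at t)"
          using der(1)[OF gi(1-3)] by (auto intro!: derivative_eq_intros simp: algebra_simps)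
        ultimately show "\<exists>y. ((\<lambda>t. exp (2 * t) * g t) has_real_derivative y) (at t) \<and> 0 \<le> y"
          by (intro exI[of _ "exp (2 * t) * (g' t + 2 * g t)"] conjI) auto
      qed (intro continuous_intros cont')
      moreover have "0 < g 0" using tube_gap[OF Q0] by (simp add: tr)
      ultimately have "0 < exp (2 * s) * g s" by simp
      then have gs: "0 < g s" by (simp add: zero_less_mult_iff)
      have pqs: "\<bar>p s\<bar> < 2" "\<bar>q s\<bar> < 2" using energy_imp[OF Es A B gs] by auto
      have "\<bar>w s - \<epsilon> * y s\<bar> \<noteq> K2 * \<epsilon>^2 * g s"
      proof
        assume eq: "\<bar>w s - \<epsilon> * y s\<bar> = K2 * \<epsilon>^2 * g s"
        obtain \<sigma> :: real where \<sigma>: "\<sigma> = 1 \<or> \<sigma> = -1" "\<sigma> * (w s - \<epsilon> * y s) = K2 * \<epsilon>^2 * g s"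
        proof (cases "0 \<le> w s - \<epsilon> * y s")
          case True then show ?thesis using eq by (intro that[of 1]) auto
        next
          case False then show ?thesis using eq by (intro that[of "-1"]) auto
        qed
        have "\<sigma> * (y s - \<epsilon> * y' s) < K2 * \<epsilon>^2 * g' s"
          unfolding y'_def g'_def
          by (rule face_derivs(2)[of "p s" "q s" "u s" "v s" \<sigma>, folded g_def w_def y_def])
            (use Es gs \<sigma> A B in \<open>auto simp: En_def\<close>)
        moreover have "((\<lambda>t. K2 * \<epsilon>^2 * g t - \<sigma> * (w t - \<epsilon> * y t)) has_real_derivative
            K2 * \<epsilon>^2 * g' s - \<sigma> * (y s - \<epsilon> * y' s)) (at s)"
          using der[OF gs pqs] by (auto intro!: derivative_eq_intros)
        ultimately have "\<exists>d>0. \<forall>h>0. h < d \<longrightarrow>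
            K2 * \<epsilon>^2 * g (s - h) - \<sigma> * (w (s - h) - \<epsilon> * y (s - h)) < K2 * \<epsilon>^2 * g s - \<sigma> * (w s - \<epsilon> * y s)"
          by (intro DERIV_pos_inc_left[where f = "\<lambda>t. K2 * \<epsilon>^2 * g t - \<sigma> * (w t - \<epsilon> * y t)"]) auto
        then obtain d where d: "0 < d" "\<And>h. 0 < h \<Longrightarrow> h < d \<Longrightarrow>
            K2 * \<epsilon>^2 * g (s - h) - \<sigma> * (w (s - h) - \<epsilon> * y (s - h)) < K2 * \<epsilon>^2 * g s - \<sigma> * (w s - \<epsilon> * y s)"
          by blast
        define h where "h = min d s / 2"
        have h: "0 < h" "h < d" "h < s" using d \<open>0 < s\<close> by (auto simp: h_def)
        have "K2 * \<epsilon>^2 * g (s - h) < \<sigma> * (w (s - h) - \<epsilon> * y (s - h))"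
          using d(2)[OF h(1,2)] \<sigma>(2) by linarith
        moreover have "\<bar>w (s - h) - \<epsilon> * y (s - h)\<bar> < K2 * \<epsilon>^2 * g (s - h)"
          using good_imp(5)[OF before, of "s - h"] h by auto
        ultimately show False using \<sigma>(1) by auto
      qed
      then show ?thesis using B pqs by (simp add: tube_def tr pq)
    qed
    have gs: "0 < g s" using tube_gap[OF Qs] by (simp add: tr)
    have B: "\<bar>w s - \<epsilon> * y s\<bar> \<le> K2 * \<epsilon>^2 * g s" and pqs: "\<bar>p s\<bar> < 2" "\<bar>q s\<bar> < 2"
      using Qs by (auto simp: tube_def tr pq)
    have e2g: "0 < K * \<epsilon>^2 * g s" using K_bounds \<epsilon> gs by simp
    have noexit': "\<not> (\<exists>t\<ge>0. K * \<epsilon>^2 * g t < \<sigma> * (w t + \<epsilon> * y t) \<and> (\<forall>\<tau>\<in>{0..t}. X \<tau> \<in> below (-\<sigma>) \<inter> tube))"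
      if "\<sigma> = 1 \<or> \<sigma> = -1" for \<sigma>
      using noexit[OF that] by (simp add: above_def tr)
    have before': "X \<tau> \<in> below (-\<sigma>) \<inter> tube" if "\<sigma> = 1 \<or> \<sigma> = -1" "0 \<le> \<tau>" "\<tau> < s" for \<sigma> \<tau>
      using before[of \<tau>] that by (auto simp: Good_def)
    have at_s: "X s \<in> below (-\<sigma>) \<inter> tube" if "K * \<epsilon>^2 * g s \<le> \<sigma> * (w s + \<epsilon> * y s)" for \<sigma>
      using that Qs e2g by (auto simp: below_def tr)
    have A1: "\<sigma> * (w s + \<epsilon> * y s) \<le> K * \<epsilon>^2 * g s" if \<sigma>: "\<sigma> = 1 \<or> \<sigma> = -1" for \<sigma>
    proof (rule ccontr)
      assume *: "\<not> ?thesis"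
      have "X \<tau> \<in> below (-\<sigma>) \<inter> tube" if "\<tau> \<in> {0..s}" for \<tau>
        using before'[OF \<sigma>, of \<tau>] at_s[of \<sigma>] * that by (cases "\<tau> = s") auto
      then show False using noexit'[OF \<sigma>] * s(1) by force
    qed
    have A: "\<bar>w s + \<epsilon> * y s\<bar> \<le> K * \<epsilon>^2 * g s"
      using A1[of 1] A1[of "-1"] by auto
    have "\<exists>\<sigma>. (\<sigma> = 1 \<or> \<sigma> = -1) \<and> \<sigma> * (w s + \<epsilon> * y s) = K * \<epsilon>^2 * g s"
    proof (rule ccontr)
      assume "\<not> ?thesis"
      then have "w s + \<epsilon> * y s \<noteq> K * \<epsilon>^2 * g s" "- (w s + \<epsilon> * y s) \<noteq> K * \<epsilon>^2 * g s"
        by (metis mult_1 , metis mult_minus1)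
      then have "X s \<in> below 1 \<inter> below (-1)" using A by (auto simp: below_def tr)
      then show False using Qs s by (simp add: Good_def)
    qed
    then obtain \<sigma> where \<sigma>: "\<sigma> = 1 \<or> \<sigma> = -1" and face: "\<sigma> * (w s + \<epsilon> * y s) = K * \<epsilon>^2 * g s" by blast
    have "K * \<epsilon>^2 * g' s < \<sigma> * (y s + \<epsilon> * y' s)"
      unfolding y'_def g'_def
      by (rule face_derivs(1)[of "p s" "q s" "u s" "v s" \<sigma>, folded g_def w_def y_def])
        (use Es gs \<sigma> A B face in \<open>auto simp: En_def\<close>)
    moreover have "((\<lambda>t. \<sigma> * (w t + \<epsilon> * y t) - K * \<epsilon>^2 * g t) has_real_derivative
            \<sigma> * (y s + \<epsilon> * y' s) - K * \<epsilon>^2 * g' s) (at s)"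
      using der[OF gs pqs] by (auto intro!: derivative_eq_intros)
    ultimately have "\<exists>d>0. \<forall>h>0. h < d \<longrightarrow>
         \<sigma> * (w s + \<epsilon> * y s) - K * \<epsilon>^2 * g s < \<sigma> * (w (s + h) + \<epsilon> * y (s + h)) - K * \<epsilon>^2 * g (s + h)"
      by (intro DERIV_pos_inc_right[where f = "\<lambda>t. \<sigma> * (w t + \<epsilon> * y t) - K * \<epsilon>^2 * g t"]) auto
    then obtain d where d: "0 < d" "\<And>h. 0 < h \<Longrightarrow> h < d \<Longrightarrow>
         \<sigma> * (w s + \<epsilon> * y s) - K * \<epsilon>^2 * g s < \<sigma> * (w (s + h) + \<epsilon> * y (s + h)) - K * \<epsilon>^2 * g (s + h)"
      by blast
    have "open (below (-\<sigma>) \<inter> tube)" by (intro open_Int open_sets)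
    moreover have "isCont X s" using contX[of UNIV] by (simp add: continuous_on_eq_continuous_at)
    moreover have "X s \<in> below (-\<sigma>) \<inter> tube" by (rule at_s) (simp add: face)
    ultimately have "\<forall>\<^sub>F t in at s. X t \<in> below (-\<sigma>) \<inter> tube"
      unfolding isCont_def using topological_tendstoD by blast
    then obtain d' where d': "0 < d'" "\<And>t. t \<noteq> s \<Longrightarrow> dist t s < d' \<Longrightarrow> X t \<in> below (-\<sigma>) \<inter> tube"
      unfolding eventually_at by auto
    define h where "h = min d d' / 2"
    have h: "0 < h" "h < d" "h < d'" using d(1) d'(1) by (auto simp: h_def)
    have "X \<tau> \<in> below (-\<sigma>) \<inter> tube" if "\<tau> \<in> {0..s + h}" for \<tau>
    proof -
      consider "\<tau> < s" | "\<tau> = s" | "s < \<tau>" by linarith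
      then show ?thesis
      proof cases
        case 1 then show ?thesis using before'[OF \<sigma>] that by auto
      next
        case 2 then show ?thesis using at_s[of \<sigma>] face by simp
      next
        case 3 then show ?thesis using d'(2)[of \<tau>] that h by (auto simp: dist_real_def)
      qed
    qed
    moreover have "K * \<epsilon>^2 * g (s + h) < \<sigma> * (w (s + h) + \<epsilon> * y (s + h))"
      using d(2)[OF h(1,2)] face by linarith
    ultimately show False using noexit'[OF \<sigma>] s(1) h(1) by (meson add_nonneg_nonneg less_imp_le)
  qed
  show ?thesis
    using all_good[OF \<open>0 \<le> t\<close>] En_const[OF \<open>0 \<le> t\<close>] all_good by (simp add: Good_def tr En_def)
qed


lemma trapped_orbit_exists:
  obtains X a b where "\<And>t. (X has_vector_derivative cfield (X t)) (at t)"
    and "0 < a" "0 < b" "X 0 = (a, a, b, - b)"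
    and "\<And>t. 0 \<le> t \<Longrightarrow> X t \<in> below 1 \<inter> below (-1) \<inter> tube \<and> zero_energy (X t)"
proof -
  obtain L where L: "L-lipschitz_on UNIV cfield" using cfield_lipschitz by blast
  \<comment> \<open>With \<open>u 0 = v 0 = sqrt (m s)\<close> the deviation \<open>u v - c\<close> equals \<open>s\<close> times the gap.\<close>
  define S where "S = K' * \<epsilon>^2"
  define m where "m s = (c + s) / (1 + 2 * s)" for s
  define G where "G s = 1 - 2 * m s" for s
  define b where "b s = sqrt ((G s)^2 / 4 + (m s - c)^2 / (2 * \<epsilon>^2))" for s
  define z where "z s = (sqrt (m s), sqrt (m s), b s, - b s)" for s
  have e2: "0 < \<epsilon>^2" using \<epsilon> by simp
  have KS: "K * \<epsilon>^2 < S" "S < K2 * \<epsilon>^2" using K_bounds e2 by (auto simp: S_def)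
  have S: "0 < S" "S \<le> c / 4" "S < K2 * \<epsilon>^2" "K * \<epsilon>^2 < S"
    using KS K2_small(4) mult_pos_pos[OF K_bounds(1) e2] by linarith+
  have X: "\<exists>X. X 0 = z s \<and> (\<forall>t. (X has_vector_derivative cfield (X t)) (at t))" for s
    by (rule lipschitz_ode_exists[OF L])
  then obtain X where X0: "\<And>s. X s 0 = z s" and X: "\<And>s t. (X s has_vector_derivative cfield (X s t)) (at t)"
    by metis
  have init: "0 < m s" "0 < G s" "m s - c = s * G s" "G s < 1" if "s \<in> {-S..S}" for s
  proof -
    have s: "- c / 4 \<le> s" "s \<le> c / 4" using that S(2) by auto
    then have d: "0 < 1 + 2 * s" using c by linarith
    show "0 < m s" using s c d by (simp add: m_def)
    show "m s - c = s * G s" using d by (simp add: m_def G_def field_simps)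
    have "G s = (1 - 2 * c) / (1 + 2 * s)" using d by (simp add: G_def m_def field_simps)
    then show "0 < G s" using d c by simp
    show "G s < 1" using \<open>0 < m s\<close> by (simp add: G_def)
  qed
  have z_gap: "gap (z s) = G s" and z_st: "stab (z s) = m s - c" "unst (z s) = m s - c" if "s \<in> {-S..S}" for s
    using init[OF that] by (simp_all add: z_def gap_def stab_def unst_def G_def algebra_simps)
  have z_energy: "zero_energy (z s)" if "s \<in> {-S..S}" for s
    using init[OF that] z_gap[OF that] by (simp add: zero_energy_def z_def b_def)
  have b2: "(b s)^2 < 4 \<and> 0 < b s" if s: "s \<in> {-S..S}" for s
  proof -
    have "(m s - c)^2 \<le> (K2 * \<epsilon>^2 * 1)^2"
    proof (subst abs_le_square_iff[symmetric])
      have "\<bar>s\<bar> \<le> K2 * \<epsilon>^2" using s S by auto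
      then have "\<bar>s\<bar> * \<bar>G s\<bar> \<le> K2 * \<epsilon>^2 * 1" using init[OF s] K_bounds e2 by (intro mult_mono) auto
      then show "\<bar>m s - c\<bar> \<le> \<bar>K2 * \<epsilon>^2 * 1\<bar>" unfolding init(3)[OF s] abs_mult using K_bounds by simp
    qed
    then have "(m s - c)^2 / (2 * \<epsilon>^2) \<le> (K2 * \<epsilon>)^2 / 2"
      using \<epsilon> by (simp add: field_simps power2_eq_square)
    also have "(K2 * \<epsilon>)^2 \<le> 1^2"
      using K2_small(2) K_bounds \<epsilon> by (intro power_mono) auto
    finally have "(m s - c)^2 / (2 * \<epsilon>^2) \<le> 1/2" by simp
    moreover have "0 < (G s)^2" "(G s)^2 \<le> 1" using init[OF s] by (auto simp: power_le_one)
    moreover have "0 \<le> (m s - c)^2 / (2 * \<epsilon>^2)" by simp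
    ultimately have *: "(G s)^2 / 4 + (m s - c)^2 / (2 * \<epsilon>^2) < 4" "0 < (G s)^2 / 4 + (m s - c)^2 / (2 * \<epsilon>^2)"
      by linarith+
    then show ?thesis by (simp add: b_def)
  qed
  have z_tube: "z s \<in> tube" if s: "s \<in> {-S..S}" for s
  proof -
    have "\<bar>s\<bar> * G s < K2 * \<epsilon>^2 * G s"
      using s S init[OF s] by (intro mult_strict_right_mono) auto
    moreover have "\<bar>b s\<bar> < 2"
      using b2[OF s] power_less_imp_less_base[of "\<bar>b s\<bar>" 2 2] by simp
    ultimately show ?thesis
      using init[OF s] z_gap[OF s] z_st[OF s] by (simp add: tube_def abs_mult z_def)
  qed
  have endpt: "z (\<sigma> * S) \<in> above \<sigma> \<inter> (below (-\<sigma>) \<inter> tube)" if \<sigma>: "\<sigma> = 1 \<or> \<sigma> = -1" for \<sigma>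
  proof -
    have s: "\<sigma> * S \<in> {-S..S}" using \<sigma> S by auto
    have "\<sigma> * (\<sigma> * S * G (\<sigma> * S)) = S * G (\<sigma> * S)" using \<sigma> by auto
    then have "\<sigma> * unst (z (\<sigma> * S)) = S * G (\<sigma> * S)"
      by (simp only: z_st(2)[OF s] init(3)[OF s])
    moreover have "K * \<epsilon>^2 * G (\<sigma> * S) < S * G (\<sigma> * S)"
      using S init(2)[OF s] by (intro mult_strict_right_mono) auto
    moreover have "0 < K * \<epsilon>^2 * G (\<sigma> * S)" using K_bounds e2 init(2)[OF s] by simp
    ultimately show ?thesis
      using z_tube[OF s] z_gap[OF s] by (simp add: above_def below_def)
  qed
  have contX: "continuous_on UNIV (X s)" for s
    using X by (meson continuous_at_imp_continuous_on has_vector_derivative_continuous)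
  have "\<exists>s\<in>{-S..S}. \<not> (\<exists>t\<ge>0. X s t \<in> above 1 \<and> (\<forall>\<tau>\<in>{0..t}. X s \<tau> \<in> below (-1) \<inter> tube)) \<and>
                   \<not> (\<exists>t\<ge>0. X s t \<in> above (-1) \<and> (\<forall>\<tau>\<in>{0..t}. X s \<tau> \<in> below 1 \<inter> tube))"
  proof (rule shooting[where L = L])
    show "dist (X s t) (X s' t) \<le> exp (L * t) * dist (X s 0) (X s' 0)" if "0 \<le> t" for s s' t
      using lipschitz_ode_dist[OF that L, of "X s" "X s'"] X by (simp add: dist_norm)
    have "continuous_on {-S..S} z"
      unfolding z_def b_def G_def m_def
      by (intro continuous_intros) (use S \<epsilon> c in auto)
    then show "continuous_on {-S..S} (\<lambda>s. X s 0)" by (simp add: X0)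
    show "X S 0 \<in> above 1 \<inter> (below (-1) \<inter> tube)" "X (-S) 0 \<in> above (-1) \<inter> (below 1 \<inter> tube)"
      using endpt[of 1] endpt[of "-1"] by (auto simp: X0)
    show "above 1 \<inter> (below 1 \<inter> tube) = {}" "above (-1) \<inter> (below (-1) \<inter> tube) = {}"
      by (auto simp: above_def below_def)
  qed (use S lipschitz_on_nonneg[OF L] open_sets in \<open>auto simp: contX intro!: open_Int\<close>)
  then obtain s where s: "s \<in> {-S..S}"
    and ne: "\<not> (\<exists>t\<ge>0. X s t \<in> above 1 \<and> (\<forall>\<tau>\<in>{0..t}. X s \<tau> \<in> below (-1) \<inter> tube))"
      "\<not> (\<exists>t\<ge>0. X s t \<in> above (-1) \<and> (\<forall>\<tau>\<in>{0..t}. X s \<tau> \<in> below 1 \<inter> tube))"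
    by blast
  show thesis
  proof (rule that[of "X s" "sqrt (m s)" "b s"])
    show "X s t \<in> below 1 \<inter> below (-1) \<inter> tube \<and> zero_energy (X s t)" if "0 \<le> t" for t
    proof (rule trapped[OF X _ _ _ _ that])
      fix \<sigma> :: real assume "\<sigma> = 1 \<or> \<sigma> = -1"
      then show "\<not> (\<exists>t\<ge>0. X s t \<in> above \<sigma> \<and> (\<forall>\<tau>\<in>{0..t}. X s \<tau> \<in> below (-\<sigma>) \<inter> tube))"
        using ne by auto
    qed (use z_energy[OF s] z_st[OF s] z_tube[OF s] in \<open>auto simp: X0\<close>)
  qed (use X init[OF s] b2[OF s] in \<open>auto simp: X0 z_def\<close>)
qed

end

locale gp_orbit = gp_block +
  fixes u v p q :: "real \<Rightarrow> real"
  assumes du: "\<And>x. (u has_real_derivative p x) (at x)" and dv: "\<And>x. (v has_real_derivative q x) (at x)"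
    and dp: "\<And>x. (p has_real_derivative accel (u x) (v x)) (at x)"
    and dq: "\<And>x. (q has_real_derivative accel (v x) (u x)) (at x)"
    and sym: "\<And>x. u (- x) = v x" and u0: "0 < u 0" and p0: "0 < p 0" and q0: "q 0 = - p 0"
    and g_pos: "\<And>x. 0 \<le> x \<Longrightarrow> 0 < 1 - (u x)^2 - (v x)^2"
    and w_le: "\<And>x. 0 \<le> x \<Longrightarrow> \<bar>u x * v x - c\<bar> \<le> K2 * \<epsilon>^2 * (1 - (u x)^2 - (v x)^2)"
    and y_le: "\<And>x. 0 \<le> x \<Longrightarrow> \<bar>p x * v x + q x * u x\<bar> \<le> K2 * \<epsilon> * (1 - (u x)^2 - (v x)^2)"
    and en: "\<And>x. 0 \<le> x \<Longrightarrow> (p x)^2 + (q x)^2 = (1 - (u x)^2 - (v x)^2)^2 / 2 + (u x * v x - c)^2 / \<epsilon>^2"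

context gp_block
begin

proposition heteroclinic_exists: "\<exists>u v p q. gp_orbit c \<epsilon> u v p q"
proof -
  obtain X a b where X: "\<And>t. (X has_vector_derivative cfield (X t)) (at t)"
    and ab: "0 < a" "0 < b" "X 0 = (a, a, b, - b)"
    and tr: "\<And>t. 0 \<le> t \<Longrightarrow> X t \<in> below 1 \<inter> below (-1) \<inter> tube \<and> zero_energy (X t)"
    using trapped_orbit_exists by metis
  define u v p q where "u t = fst (X t)" and "v t = fst (snd (X t))"
    and "p t = fst (snd (snd (X t)))" and "q t = snd (snd (snd (X t)))" for t
  have Xt: "X t = (u t, v t, p t, q t)" for t by (simp add: u_def v_def p_def q_def)
  have facts: "0 < gap (X x)" "\<bar>p x\<bar> < 2" "\<bar>q x\<bar> < 2" "\<bar>unst (X x)\<bar> \<le> K2 * \<epsilon>^2 * gap (X x)"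
    "\<bar>stab (X x)\<bar> \<le> K2 * \<epsilon>^2 * gap (X x)" "zero_energy (X x)" if "0 \<le> x" for x
  proof -
    show g: "0 < gap (X x)" using tr[OF that] tube_gap by blast
    have "K * \<epsilon>^2 * gap (X x) \<le> K2 * \<epsilon>^2 * gap (X x)"
      using K_bounds g by (intro mult_right_mono) auto
    then show "\<bar>p x\<bar> < 2" "\<bar>q x\<bar> < 2" "\<bar>unst (X x)\<bar> \<le> K2 * \<epsilon>^2 * gap (X x)"
      "\<bar>stab (X x)\<bar> \<le> K2 * \<epsilon>^2 * gap (X x)" "zero_energy (X x)"
      using tr[OF that] by (auto simp: below_def tube_def p_def q_def)
  qed
  have pos_field: "cfield (X x) = field (X x)" if "0 \<le> x" for x
    using facts[OF that] by (intro gap_in_box) (auto simp: p_def q_def)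
  define R where "R z = (fst (snd z), fst z, - snd (snd (snd z)), - fst (snd (snd z)))" for z :: "real \<times> real \<times> real \<times> real"
  have clampR: "clamp box_lo box_hi (R z) = R (clamp box_lo box_hi z)" for z
    by (cases z) (auto simp: R_def clamp_def box_lo_def box_hi_def Basis_prod_def inner_prod_def sum.union_disjoint)
  have cfieldR: "cfield (R z) = - R (cfield z)" for z
    unfolding cfield_def clampR by (simp add: field_def R_def)
  have linR: "bounded_linear R"
    unfolding R_def by (intro bounded_linear_intros bounded_linear_minus)
  have RX0: "R (X (- t)) = X t" for t
  proof -
    obtain L where L: "L-lipschitz_on UNIV cfield" using cfield_lipschitz by blast
    have "((\<lambda>t. R (X (- t))) has_vector_derivative cfield (R (X (- t)))) (at t)" for t
      unfolding cfieldR
      using bounded_linear.has_vector_derivative[OF linR has_vector_derivative_reflect[OF X]]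
      by (simp add: linear_neg[OF bounded_linear.linear[OF linR]])
    then show ?thesis
      using lipschitz_ode_unique[OF L, of "\<bar>t\<bar>" "\<lambda>t. R (X (- t))" X t] X ab by (simp add: R_def)
  qed
  have RX: "v (- x) = u x" "u (- x) = v x" "- q (- x) = p x" "- p (- x) = q x" for x
    using RX0[of x] by (simp_all add: Xt R_def)
  have fieldX: "cfield (X x) = field (X x)" for x
  proof (cases "0 \<le> x")
    case True then show ?thesis using pos_field by simp
  next
    case False
    then have "0 \<le> - x" by simp
    from facts(1-3)[OF this] RX[of x] show ?thesis
      by (intro gap_in_box) (auto simp: gap_def u_def[symmetric] v_def[symmetric] p_def[symmetric] q_def[symmetric])
  qed
  have "gp_orbit c \<epsilon> u v p q"
  proof unfold_locales
    fix x :: real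
    have "(X has_vector_derivative field (X x)) (at x)" using X[of x] fieldX by simp
    from coords_deriv[OF this]
    show "(u has_real_derivative p x) (at x)" "(v has_real_derivative q x) (at x)"
      "(p has_real_derivative accel (u x) (v x)) (at x)" "(q has_real_derivative accel (v x) (u x)) (at x)"
      by (simp_all add: u_def[abs_def] v_def[abs_def] p_def[abs_def] q_def[abs_def])
    show "u (- x) = v x" by (rule RX)
    show "0 < u 0" "0 < p 0" "q 0 = - p 0" using ab by (simp_all add: u_def p_def q_def)
    assume x: "0 \<le> x"
    have en: "(p x)^2 + (q x)^2 = (1 - (u x)^2 - (v x)^2)^2 / 2 + (u x * v x - c)^2 / \<epsilon>^2"
      using facts(6)[OF x] by (simp add: zero_energy_def gap_def u_def v_def p_def q_def)
    have A: "\<bar>(u x * v x - c) + \<epsilon> * (p x * v x + q x * u x)\<bar> \<le> K2 * \<epsilon>^2 * (1 - (u x)^2 - (v x)^2)"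
      and B: "\<bar>(u x * v x - c) - \<epsilon> * (p x * v x + q x * u x)\<bar> \<le> K2 * \<epsilon>^2 * (1 - (u x)^2 - (v x)^2)"
      using facts(4,5)[OF x] by (simp_all add: unst_def stab_def gap_def u_def v_def p_def q_def)
    show "0 < 1 - (u x)^2 - (v x)^2" using facts(1)[OF x] by (simp add: gap_def u_def v_def)
    show "\<bar>u x * v x - c\<bar> \<le> K2 * \<epsilon>^2 * (1 - (u x)^2 - (v x)^2)"
      "\<bar>p x * v x + q x * u x\<bar> \<le> K2 * \<epsilon> * (1 - (u x)^2 - (v x)^2)"
      "(p x)^2 + (q x)^2 = (1 - (u x)^2 - (v x)^2)^2 / 2 + (u x * v x - c)^2 / \<epsilon>^2"
      using block_bounds(2,3)[OF en A B] en by blast+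
  qed
  then show ?thesis by blast
qed

end

section \<open>Comparison inequalities\<close>

lemma exp_weight_comparison:
  fixes \<delta> \<delta>' :: "real \<Rightarrow> real"
  assumes d: "\<And>t. 0 \<le> t \<Longrightarrow> (\<delta> has_real_derivative \<delta>' t) (at t)" and "\<delta> 0 = 0" and "0 < \<mu>" "0 \<le> C"
    and le: "\<And>t. 0 \<le> t \<Longrightarrow> \<delta> t * \<delta>' t \<le> - \<mu> * (\<delta> t)^2 + C * \<bar>\<delta> t\<bar>" and "0 \<le> x"
  shows "\<bar>\<delta> x\<bar> \<le> C / \<mu>"
proof -
  define B where "B = C / \<mu>"
  have B: "0 \<le> B" "C = \<mu> * B" using assms by (auto simp: B_def)
  define h where "h t = exp (\<mu> * t) * ((\<delta> t)^2 - B^2)" for t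
  have "h x \<le> h 0"
  proof (rule DERIV_nonpos_imp_nonincreasing[OF \<open>0 \<le> x\<close>])
    fix t assume t: "0 \<le> t" "t \<le> x"
    have "(h has_real_derivative exp (\<mu> * t) * (2 * (\<delta> t * \<delta>' t) + \<mu> * ((\<delta> t)^2 - B^2))) (at t)"
      unfolding h_def using d[OF t(1)] by (auto intro!: derivative_eq_intros simp: algebra_simps)
    moreover have "2 * (\<delta> t * \<delta>' t) + \<mu> * ((\<delta> t)^2 - B^2) \<le> 0"
    proof -
      have "2 * (\<delta> t * \<delta>' t) + \<mu> * ((\<delta> t)^2 - B^2) \<le> - (\<mu> * (\<bar>\<delta> t\<bar> - B)^2)"
        using le[OF t(1)] unfolding B(2) by (simp add: power2_eq_square algebra_simps)
      also have "\<dots> \<le> 0" using \<open>0 < \<mu>\<close> by simp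
      finally show ?thesis .
    qed
    ultimately show "\<exists>y. (h has_real_derivative y) (at t) \<and> y \<le> 0"
      by (meson exp_ge_zero mult_nonneg_nonpos)
  qed
  also have "\<dots> \<le> 0" using \<open>\<delta> 0 = 0\<close> by (simp add: h_def)
  finally have "exp (\<mu> * x) * ((\<delta> x)^2 - B^2) \<le> 0" by (simp add: h_def)
  then have "(\<delta> x)^2 \<le> B^2" by (simp add: mult_le_0_iff)
  then show ?thesis
    using B(1) abs_le_square_iff[of "\<delta> x" B] by (simp add: B_def)
qed

lemma lower_from_squares:
  fixes a b e :: real
  assumes "0 \<le> e" "0 \<le> b" "0 \<le> a" "a^2 - b^2 \<le> e^2"
  shows "a - b \<le> e"
proof (rule ccontr)
  assume "\<not> ?thesis"
  then have *: "e < a - b" by simp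
  then have "e^2 < (a - b)^2" using assms by (intro power_strict_mono) auto
  also have "\<dots> \<le> (a - b) * (a + b)" using * assms by (auto simp: power2_eq_square intro!: mult_left_mono)
  finally show False using assms(4) by (simp add: power2_eq_square algebra_simps)
qed

lemma inv_sqrt_minus_sqrt_lipschitz:
  fixes a b m :: real
  assumes "0 < m" "m \<le> 1" "m \<le> a" "m \<le> b"
  shows "\<bar>(1 - a) / sqrt a - (1 - b) / sqrt b\<bar> \<le> \<bar>a - b\<bar> / m^2"
proof -
  define \<alpha> where "\<alpha> = sqrt a"
  define \<beta> where "\<beta> = sqrt b"
  have a: "a = \<alpha>^2" "m \<le> \<alpha>" and b: "b = \<beta>^2" "m \<le> \<beta>"
  proof -
    have "m^2 \<le> m" using assms by (simp add: power2_eq_square mult_left_le)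
    then show "m \<le> \<alpha>" "m \<le> \<beta>" using assms by (auto simp: \<alpha>_def \<beta>_def intro!: real_le_rsqrt)
    show "a = \<alpha>^2" "b = \<beta>^2" using assms by (auto simp: \<alpha>_def \<beta>_def)
  qed
  have pos: "0 < \<alpha>" "0 < \<beta>" using a b assms by auto
  have eq: "(1 - \<alpha>^2) / \<alpha> - (1 - \<beta>^2) / \<beta> = - ((\<alpha> - \<beta>) * (1 / (\<alpha> * \<beta>) + 1))"
    using pos by (simp add: field_simps power2_eq_square)
  have d: "\<alpha>^2 - \<beta>^2 = (\<alpha> - \<beta>) * (\<alpha> + \<beta>)" by (simp add: power2_eq_square algebra_simps)
  have "sqrt m * sqrt m \<le> \<alpha> * \<beta>"
    unfolding \<alpha>_def \<beta>_def using assms by (intro mult_mono) auto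
  then have "m \<le> \<alpha> * \<beta>" using assms by simp
  then have "1 / (\<alpha> * \<beta>) \<le> 1 / m" using assms pos by (intro divide_left_mono) auto
  moreover have "1 \<le> 1 / m" using assms by simp
  ultimately have "1 / (\<alpha> * \<beta>) + 1 \<le> 1 / m + 1 / m" by linarith
  also have "\<dots> = 2 * m / m^2" using assms by (simp add: power2_eq_square)
  also have "\<dots> \<le> (\<alpha> + \<beta>) / m^2" using a b by (intro divide_right_mono) auto
  finally have "\<bar>\<alpha> - \<beta>\<bar> * (1 / (\<alpha> * \<beta>) + 1) \<le> \<bar>\<alpha> - \<beta>\<bar> * ((\<alpha> + \<beta>) / m^2)"
    by (intro mult_left_mono) auto
  moreover have "\<bar>(1 - \<alpha>^2) / \<alpha> - (1 - \<beta>^2) / \<beta>\<bar> = \<bar>\<alpha> - \<beta>\<bar> * (1 / (\<alpha> * \<beta>) + 1)"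
    unfolding eq abs_minus_cancel abs_mult using pos by simp
  moreover have "\<bar>\<alpha>^2 - \<beta>^2\<bar> = \<bar>\<alpha> - \<beta>\<bar> * (\<alpha> + \<beta>)"
    unfolding d abs_mult using pos by simp
  ultimately show ?thesis
    unfolding a(1) b(1) using pos by simp
qed

section \<open>The limit profile\<close>

text \<open>\<open>Y = v / u\<close> satisfies \<open>Y' = - slow_speed c0 Y\<close> on the limiting hyperbola \<open>u v = c0\<close>. In this
  variable the speed increases at least linearly on the whole range \<open>(0, 1]\<close>, so that errors contract
  all along the half line.\<close>

definition slow_speed :: "real \<Rightarrow> real \<Rightarrow> real" where
  "slow_speed c0 Y = sqrt 2 * Y * ((1 - c0 * (Y + 1/Y)) / sqrt (c0 * (Y + 1/Y)))"

lemma slow_speed_diff: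
  assumes c0: "0 < c0" "c0 < 1/2" and ab: "0 < a" "a \<le> b" "b \<le> 1"
    and rb: "c0 * (b + 1/b) \<le> 1" and ra: "c0 * (a + 1/a) \<le> 4"
  shows "(1 - 2 * c0) / 2 * (b - a) \<le> slow_speed c0 b - slow_speed c0 a"
proof -
  define R where "R z = c0 * (z + 1/z)" for z
  define N where "N z = z - c0 * z^2 - c0" for z
  have S: "slow_speed c0 z = sqrt 2 * (N z / sqrt (R z))" if "0 < z" for z
  proof -
    have "N z = z * (1 - R z)" using that by (simp add: R_def N_def power2_eq_square field_simps)
    then show ?thesis by (simp add: slow_speed_def R_def)
  qed
  have b: "0 < b" using ab by simp
  have "(a + 1/a) - (b + 1/b) = (b - a) * (1 / (a * b) - 1)"
    using ab b by (simp add: field_simps)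
  also have "\<dots> \<ge> 0" using ab b by (intro mult_nonneg_nonneg) (auto simp: mult_le_one)
  finally have "R b \<le> R a" using c0 by (simp add: R_def)
  then have sq: "sqrt (R b) \<le> sqrt (R a)" by simp
  have Rb: "0 < R b" using c0 b by (simp add: R_def add_pos_pos)
  have Ra: "0 < sqrt (R a)" using \<open>R b \<le> R a\<close> Rb by simp
  have Ra2: "sqrt (R a) \<le> 2" using ra real_sqrt_le_mono[of "R a" 4] by (simp add: R_def)
  have "0 \<le> b * (1 - R b)" using rb b by (simp add: R_def)
  also have "b * (1 - R b) = N b" using b by (simp add: R_def N_def field_simps power2_eq_square)
  finally have "N b / sqrt (R a) \<le> N b / sqrt (R b)"
    using sq Rb by (intro divide_left_mono) auto
  then have 1: "(N b - N a) / sqrt (R a) \<le> N b / sqrt (R b) - N a / sqrt (R a)"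
    by (simp add: diff_divide_distrib)
  have "(b - a) * (1 - 2 * c0) \<le> (b - a) * (1 - c0 * (a + b))"
    using ab c0 by (intro mult_left_mono) auto
  also have "\<dots> = N b - N a" by (simp add: N_def power2_eq_square algebra_simps)
  finally have 2: "(b - a) * (1 - 2 * c0) \<le> N b - N a" .
  have 3: "0 \<le> (b - a) * (1 - 2 * c0)" using ab c0 by simp
  have "(b - a) * (1 - 2 * c0) / 2 \<le> (b - a) * (1 - 2 * c0) / sqrt (R a)"
    using 3 Ra Ra2 by (intro divide_left_mono) auto
  also have "\<dots> \<le> (N b - N a) / sqrt (R a)" using 2 Ra by (intro divide_right_mono) auto
  finally have 4: "(b - a) * (1 - 2 * c0) / 2 \<le> N b / sqrt (R b) - N a / sqrt (R a)" using 1 by linarith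
  have "(b - a) * (1 - 2 * c0) / 2 = 1 * ((b - a) * (1 - 2 * c0) / 2)" by simp
  also have "\<dots> \<le> sqrt 2 * (N b / sqrt (R b) - N a / sqrt (R a))"
    using 3 4 by (intro mult_mono) auto
  finally show ?thesis using S[OF ab(1)] S[OF b] by (simp add: algebra_simps)
qed

definition profile_rhs :: "real \<Rightarrow> real \<Rightarrow> real" where
  "profile_rhs c0 z = (z^2 - z^4 - c0^2) / (sqrt 2 * sqrt (z^4 + c0^2))"

lemma limit_profile_iff:
  "limit_profile c0 w \<longleftrightarrow> (\<forall>x. (w has_real_derivative profile_rhs c0 (w x)) (at x)) \<and> w 0 = sqrt c0"
  by (simp add: limit_profile_def profile_rhs_def)

lemma profile_rhs_lipschitz:
  assumes "0 < c0" shows "\<exists>L. L-lipschitz_on {a..b} (profile_rhs c0)"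
proof (rule C1_imp_lipschitz_on_interval)
  have pos: "0 < z^4 + c0^2" for z :: real
    using assms by (simp add: add_nonneg_pos)
  show "(profile_rhs c0 has_real_derivative
      ((2 * z - 4 * z^3) * (sqrt 2 * sqrt (z^4 + c0^2)) -
       (z^2 - z^4 - c0^2) * (sqrt 2 * (4 * z^3 / (2 * sqrt (z^4 + c0^2))))) /
      ((sqrt 2 * sqrt (z^4 + c0^2)) * (sqrt 2 * sqrt (z^4 + c0^2)))) (at z)" for z
    unfolding profile_rhs_def using pos[of z] less_imp_neq[OF pos[of z]]
    by (auto intro!: derivative_eq_intros simp: divide_simps)
  show "continuous_on {a..b} (\<lambda>z. ((2 * z - 4 * z^3) * (sqrt 2 * sqrt (z^4 + c0^2)) -
       (z^2 - z^4 - c0^2) * (sqrt 2 * (4 * z^3 / (2 * sqrt (z^4 + c0^2))))) /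
      ((sqrt 2 * sqrt (z^4 + c0^2)) * (sqrt 2 * sqrt (z^4 + c0^2))))"
    using less_imp_neq[OF pos, symmetric] by (intro continuous_intros) auto
qed

lemma limit_profile_unique:
  assumes c0: "0 < c0" and w: "limit_profile c0 w" and z: "limit_profile c0 z"
  shows "w = z"
proof
  fix t :: real
  define T where "T = \<bar>t\<bar>"
  have cont: "continuous_on {-T..T} w" "continuous_on {-T..T} z"
    using w z unfolding limit_profile_iff by (meson DERIV_isCont continuous_at_imp_continuous_on)+
  obtain B1 where B1: "\<And>x. x \<in> {-T..T} \<Longrightarrow> \<bar>w x\<bar> \<le> B1"
    using compact_imp_bounded[OF compact_continuous_image[OF cont(1) compact_Icc]]
    unfolding bounded_iff by (metis imageI real_norm_def)
  obtain B2 where B2: "\<And>x. x \<in> {-T..T} \<Longrightarrow> \<bar>z x\<bar> \<le> B2"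
    using compact_imp_bounded[OF compact_continuous_image[OF cont(2) compact_Icc]]
    unfolding bounded_iff by (metis imageI real_norm_def)
  obtain L where L: "L-lipschitz_on {-(max B1 B2)..max B1 B2} (profile_rhs c0)"
    using profile_rhs_lipschitz[OF c0] by blast
  show "w t = z t"
  proof (rule lipschitz_ode_unique[OF L, where T = T and X = w and Y = z])
    fix s assume "\<bar>s\<bar> \<le> T"
    then have "s \<in> {-T..T}" by auto
    from B1[OF this] B2[OF this]
    show "w s \<in> {-(max B1 B2)..max B1 B2} \<and> z s \<in> {-(max B1 B2)..max B1 B2}" by auto
  qed (use w z in \<open>auto simp: limit_profile_iff has_real_derivative_iff_has_vector_derivative T_def\<close>)
qed

lemma limit_profile_exists:
  assumes c0: "0 < c0" "c0 < 1/2"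
  obtains U where "limit_profile c0 U" "\<And>x. 0 < U x" "\<And>x. U x * U (- x) = c0"
    "\<And>x. 0 \<le> x \<Longrightarrow> c0 \<le> (U x)^2" "\<And>x. c0^2 \<le> (U x)^2 - (U x)^4"
proof -
  define s where "s = sqrt (1 - 4 * c0^2)"
  define \<alpha> \<beta> where "\<alpha> = sqrt ((1 - s) / 2)" and "\<beta> = sqrt ((1 + s) / 2)"
  have "c0^2 < (1/2)^2" using c0 by (intro power_strict_mono) auto
  then have "0 < 1 - 4 * c0^2" by (simp add: power_divide)
  then have s: "0 < s" "s < 1" "s^2 = 1 - 4 * c0^2" using c0 by (auto simp: s_def)
  have sq: "\<alpha>^2 = (1 - s) / 2" "\<beta>^2 = (1 + s) / 2" "0 < \<alpha>" "0 < \<beta>" using s by (auto simp: \<alpha>_def \<beta>_def)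
  have factor: "z^2 - z^4 - c0^2 = (z^2 - \<alpha>^2) * (\<beta>^2 - z^2)" for z
  proof -
    have "(z^2 - (1 - s) / 2) * ((1 + s) / 2 - z^2) = z^2 - z^4 - (1 - s^2) / 4"
      by (simp add: power2_eq_square power4_eq_xxxx field_simps)
    then show ?thesis unfolding sq s(3) by simp
  qed
  have "s^2 < s" using s(1,2) by (simp add: power2_eq_square)
  moreover have "(2 * c0)^2 = 1 - s^2" using s by (simp add: power_mult_distrib)
  moreover have "(1 - s)^2 = 1 - 2 * s + s^2" "(1 + s)^2 = 1 + 2 * s + s^2"
    by (simp_all add: power2_eq_square algebra_simps)
  ultimately have "(1 - s)^2 < (2 * c0)^2" "(2 * c0)^2 < (1 + s)^2"
    using s zero_le_power2[of s] by linarith+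
  then have "1 - s < 2 * c0" "2 * c0 < 1 + s"
    using s(1) c0(1) by (auto intro: power_less_imp_less_base[where n = 2])
  then have mid: "\<alpha> < sqrt c0" "sqrt c0 < \<beta>" by (auto simp: \<alpha>_def \<beta>_def)
  obtain L where "L-lipschitz_on {\<alpha>..\<beta>} (profile_rhs c0)" using profile_rhs_lipschitz[OF c0(1)] by blast
  then have L: "L-lipschitz_on UNIV (\<lambda>z. profile_rhs c0 (clamp \<alpha> \<beta> z))"
    using mid by (intro lipschitz_on_clamp) auto
  obtain U where U0: "U 0 = sqrt c0" and U: "\<And>t. (U has_vector_derivative profile_rhs c0 (clamp \<alpha> \<beta> (U t))) (at t)"
    using lipschitz_ode_exists[OF L] by blast
  have rest: "profile_rhs c0 (clamp \<alpha> \<beta> \<alpha>) = 0" "profile_rhs c0 (clamp \<alpha> \<beta> \<beta>) = 0"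
    using mid by (simp_all add: profile_rhs_def factor)
  have avoid: "U t \<noteq> e" if "profile_rhs c0 (clamp \<alpha> \<beta> e) = 0" "e \<noteq> sqrt c0" for t e
  proof
    assume "U t = e"
    have "U (t + (- t)) = e"
    proof (rule lipschitz_ode_unique[OF L, where T = "\<bar>t\<bar>" and X = "\<lambda>s. U (t + s)" and Y = "\<lambda>s. e"])
      show "((\<lambda>s. U (t + s)) has_vector_derivative profile_rhs c0 (clamp \<alpha> \<beta> (U (t + s)))) (at s)" for s
        using U[of "t + s"] by (simp add: DERIV_shift[symmetric] has_real_derivative_iff_has_vector_derivative[symmetric] add.commute)
    qed (use that \<open>U t = e\<close> in auto)
    then show False using U0 that by simp
  qed
  have contU: "continuous_on S U" for S
    using U by (meson continuous_at_imp_continuous_on has_vector_derivative_continuous)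
  have conn: "connected (range U)" by (intro connected_continuous_image contU) simp
  have range: "\<alpha> < U t" "U t < \<beta>" for t
  proof -
    have "sqrt c0 \<in> range U" using U0 by (metis rangeI)
    then have "\<alpha> \<in> range U" if "U t \<le> \<alpha>" using connectedD_interval[OF conn, of "U t" "sqrt c0" \<alpha>] that mid by auto
    then show "\<alpha> < U t" using avoid[OF rest(1)] mid by (metis not_le imageE less_irrefl)
    have "\<beta> \<in> range U" if "\<beta> \<le> U t" using connectedD_interval[OF conn, of "sqrt c0" "U t" \<beta>] that mid \<open>sqrt c0 \<in> range U\<close> by auto
    then show "U t < \<beta>" using avoid[OF rest(2)] mid by (metis not_le imageE less_irrefl)
  qed
  have "clamp \<alpha> \<beta> (U t) = U t" for t
    using range[of t] by (intro clamp_cancel_cbox) (auto simp: less_imp_le)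
  then have dU: "(U has_real_derivative profile_rhs c0 (U t)) (at t)" for t
    using U[of t] by (simp add: has_real_derivative_iff_has_vector_derivative)
  then have lp: "limit_profile c0 U" using U0 by (simp add: limit_profile_iff)
  have pos: "0 < U t" for t using range[of t] sq by linarith
  have num: "0 \<le> (U t)^2 - (U t)^4 - c0^2" for t
    unfolding factor using range[of t] sq by (intro mult_nonneg_nonneg) (auto intro!: power_mono)
  define W where "W t = c0 / U (- t)" for t
  have "W = U"
  proof (rule limit_profile_unique[OF c0(1) _ lp], unfold limit_profile_iff, intro conjI allI)
    show "W 0 = sqrt c0" using c0 by (simp add: W_def U0 real_div_sqrt)
    fix t
    define z where "z = U (- t)"
    have z: "0 < z" using pos by (simp add: z_def)
    have "((\<lambda>t. U (- t)) has_real_derivative - profile_rhs c0 z) (at t)"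
      using has_vector_derivative_reflect[of U "profile_rhs c0 z" t] dU[of "- t"]
      by (simp add: has_real_derivative_iff_has_vector_derivative z_def)
    then have "(W has_real_derivative c0 * profile_rhs c0 z / z^2) (at t)"
      unfolding W_def using pos[of "- t"]
      by (auto intro!: derivative_eq_intros simp: z_def power2_eq_square)
    moreover have "profile_rhs c0 (c0 / z) = c0 * profile_rhs c0 z / z^2"
    proof -
      have "(c0/z)^4 + c0^2 = (c0 / z^2)^2 * (z^4 + c0^2)"
        using z by (simp add: field_simps power2_eq_square power4_eq_xxxx)
      then have r: "sqrt ((c0/z)^4 + c0^2) = c0 / z^2 * sqrt (z^4 + c0^2)"
        using c0 by (simp add: real_sqrt_mult)
      have n: "(c0/z)^2 - (c0/z)^4 - c0^2 = (c0 / z^2)^2 * (z^2 - z^4 - c0^2)"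
        using z by (simp add: field_simps power2_eq_square power4_eq_xxxx)
      have k: "0 < c0 / z^2" "0 < sqrt (z^4 + c0^2)" using c0 z by (auto simp: add_pos_pos)
      define k where "k = c0 / z^2"
      show ?thesis
        unfolding profile_rhs_def r n unfolding k_def[symmetric] using k
        by (simp add: power2_eq_square k_def[symmetric]) (simp add: k_def power2_eq_square)
    qed
    ultimately show "(W has_real_derivative profile_rhs c0 (W t)) (at t)" by (simp add: W_def z_def)
  qed
  then have prod: "U t * U (- t) = c0" for t
    using pos[of "- t"] by (metis W_def nonzero_eq_divide_eq less_irrefl)
  show thesis
  proof (rule that[OF lp pos prod])
    fix x :: real assume x: "0 \<le> x"
    have "U 0 \<le> U x"
    proof (rule DERIV_nonneg_imp_nondecreasing[OF x])
      fix t
      have "0 \<le> profile_rhs c0 (U t)" using num[of t] by (simp add: profile_rhs_def)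
      then show "\<exists>y. (U has_real_derivative y) (at t) \<and> 0 \<le> y" using dU by blast
    qed
    then have "(sqrt c0)^2 \<le> (U x)^2" using c0 U0 by (intro power_mono) auto
    then show "c0 \<le> (U x)^2" using c0 by simp
  next
    fix x show "c0^2 \<le> (U x)^2 - (U x)^4" using num[of x] by linarith
  qed
qed

section \<open>Estimates along the orbit\<close>

context gp_orbit
begin

text \<open>\<open>y\<close> is the derivative of \<open>w\<close>, and \<open>2 e\<close> that of \<open>D\<close>.\<close>

definition "\<kappa> = K2 * \<epsilon>"
definition "g x = 1 - (u x)^2 - (v x)^2"
definition "w x = u x * v x - c"
definition "y x = p x * v x + q x * u x"
definition "e x = u x * p x - v x * q x"
definition "D x = (u x)^2 - (v x)^2"
definition "r x = (u x)^2 + (v x)^2"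

lemma \<kappa>_bounds: "0 < \<kappa>" "\<kappa> \<le> 3/25 * c^2" "\<kappa> \<le> 3/100" "\<kappa> \<le> 12 / c * \<epsilon>" "\<kappa> * \<epsilon> \<le> c / 4"
proof -
  show "0 < \<kappa>" using K_bounds \<epsilon> by (simp add: \<kappa>_def)
  show "\<kappa> \<le> 3/25 * c^2" "\<kappa> \<le> 3/100" using K2_small by (simp_all only: \<kappa>_def)
  show "\<kappa> \<le> 12 / c * \<epsilon>" unfolding \<kappa>_def using K_bounds \<epsilon> by (intro mult_right_mono) auto
  show "\<kappa> * \<epsilon> \<le> c / 4" using K2_small(4) by (simp only: \<kappa>_def power2_eq_square mult.assoc)
qed

lemma r_eq: "r x = 1 - g x" by (simp add: r_def g_def)

lemma g_le_1: "g x \<le> 1" by (simp add: g_def)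

lemma gap_pos: "0 \<le> x \<Longrightarrow> 0 < g x" using g_pos by (simp add: g_def)

lemma w_bound: "0 \<le> x \<Longrightarrow> \<bar>w x\<bar> \<le> \<kappa> * \<epsilon> * g x"
  using w_le by (simp add: w_def g_def \<kappa>_def power2_eq_square mult_ac)

lemma y_bound: "0 \<le> x \<Longrightarrow> \<bar>y x\<bar> \<le> \<kappa> * g x" using y_le by (simp add: y_def g_def \<kappa>_def)

lemma energy_eq: "0 \<le> x \<Longrightarrow> (p x)^2 + (q x)^2 = (g x)^2 / 2 + (w x)^2 / \<epsilon>^2"
  using en by (simp add: g_def w_def)

lemma w_sq_bound: assumes "0 \<le> x" shows "(w x)^2 / \<epsilon>^2 \<le> (\<kappa> * g x)^2"
proof -
  have "(w x)^2 \<le> (\<kappa> * \<epsilon> * g x)^2" using power_mono[OF w_bound[OF assms], of 2] by simp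
  then show ?thesis using \<epsilon> by (simp add: field_simps power_mult_distrib)
qed

lemma w_small: "0 \<le> x \<Longrightarrow> \<bar>w x\<bar> \<le> c / 4" "0 \<le> x \<Longrightarrow> \<bar>w x\<bar> \<le> \<epsilon>" "0 \<le> x \<Longrightarrow> \<bar>w x\<bar> \<le> g x"
proof -
  assume x: "0 \<le> x"
  have "\<kappa> * \<epsilon> * g x \<le> \<kappa> * \<epsilon> * 1" using \<kappa>_bounds \<epsilon> g_le_1 by (intro mult_left_mono) auto
  then show "\<bar>w x\<bar> \<le> c / 4" using w_bound[OF x] \<kappa>_bounds(5) by linarith
  have "\<kappa> * \<epsilon> * g x \<le> 1 * \<epsilon> * 1" using \<kappa>_bounds \<epsilon> g_le_1 gap_pos[OF x] by (intro mult_mono) auto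
  then show "\<bar>w x\<bar> \<le> \<epsilon>" using w_bound[OF x] by linarith
  have "\<kappa> * \<epsilon> * g x \<le> 1 * 1 * g x" using \<kappa>_bounds \<epsilon> K2_small(5) gap_pos[OF x] by (intro mult_right_mono mult_mono) auto
  then show "\<bar>w x\<bar> \<le> g x" using w_bound[OF x] by linarith
qed

lemma uv_lower: "0 \<le> x \<Longrightarrow> 3/4 * c \<le> u x * v x" using w_small(1)[of x, unfolded w_def abs_le_iff] by linarith

lemma orbit_continuous: "continuous_on S u" "continuous_on S v" "continuous_on S p" "continuous_on S q"
  by (rule continuous_at_imp_continuous_on, use du dv dp dq in \<open>blast intro: DERIV_isCont\<close>)+

lemma pos_of_nonzero:
  fixes f :: "real \<Rightarrow> real"
  assumes "continuous_on {0..x} f" "0 < f 0" "\<And>t. 0 \<le> t \<Longrightarrow> t \<le> x \<Longrightarrow> f t \<noteq> 0" "0 \<le> x"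
  shows "0 < f x"
proof (rule ccontr)
  assume "\<not> ?thesis"
  then have "\<exists>t\<ge>0. t \<le> x \<and> f t = 0" using assms by (intro IVT2') auto
  then show False using assms(3) by blast
qed

lemma u_pos_right: "0 \<le> x \<Longrightarrow> 0 < u x" and v_pos_right: "0 \<le> x \<Longrightarrow> 0 < v x"
proof -
  assume x: "0 \<le> x"
  have ne: "u t \<noteq> 0 \<and> v t \<noteq> 0" if "0 \<le> t" for t using uv_lower[OF that] c by auto
  show "0 < u x" using ne x u0 by (intro pos_of_nonzero[of x u] orbit_continuous) auto
  have "0 < v 0" using sym[of 0] u0 by simp
  then show "0 < v x" using ne x by (intro pos_of_nonzero[of x v] orbit_continuous) auto
qed

lemma sym': "v (- x) = u x" using sym[of "- x"] by simp

lemma u_pos: "0 < u x" and v_pos: "0 < v x"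
proof -
  have "0 < u x \<and> 0 < v x"
  proof (cases "0 \<le> x")
    case True then show ?thesis using u_pos_right v_pos_right by blast
  next
    case False
    then have "0 \<le> - x" by simp
    from u_pos_right[OF this] v_pos_right[OF this] show ?thesis by (simp add: sym sym')
  qed
  then show "0 < u x" "0 < v x" by auto
qed

lemma sym_deriv: "p (- x) = - q x" "q (- x) = - p x"
proof -
  have 1: "p (- x) = - q x" for x
  proof -
    have "((\<lambda>x. u (- x)) has_real_derivative - p (- x)) (at x)"
      using has_vector_derivative_reflect[of u "p (- x)" x] du[of "- x"]
      by (simp add: has_real_derivative_iff_has_vector_derivative)
    then have "(v has_real_derivative - p (- x)) (at x)" by (simp add: sym)
    then show ?thesis using DERIV_unique[OF dv[of x]] by simp
  qed
  then show "p (- x) = - q x" .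
  show "q (- x) = - p x" using 1[of "- x"] by simp
qed

lemma r_le: "0 \<le> x \<Longrightarrow> r x < 1" using gap_pos by (simp add: r_eq)

lemma r_ge: assumes "0 \<le> x" shows "c \<le> r x"
  using sum_squares_bound[of "u x" "v x"] uv_lower[OF assms] c by (simp add: r_def)

lemma uv_le1: assumes "0 \<le> x" shows "u x \<le> 1" "v x \<le> 1"
proof -
  have "(u x)^2 \<le> 1" "(v x)^2 \<le> 1"
    using r_le[OF assms, unfolded r_def] zero_le_power2[of "u x"] zero_le_power2[of "v x"] by linarith+
  then show "u x \<le> 1" "v x \<le> 1"
    using power2_le_imp_le[of "u x" 1] power2_le_imp_le[of "v x" 1] by simp_all
qed

lemma uv_ge: assumes "0 \<le> x" shows "3/4 * c \<le> u x" "3/4 * c \<le> v x"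
proof -
  have "u x * v x \<le> u x * 1" "u x * v x \<le> 1 * v x"
    using uv_le1[OF assms] u_pos[of x] v_pos[of x] by (auto intro: mult_left_mono mult_right_mono)
  then show "3/4 * c \<le> u x" "3/4 * c \<le> v x" using uv_lower[OF assms] by auto
qed

lemma uv_half: assumes "0 \<le> x" shows "u x * v x \<le> 1/2"
  using sum_squares_bound[of "u x" "v x"] r_le[OF assms] by (simp add: r_def)

lemma e_y_norm: "(e x)^2 + (y x)^2 = r x * ((p x)^2 + (q x)^2)"
  by (simp add: e_def y_def r_def power2_eq_square algebra_simps)

lemma e_sq: assumes "0 \<le> x"
  shows "r x / 2 * (g x)^2 - (\<kappa> * g x)^2 \<le> (e x)^2" "(e x)^2 \<le> r x / 2 * (g x)^2 + (\<kappa> * g x)^2"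
proof -
  have eq: "(e x)^2 = r x / 2 * (g x)^2 + r x * ((w x)^2 / \<epsilon>^2) - (y x)^2"
    using e_y_norm[of x] energy_eq[OF assms] by (simp add: algebra_simps)
  have r0: "0 \<le> r x" by (simp add: r_def)
  have "(y x)^2 \<le> (\<kappa> * g x)^2" using power_mono[OF y_bound[OF assms], of 2] by simp
  moreover have "0 \<le> r x * ((w x)^2 / \<epsilon>^2)" using r0 by simp
  ultimately show "r x / 2 * (g x)^2 - (\<kappa> * g x)^2 \<le> (e x)^2" using eq by linarith
  have "r x * ((w x)^2 / \<epsilon>^2) \<le> 1 * (\<kappa> * g x)^2"
    using w_sq_bound[OF assms] r_le[OF assms] r0 by (intro mult_mono) auto
  then show "(e x)^2 \<le> r x / 2 * (g x)^2 + (\<kappa> * g x)^2" using eq zero_le_power2[of "y x"] by linarith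
qed

lemma e_sq_lower: assumes "0 \<le> x" shows "(c / 2 * g x)^2 \<le> (e x)^2" "0 < (e x)^2"
proof -
  have "\<kappa>^2 \<le> (3/25 * c^2)^2" using \<kappa>_bounds by (intro power_mono) auto
  also have "\<dots> = 9/625 * (c^2 * c^2)" by (simp add: power2_eq_square)
  also have "\<dots> \<le> 9/625 * (c * c)" using c by (simp add: power2_eq_square mult_left_le mult_le_one)
  also have "\<dots> \<le> 1/8 * c" using c by (simp add: mult_left_le)
  finally have k: "\<kappa>^2 \<le> 1/8 * c" .
  have "(c / 2)^2 \<le> 1/8 * c" using c by (simp add: power2_eq_square)
  then have "(c / 2)^2 \<le> r x / 2 - \<kappa>^2" using k r_ge[OF assms] c by linarith
  then have "(c / 2)^2 * (g x)^2 \<le> (r x / 2 - \<kappa>^2) * (g x)^2" by (intro mult_right_mono) auto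
  then show 1: "(c / 2 * g x)^2 \<le> (e x)^2" using e_sq(1)[OF assms]
    unfolding power_mult_distrib left_diff_distrib by linarith
  have "0 < (c / 2 * g x)^2" using c gap_pos[OF assms] by simp
  then show "0 < (e x)^2" using 1 by linarith
qed

lemma e_pos: assumes "0 \<le> x" shows "0 < e x"
proof (rule pos_of_nonzero[of x e])
  show "continuous_on {0..x} e" unfolding e_def[abs_def] by (intro continuous_intros orbit_continuous)
  show "0 < e 0" using u0 p0 q0 sym[of 0] by (simp add: e_def)
  show "e t \<noteq> 0" if "0 \<le> t" for t using e_sq_lower(2)[OF that] by auto
qed (use assms in auto)

lemma e_lower: assumes "0 \<le> x" shows "c / 2 * g x \<le> e x" "(sqrt (r x / 2) - \<kappa>) * g x \<le> e x" "e x \<le> (sqrt (r x / 2) + \<kappa>) * g x"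
proof -
  have r0: "0 \<le> r x / 2" by (simp add: r_def)
  show "c / 2 * g x \<le> e x"
    using e_sq_lower(1)[OF assms] e_pos[OF assms] by (intro power2_le_imp_le[of "c / 2 * g x" "e x"]) auto
  have sq: "(sqrt (r x / 2) * g x)^2 = r x / 2 * (g x)^2" using r0 by (simp add: power_mult_distrib)
  have "sqrt (r x / 2) * g x - \<kappa> * g x \<le> e x"
  proof (rule lower_from_squares)
    show "(sqrt (r x / 2) * g x)^2 - (\<kappa> * g x)^2 \<le> (e x)^2"
      using e_sq(1)[OF assms] by (simp only: sq)
    show "0 \<le> e x" using e_pos[OF assms] by simp
    show "0 \<le> \<kappa> * g x" "0 \<le> sqrt (r x / 2) * g x"
      using \<kappa>_bounds(1) gap_pos[OF assms] r0 by (simp_all add: less_imp_le)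
  qed
  then show "(sqrt (r x / 2) - \<kappa>) * g x \<le> e x" by (simp add: algebra_simps)
  have "(e x)^2 \<le> (sqrt (r x / 2) * g x + \<kappa> * g x)^2"
  proof -
    have "0 \<le> 2 * (sqrt (r x / 2) * g x) * (\<kappa> * g x)" using \<kappa>_bounds gap_pos[OF assms] r0 by simp
    then show ?thesis using e_sq(2)[OF assms] unfolding power2_sum sq by linarith
  qed
  then have "e x \<le> sqrt (r x / 2) * g x + \<kappa> * g x"
    by (rule power2_le_imp_le) (use \<kappa>_bounds(1) gap_pos[OF assms] r0 in \<open>simp add: less_imp_le\<close>)
  then show "e x \<le> (sqrt (r x / 2) + \<kappa>) * g x" by (simp add: algebra_simps)
qed

lemma pq_eq: "r x * p x = u x * e x + v x * y x" "r x * q x = - (v x) * e x + u x * y x"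
  by (simp_all add: r_def e_def y_def power2_eq_square algebra_simps)

lemma p_pos_right: assumes "0 \<le> x" shows "0 < p x" and q_neg_right: "q x < 0"
proof -
  have r0: "0 < r x" using r_ge[OF assms] c by linarith
  have *: "\<bar>b * y x\<bar> < a * e x" if "3/4 * c \<le> a" "0 < b" "b \<le> 1" for a b
  proof -
    have "\<bar>b * y x\<bar> \<le> 1 * (\<kappa> * g x)" unfolding abs_mult using that y_bound[OF assms] by (intro mult_mono) auto
    also have "\<dots> \<le> 3/25 * c^2 * g x" using \<kappa>_bounds(2) gap_pos[OF assms] by (simp add: mult_right_mono)
    also have "\<dots> < 3/8 * c^2 * g x" using c gap_pos[OF assms] by simp
    also have "\<dots> = 3/4 * c * (c / 2 * g x)" by (simp add: power2_eq_square)
    also have "\<dots> \<le> a * e x" using that e_lower(1)[OF assms] c gap_pos[OF assms] by (intro mult_mono) auto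
    finally show ?thesis .
  qed
  have "0 < r x * p x" unfolding pq_eq
    using *[OF uv_ge(1)[OF assms] v_pos uv_le1(2)[OF assms]] by linarith
  then show "0 < p x" using r0 by (simp add: zero_less_mult_iff)
  have "r x * q x < 0" unfolding pq_eq
    using *[OF uv_ge(2)[OF assms] u_pos uv_le1(1)[OF assms]] by linarith
  then show "q x < 0" using r0 by (simp add: mult_less_0_iff)
qed

lemma p_pos: "0 < p x"
proof (cases "0 \<le> x")
  case True then show ?thesis by (rule p_pos_right)
next
  case False
  then have "0 \<le> - x" by simp
  from q_neg_right[OF this] show ?thesis by (simp add: sym_deriv)
qed

lemma pq_le: assumes "0 \<le> x" shows "\<bar>p x\<bar> \<le> g x" "\<bar>q x\<bar> \<le> g x"
proof -
  have "(\<kappa> * g x)^2 \<le> (1/2 * g x)^2" using \<kappa>_bounds gap_pos[OF assms] by (intro power_mono mult_right_mono) auto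
  also have "\<dots> = (g x)^2 / 4" by (simp add: power_mult_distrib power_divide)
  finally have "(w x)^2 / \<epsilon>^2 \<le> (g x)^2 / 2" using w_sq_bound[OF assms] zero_le_power2[of "g x"] by linarith
  then have "(p x)^2 + (q x)^2 \<le> (g x)^2" using energy_eq[OF assms] by linarith
  then have "(p x)^2 \<le> (g x)^2" "(q x)^2 \<le> (g x)^2"
    using zero_le_power2[of "p x"] zero_le_power2[of "q x"] by linarith+
  then show "\<bar>p x\<bar> \<le> g x" "\<bar>q x\<bar> \<le> g x"
    using gap_pos[OF assms] unfolding abs_le_square_iff[symmetric] by auto
qed

lemma g_deriv: "(g has_real_derivative - 2 * (u x * p x + v x * q x)) (at x)"
  and D_deriv: "(D has_real_derivative 2 * e x) (at x)"
  unfolding g_def[abs_def] D_def[abs_def] e_def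
  using du[of x] dv[of x] by (auto intro!: derivative_eq_intros simp: algebra_simps)

lemma D_nonneg: assumes "0 \<le> x" shows "0 \<le> D x"
proof -
  have "D 0 \<le> D x"
    by (rule DERIV_nonneg_imp_nondecreasing[OF assms]) (use D_deriv e_pos in \<open>force intro: less_imp_le\<close>)
  then show ?thesis using sym[of 0] by (simp add: D_def)
qed

lemma D_sq: "(D x)^2 = (r x)^2 - 4 * (u x * v x)^2"
  by (simp add: D_def r_def power2_eq_square algebra_simps)

lemma D_le_r: "D x \<le> r x" by (simp add: D_def r_def)

lemma uv_le_r: "2 * (u x * v x) \<le> r x" using sum_squares_bound[of "u x" "v x"] by (simp add: r_def)

lemma g_deriv_le: assumes "0 \<le> x"
  shows "- 2 * (u x * p x + v x * q x) \<le> (- sqrt 2 * D x + 4 * \<kappa>) * g x"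
proof -
  have r: "0 < r x" "r x \<le> 1" using r_ge[OF assms] r_le[OF assms] c by auto
  have s: "sqrt 2 * r x \<le> 2 * sqrt (r x / 2)"
  proof -
    have "r x \<le> sqrt (r x)" using r by (simp add: real_le_rsqrt power2_eq_square mult_left_le)
    then have "sqrt 2 * r x \<le> sqrt 2 * sqrt (r x)" by simp
    also have "\<dots> = 2 * sqrt (r x / 2)" by (simp add: real_sqrt_divide field_simps)
    finally show ?thesis .
  qed
  have "r x * (u x * p x + v x * q x) = u x * (r x * p x) + v x * (r x * q x)" by (simp add: algebra_simps)
  also have "\<dots> = D x * e x + 2 * (u x * v x) * y x"
    unfolding pq_eq by (simp add: D_def power2_eq_square algebra_simps)
  also have "\<dots> \<ge> D x * ((sqrt (r x / 2) - \<kappa>) * g x) - r x * (\<kappa> * g x)"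
  proof -
    have "D x * ((sqrt (r x / 2) - \<kappa>) * g x) \<le> D x * e x"
      using D_nonneg[OF assms] e_lower(2)[OF assms] by (intro mult_left_mono) auto
    moreover have "\<bar>2 * (u x * v x) * y x\<bar> \<le> r x * (\<kappa> * g x)"
      unfolding abs_mult[of _ "y x"] using uv_le_r[of x] y_bound[OF assms] r u_pos[of x] v_pos[of x] by (intro mult_mono) auto
    ultimately show ?thesis by linarith
  qed
  finally have "r x * (- 2 * (u x * p x + v x * q x)) \<le> - (D x * (2 * sqrt (r x / 2))) * g x + 2 * D x * \<kappa> * g x + 2 * r x * \<kappa> * g x"
    by (simp add: algebra_simps)
  also have "\<dots> \<le> - (D x * (sqrt 2 * r x)) * g x + 2 * r x * \<kappa> * g x + 2 * r x * \<kappa> * g x"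
  proof -
    have "D x * (sqrt 2 * r x) * g x \<le> D x * (2 * sqrt (r x / 2)) * g x"
      using s D_nonneg[OF assms] gap_pos[OF assms] by (intro mult_right_mono mult_left_mono) auto
    moreover have "D x * (\<kappa> * g x) \<le> r x * (\<kappa> * g x)"
      using D_le_r \<kappa>_bounds gap_pos[OF assms] by (intro mult_right_mono) auto
    ultimately show ?thesis by (simp add: algebra_simps)
  qed
  also have "\<dots> = r x * ((- sqrt 2 * D x + 4 * \<kappa>) * g x)" by (simp add: algebra_simps)
  finally show ?thesis using r by (simp only: mult_le_cancel_left_pos)
qed

definition "lo = sqrt ((1 - sqrt (1 - 4 * c^2)) / 2)"
definition "hi = sqrt ((1 + sqrt (1 - 4 * c^2)) / 2)"

lemma four_c_sq_bounds: "0 < 1 - 4 * c^2" "1 - 4 * c^2 < 1"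
proof -
  have "c^2 < (1/2)^2" using c by (intro power_strict_mono) auto
  then show "0 < 1 - 4 * c^2" by (simp add: power_divide)
  show "1 - 4 * c^2 < 1" using c by simp
qed

lemma lo_hi: "lo^2 + hi^2 = 1" "lo * hi = c" "0 < lo" "1/2 \<le> hi" "0 < hi"
proof -
  define s where "s = sqrt (1 - 4 * c^2)"
  have s: "0 < s" "s < 1" "s^2 = 1 - 4 * c^2" using four_c_sq_bounds by (auto simp: s_def)
  have lh: "lo^2 = (1 - s) / 2" "hi^2 = (1 + s) / 2" using s by (auto simp: lo_def hi_def s_def[symmetric])
  then show "lo^2 + hi^2 = 1" by simp
  show "0 < lo" using s by (simp add: lo_def s_def[symmetric])
  show "0 < hi" using s by (simp add: hi_def s_def[symmetric])
  have "(1/2)^2 \<le> hi^2" using s lh by (simp add: power_divide)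
  then show "1/2 \<le> hi" using \<open>0 < hi\<close> by (intro power2_le_imp_le[of "1/2" hi]) auto
  have "(lo * hi)^2 = c^2" unfolding power_mult_distrib lh using s(3) by (simp add: power2_eq_square algebra_simps)
  then show "lo * hi = c" using \<open>0 < lo\<close> \<open>0 < hi\<close> c by (simp add: power2_eq_iff_nonneg)
qed

lemma product_bound_aux:
  assumes "0 \<le> x" and s: "s = u x \<or> s = v x"
  shows "\<bar>s - lo\<bar> * \<bar>s - hi\<bar> \<le> 8 / c * g x"
proof -
  have s0_pos_sq: "3/4 * c \<le> s" "s \<le> 1" using s uv_ge[OF assms(1)] uv_le1[OF assms(1)] by auto
  have f: "(s - lo) * (s - hi) * ((s + lo) * (s + hi)) = s^2 * (s^2 - 1) + c^2"
  proof -
    have "(s - lo) * (s - hi) * ((s + lo) * (s + hi)) = (s^2 - lo^2) * (s^2 - hi^2)"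
      by (simp add: power2_eq_square algebra_simps)
    also have "\<dots> = s^2 * (s^2 - (lo^2 + hi^2)) + (lo * hi)^2"
      by (simp add: power2_eq_square algebra_simps)
    finally show ?thesis by (simp only: lo_hi)
  qed
  have "s^2 * (s^2 - 1) = - (s^2) * g x - (u x * v x)^2"
    using s by (auto simp: g_def power2_eq_square algebra_simps)
  then have eq: "s^2 * (s^2 - 1) + c^2 = - (s^2) * g x - w x * (u x * v x + c)"
    by (simp add: w_def power2_eq_square algebra_simps)
  have "\<bar>s^2 * g x\<bar> \<le> 1 * g x"
    unfolding abs_mult using s0_pos_sq gap_pos[OF assms(1)] c by (intro mult_mono) (auto simp: power_le_one)
  moreover have "\<bar>w x * (u x * v x + c)\<bar> \<le> g x * 1"
    unfolding abs_mult using w_small(3)[OF assms(1)] uv_half[OF assms(1)] c u_pos[of x] v_pos[of x] gap_pos[OF assms(1)] by (intro mult_mono) auto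
  ultimately have "\<bar>s^2 * (s^2 - 1) + c^2\<bar> \<le> 2 * g x" unfolding eq by linarith
  then have b: "\<bar>s - lo\<bar> * \<bar>s - hi\<bar> * ((s + lo) * (s + hi)) \<le> 2 * g x"
    unfolding f[symmetric] abs_mult using s0_pos_sq c lo_hi by (simp add: abs_mult)
  have "3/4 * c * (1/2) \<le> (s + lo) * (s + hi)"
    using s0_pos_sq c lo_hi by (intro mult_mono) auto
  then have "\<bar>s - lo\<bar> * \<bar>s - hi\<bar> * (3/4 * c * (1/2)) \<le> \<bar>s - lo\<bar> * \<bar>s - hi\<bar> * ((s + lo) * (s + hi))"
    by (intro mult_left_mono) auto
  then have "\<bar>s - lo\<bar> * \<bar>s - hi\<bar> * (3/4 * c * (1/2)) \<le> 2 * g x" using b by linarith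
  then have "\<bar>s - lo\<bar> * \<bar>s - hi\<bar> * c \<le> 8 * g x" using gap_pos[OF assms(1)] by simp
  then show ?thesis using c by (simp add: field_simps)
qed

lemma product_bound:
  shows "\<bar>u x - lo\<bar> * \<bar>u x - hi\<bar> + \<bar>p x\<bar> \<le> (8 / c + 1) * g \<bar>x\<bar>"
proof -
  obtain s where s: "s = u \<bar>x\<bar> \<or> s = v \<bar>x\<bar>" "u x = s"
    using sym[of "- x"] sym[of x] sym'[of x] by (cases "0 \<le> x") auto
  have "\<bar>p x\<bar> \<le> g \<bar>x\<bar>"
    using pq_le[of "\<bar>x\<bar>"] sym_deriv[of "- x"] by (cases "0 \<le> x") auto
  moreover have "\<bar>u x - lo\<bar> * \<bar>u x - hi\<bar> \<le> 8 / c * g \<bar>x\<bar>"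
    unfolding s(2) by (rule product_bound_aux[OF _ s(1)]) simp
  ultimately show ?thesis by (simp add: algebra_simps)
qed

lemma w_abs: "\<bar>w x\<bar> \<le> 12 / c * \<epsilon>^2 * g \<bar>x\<bar>"
proof -
  have "w x = w \<bar>x\<bar>" using sym[of x] sym'[of x] by (cases "0 \<le> x") (auto simp: w_def)
  also have "\<bar>w \<bar>x\<bar>\<bar> \<le> \<kappa> * \<epsilon> * g \<bar>x\<bar>" by (rule w_bound) simp
  also have "\<dots> \<le> 12 / c * \<epsilon> * \<epsilon> * g \<bar>x\<bar>"
    using \<kappa>_bounds(4) \<epsilon> gap_pos[of "\<bar>x\<bar>"] by (intro mult_right_mono) auto
  finally show ?thesis by (simp add: power2_eq_square)
qed

lemma limits:
  assumes g0: "(g \<longlongrightarrow> 0) at_top"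
  shows "(u \<longlongrightarrow> hi) at_top" "(v \<longlongrightarrow> lo) at_top" "(u \<longlongrightarrow> lo) at_bot" "(v \<longlongrightarrow> hi) at_bot"
proof -
  have ev: "\<forall>\<^sub>F x in at_top. (0::real) \<le> x" by (rule eventually_ge_at_top)
  have w0: "(w \<longlongrightarrow> 0) at_top"
    by (rule Lim_null_comparison[OF _ g0]) (use ev in \<open>eventually_elim, auto simp: w_small(3)\<close>)
  have ueq: "u x = sqrt ((1 - g x + sqrt ((1 - g x)^2 - 4 * (c + w x)^2)) / 2)"
    and veq: "v x = sqrt ((1 - g x - sqrt ((1 - g x)^2 - 4 * (c + w x)^2)) / 2)" if "0 \<le> x" for x
  proof -
    have "sqrt ((1 - g x)^2 - 4 * (c + w x)^2) = D x"
      using D_sq[of x] D_nonneg[OF that] by (simp add: r_eq w_def real_sqrt_unique)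
    then show "u x = sqrt ((1 - g x + sqrt ((1 - g x)^2 - 4 * (c + w x)^2)) / 2)"
      "v x = sqrt ((1 - g x - sqrt ((1 - g x)^2 - 4 * (c + w x)^2)) / 2)"
      using u_pos[of x] v_pos[of x] by (simp_all add: g_def D_def)
  qed
  have "((\<lambda>x. sqrt ((1 - g x + sqrt ((1 - g x)^2 - 4 * (c + w x)^2)) / 2)) \<longlongrightarrow>
      sqrt ((1 - 0 + sqrt ((1 - 0)^2 - 4 * (c + 0)^2)) / 2)) at_top"
    by (intro tendsto_intros g0 w0) auto
  then have "((\<lambda>x. sqrt ((1 - g x + sqrt ((1 - g x)^2 - 4 * (c + w x)^2)) / 2)) \<longlongrightarrow> hi) at_top"
    by (simp add: hi_def)
  then show u: "(u \<longlongrightarrow> hi) at_top"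
    by (rule Lim_transform_eventually) (use ev in \<open>eventually_elim, simp add: ueq[symmetric]\<close>)
  have "((\<lambda>x. sqrt ((1 - g x - sqrt ((1 - g x)^2 - 4 * (c + w x)^2)) / 2)) \<longlongrightarrow>
      sqrt ((1 - 0 - sqrt ((1 - 0)^2 - 4 * (c + 0)^2)) / 2)) at_top"
    by (intro tendsto_intros g0 w0) auto
  then have "((\<lambda>x. sqrt ((1 - g x - sqrt ((1 - g x)^2 - 4 * (c + w x)^2)) / 2)) \<longlongrightarrow> lo) at_top"
    by (simp add: lo_def)
  then show v: "(v \<longlongrightarrow> lo) at_top"
    by (rule Lim_transform_eventually) (use ev in \<open>eventually_elim, simp add: veq[symmetric]\<close>)
  show "(u \<longlongrightarrow> lo) at_bot" "(v \<longlongrightarrow> hi) at_bot"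
    using u v by (simp_all add: filterlim_at_bot_mirror sym sym')
qed

end

section \<open>Exponential decay\<close>

locale gp_orbit_near = gp_orbit +
  fixes c0 C0 :: real
  assumes c0: "0 < c0" "c0 < 1/2" and C0: "0 \<le> C0" "\<bar>c - c0\<bar> \<le> C0 * \<epsilon>" and cc: "c0 / 2 \<le> c"
begin

definition "s0 = sqrt (1 - 4 * c0^2)"

lemma s0_pos_sq: "0 < s0" "s0^2 = 1 - 4 * c0^2"
proof -
  have "c0^2 < (1/2)^2" using c0 by (intro power_strict_mono) auto
  then have "0 < 1 - 4 * c0^2" by (simp add: power_divide)
  then show "0 < s0" "s0^2 = 1 - 4 * c0^2" by (auto simp: s0_def)
qed

lemma uv_c0: assumes "0 \<le> x" shows "\<bar>u x * v x - c0\<bar> \<le> (C0 + 1) * \<epsilon>"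
  using w_small(2)[OF assms] C0(2) by (simp add: w_def algebra_simps)

lemma D_lower: assumes "0 \<le> x" shows "s0 - (2 * g x + 4 * (C0 + 1) * \<epsilon>) / s0 \<le> D x"
proof (cases "s0 \<le> D x")
  case True
  have "0 \<le> (2 * g x + 4 * (C0 + 1) * \<epsilon>) / s0" using gap_pos[OF assms] C0 \<epsilon> s0_pos_sq by simp
  then show ?thesis using True by linarith
next
  case False
  have P: "\<bar>(u x * v x)^2 - c0^2\<bar> \<le> (C0 + 1) * \<epsilon> * 1"
  proof -
    have "(u x * v x)^2 - c0^2 = (u x * v x - c0) * (u x * v x + c0)" by (simp add: power2_eq_square algebra_simps)
    then show ?thesis
      using uv_c0[OF assms] uv_half[OF assms] c0 u_pos[of x] v_pos[of x]
      by (simp only: abs_mult) (intro mult_mono, auto)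
  qed
  have "s0^2 - (D x)^2 = 1 - (1 - g x)^2 + 4 * ((u x * v x)^2 - c0^2)"
    unfolding s0_pos_sq D_sq r_eq by simp
  also have "\<dots> \<le> 2 * g x + 4 * (C0 + 1) * \<epsilon>"
  proof -
    have "(u x * v x)^2 - c0^2 \<le> (C0 + 1) * \<epsilon>" using P by (simp only: mult_1_right abs_le_iff)
    then have "4 * ((u x * v x)^2 - c0^2) \<le> 4 * ((C0 + 1) * \<epsilon>)" by (rule mult_left_mono) simp
    moreover have "(1 - g x)^2 = 1 - 2 * g x + (g x)^2" by (simp add: power2_eq_square algebra_simps)
    ultimately show ?thesis using zero_le_power2[of "g x"] by linarith
  qed
  finally have "(s0 - D x) * (s0 + D x) \<le> 2 * g x + 4 * (C0 + 1) * \<epsilon>"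
    by (simp add: power2_eq_square algebra_simps)
  moreover have "(s0 - D x) * s0 \<le> (s0 - D x) * (s0 + D x)"
    using False D_nonneg[OF assms] by (intro mult_left_mono) auto
  ultimately have "(s0 - D x) * s0 \<le> 2 * g x + 4 * (C0 + 1) * \<epsilon>" by linarith
  then have "s0 - D x \<le> (2 * g x + 4 * (C0 + 1) * \<epsilon>) / s0" using s0_pos_sq by (simp add: pos_le_divide_eq)
  then show ?thesis by linarith
qed

lemma \<kappa>_c0: "\<kappa> \<le> 24 / c0 * \<epsilon>"
proof -
  have "12 / c \<le> 12 / (c0 / 2)" using cc c0 by (intro divide_left_mono) auto
  then have "12 / c * \<epsilon> \<le> 24 / c0 * \<epsilon>" using \<epsilon> by (intro mult_right_mono) auto
  then show ?thesis using \<kappa>_bounds(4) by linarith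
qed

definition "C1 = 4 * sqrt 2 * (C0 + 1) / s0 + 96 / c0"
definition "M = 4 * sqrt 2 / (s0 * c0)"

text \<open>Since \<open>D' = 2 e \<ge> c g\<close>, the weight \<open>exp (- M D)\<close> absorbs the quadratic term of
  \<open>g' \<le> g (- sqrt 2 s0 + O(g) + O(\<epsilon>))\<close>.\<close>

lemma g_decay: assumes "0 \<le> x" shows "g x \<le> exp M * exp (- (sqrt 2 * s0 - C1 * \<epsilon>) * x)"
proof -
  define \<beta> where "\<beta> = sqrt 2 * s0 - C1 * \<epsilon>"
  have M: "0 < M" "M * (c0 / 2) = 2 * sqrt 2 / s0" using s0_pos_sq c0 by (auto simp: M_def)
  define h where "h x = g x * exp (\<beta> * x - M * D x)" for x
  have "h x \<le> h 0"
  proof (rule DERIV_nonpos_imp_nonincreasing[OF assms])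
    fix t assume t: "0 \<le> t" "t \<le> x"
    define g' where "g' = - 2 * (u t * p t + v t * q t)"
    have "(h has_real_derivative exp (\<beta> * t - M * D t) * (g' + g t * (\<beta> - M * (2 * e t)))) (at t)"
      unfolding h_def using g_deriv[of t, folded g'_def] D_deriv[of t]
      by (auto intro!: derivative_eq_intros simp: algebra_simps)
    moreover have "g' + g t * (\<beta> - M * (2 * e t)) \<le> 0"
    proof -
      have gt: "0 < g t" using gap_pos t by simp
      have "M * (c0 / 2 * g t) \<le> M * (c * g t)"
        using M cc gt by (intro mult_left_mono mult_right_mono) auto
      also have "\<dots> \<le> M * (2 * e t)" using M e_lower(1)[OF t(1)] by (intro mult_left_mono) auto
      also have "M * (c0 / 2 * g t) = 2 * sqrt 2 / s0 * g t" by (simp only: mult.assoc[symmetric] M(2))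
      finally have 1: "2 * sqrt 2 / s0 * g t \<le> M * (2 * e t)" .
      have "g' \<le> (- sqrt 2 * D t + 4 * \<kappa>) * g t" unfolding g'_def by (rule g_deriv_le[OF t(1)])
      also have "\<dots> \<le> (- (sqrt 2 * (s0 - (2 * g t + 4 * (C0 + 1) * \<epsilon>) / s0)) + 4 * (24 / c0 * \<epsilon>)) * g t"
      proof (rule mult_right_mono)
        have "sqrt 2 * (s0 - (2 * g t + 4 * (C0 + 1) * \<epsilon>) / s0) \<le> sqrt 2 * D t"
          by (rule mult_left_mono[OF D_lower[OF t(1)]]) simp
        then show "- sqrt 2 * D t + 4 * \<kappa> \<le> - (sqrt 2 * (s0 - (2 * g t + 4 * (C0 + 1) * \<epsilon>) / s0)) + 4 * (24 / c0 * \<epsilon>)"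
          using \<kappa>_c0 by linarith
      qed (use gt in simp)
      also have "(- (sqrt 2 * (s0 - (2 * g t + 4 * (C0 + 1) * \<epsilon>) / s0)) + 4 * (24 / c0 * \<epsilon>))
          = 2 * sqrt 2 / s0 * g t - \<beta>"
        using s0_pos_sq(1) c0 by (simp add: \<beta>_def C1_def field_simps)
      finally have "g' + g t * (\<beta> - M * (2 * e t)) \<le> (2 * sqrt 2 / s0 * g t - \<beta>) * g t + g t * (\<beta> - M * (2 * e t))"
        by simp
      also have "\<dots> = g t * (2 * sqrt 2 / s0 * g t - M * (2 * e t))" by (simp add: algebra_simps)
      also have "\<dots> \<le> 0" using 1 gt by (intro mult_nonneg_nonpos) auto
      finally show ?thesis .
    qed
    ultimately show "\<exists>y. (h has_real_derivative y) (at t) \<and> y \<le> 0"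
      by (meson exp_ge_zero mult_nonneg_nonpos)
  qed
  also have "\<dots> \<le> 1" using g_le_1[of 0] sym[of 0] by (simp add: h_def D_def)
  finally have "g x * exp (\<beta> * x - M * D x) \<le> 1" by (simp add: h_def)
  then have "g x * exp (\<beta> * x - M * D x) * exp (M * D x) \<le> 1 * exp (M * D x)"
    by (intro mult_right_mono) auto
  then have "g x * exp (\<beta> * x) \<le> exp (M * D x)" by (simp add: exp_diff)
  also have "\<dots> \<le> exp M" using M D_le_r[of x] r_le[OF assms] by (simp add: mult_left_le)
  finally have "g x * exp (\<beta> * x) * exp (- \<beta> * x) \<le> exp M * exp (- \<beta> * x)"
    by (intro mult_right_mono) auto
  moreover have "g x * exp (\<beta> * x) * exp (- \<beta> * x) = g x" by (simp add: exp_minus)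
  ultimately show ?thesis unfolding \<beta>_def[symmetric] by linarith
qed

lemma g_tendsto: assumes "C1 * \<epsilon> < sqrt 2 * s0" shows "(g \<longlongrightarrow> 0) at_top"
proof (rule tendsto_sandwich)
  show "\<forall>\<^sub>F x in at_top. 0 \<le> g x"
    using eventually_ge_at_top[of 0] by eventually_elim (simp add: gap_pos less_imp_le)
  show "\<forall>\<^sub>F x in at_top. g x \<le> exp M * exp (- (sqrt 2 * s0 - C1 * \<epsilon>) * x)"
    using eventually_ge_at_top[of 0] by eventually_elim (rule g_decay)
  have "((\<lambda>x. exp (- (sqrt 2 * s0 - C1 * \<epsilon>) * x)) \<longlongrightarrow> 0) at_top"
    by (rule filterlim_compose[OF exp_at_bot])
      (rule filterlim_tendsto_neg_mult_at_bot[OF tendsto_const _ filterlim_ident], use assms in simp)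
  from tendsto_mult_left[OF this, of "exp M"]
  show "((\<lambda>x. exp M * exp (- (sqrt 2 * s0 - C1 * \<epsilon>) * x)) \<longlongrightarrow> 0) at_top" by simp
qed simp

section \<open>Distance to the limit profile\<close>

definition "C3 = (384 + 24 * (C0 + 1)) / c0^3"
definition "C4 = 8 / c0^2 * ((C0 + 1) + C3 / ((1 - 2 * c0) / 2))"

lemma ratio_sum_le: assumes "0 \<le> x" shows "v x / u x + u x / v x \<le> 3 / c0"
proof -
  have "v x / u x + u x / v x = r x / (u x * v x)"
    using u_pos[of x] v_pos[of x] by (simp add: r_def field_simps power2_eq_square)
  also have "\<dots> \<le> 1 / (3/4 * c)"
    using r_le[OF assms] uv_lower[OF assms] c r_ge[OF assms] by (intro frac_le) auto
  also have "\<dots> \<le> 1 / (3/4 * (c0 / 2))"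
    using cc c0 by (intro divide_left_mono) auto
  also have "\<dots> \<le> 3 / c0" using c0 by (simp add: field_simps)
  finally show ?thesis .
qed

lemma ratio_le: assumes "0 \<le> x" shows "v x / u x \<le> 1"
proof -
  have "(v x)^2 \<le> (u x)^2" using D_nonneg[OF assms] by (simp add: D_def)
  then have "v x \<le> u x" using u_pos[of x] by (intro power2_le_imp_le[of "v x" "u x"]) auto
  then show ?thesis using u_pos[of x] by simp
qed

lemma dratio: "((\<lambda>x. v x / u x) has_real_derivative (q x * u x - v x * p x) / (u x)^2) (at x)"
  using du[of x] dv[of x] u_pos[of x]
  by (auto intro!: derivative_eq_intros simp: power2_eq_square)

lemma ratio_ode: assumes x: "0 \<le> x"
  shows "\<bar>(q x * u x - v x * p x) / (u x)^2 + slow_speed c0 (v x / u x)\<bar> \<le> C3 * \<epsilon>"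
proof -
  define Y where "Y = v x / u x"
  have up: "0 < u x" "0 < v x" by (rule u_pos v_pos)+
  have rp: "0 < r x" using r_ge[OF x] c by linarith
  have Y: "0 < Y" "Y \<le> 1" using up ratio_le[OF x] by (auto simp: Y_def)
  have gx: "0 < g x" "g x \<le> 1" using gap_pos[OF x] g_le_1 by auto
  have P: "u x * v x / (u x)^2 = Y" using up by (simp add: Y_def power2_eq_square)
  have "r x * (q x * u x - v x * p x) = u x * (r x * q x) - v x * (r x * p x)" by (simp add: algebra_simps)
  also have "\<dots> = - 2 * (u x * v x) * e x + D x * y x"
    unfolding pq_eq by (simp add: D_def power2_eq_square algebra_simps)
  finally have "q x * u x - v x * p x = (- 2 * (u x * v x) * e x + D x * y x) / r x"
    using rp by (simp add: field_simps)
  then have "(q x * u x - v x * p x) / (u x)^2 = (- 2 * (u x * v x) * e x + D x * y x) / r x / (u x)^2"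
    by (simp only:)
  also have "\<dots> = - 2 * (u x * v x / (u x)^2) * e x / r x + D x / r x * (y x / (u x)^2)"
    by (simp only: divide_inverse) (simp only: algebra_simps)
  finally have "(q x * u x - v x * p x) / (u x)^2 = - 2 * (u x * v x / (u x)^2) * e x / r x + D x / r x * (y x / (u x)^2)" .
  then have eq: "(q x * u x - v x * p x) / (u x)^2 = - 2 * Y / r x * e x + D x / r x * (y x / (u x)^2)"
    unfolding P by simp
  have main: "sqrt 2 * Y * ((1 - r x) / sqrt (r x)) = 2 * Y / r x * (sqrt (r x / 2) * g x)"
  proof -
    define t where "t = sqrt (r x)"
    have t: "r x = t * t" "0 < t" using rp by (auto simp: t_def)
    have h: "sqrt (r x / 2) = t / sqrt 2" by (simp add: real_sqrt_divide t_def)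
    have "2 * Y / r x * (sqrt (r x / 2) * g x) = 2 * Y / (t * t) * (t / sqrt 2 * g x)"
      by (simp only: h) (simp only: t(1))
    also have "\<dots> = (2 / sqrt 2) * Y * (g x / t)" using t(2) by (simp add: field_simps)
    also have "2 / sqrt 2 = sqrt 2" by (simp add: real_div_sqrt)
    finally show ?thesis by (simp add: r_eq t_def)
  qed
  have kc: "\<kappa> * (1 / c^2) \<le> 96 / c0^3 * \<epsilon>"
  proof -
    have "(c0 / 2)^2 \<le> c^2" using cc c0 by (intro power_mono) auto
    then have "1 / c^2 \<le> 1 / (c0 / 2)^2" using c0 c by (intro divide_left_mono) auto
    then have "\<kappa> * (1 / c^2) \<le> (24 / c0 * \<epsilon>) * (1 / (c0 / 2)^2)"
      using \<kappa>_c0 \<kappa>_bounds(1) c0 \<epsilon> by (intro mult_mono) auto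
    also have "\<dots> = 96 / c0^3 * \<epsilon>" by (simp add: power2_eq_square power3_eq_cube)
    finally show ?thesis .
  qed
  have "\<bar>2 * Y / r x * (sqrt (r x / 2) * g x - e x)\<bar> \<le> 2 * \<kappa> * (1 / c^2)"
  proof -
    have "\<bar>sqrt (r x / 2) * g x - e x\<bar> \<le> \<kappa> * g x"
      using e_lower(2,3)[OF x] by (auto simp: abs_le_iff algebra_simps)
    also have "\<dots> \<le> \<kappa> * 1" using \<kappa>_bounds gx by (intro mult_left_mono) auto
    finally have 1: "\<bar>sqrt (r x / 2) * g x - e x\<bar> \<le> \<kappa>" by simp
    have "Y / r x \<le> 1 / c" using Y r_ge[OF x] c by (intro frac_le) auto
    also have "1 / c \<le> 1 / c^2" using c by (simp add: power2_eq_square field_simps)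
    finally have "2 * Y / r x \<le> 2 * (1 / c^2)" by simp
    then have "\<bar>2 * Y / r x\<bar> * \<bar>sqrt (r x / 2) * g x - e x\<bar> \<le> 2 * (1 / c^2) * \<kappa>"
      using 1 Y rp c by (intro mult_mono) auto
    then show ?thesis unfolding abs_mult[of "2 * Y / r x"] by (simp only: mult_ac)
  qed
  moreover have "\<bar>D x / r x * (y x / (u x)^2)\<bar> \<le> 2 * \<kappa> * (1 / c^2)"
  proof -
    have 1: "\<bar>D x / r x\<bar> \<le> 1" using D_le_r[of x] D_nonneg[OF x] rp by simp
    have "(3/4 * c)^2 \<le> (u x)^2" using uv_ge[OF x] c by (intro power_mono) auto
    moreover have "(3/4 * c)^2 = 9/16 * c^2" by (simp add: power_mult_distrib power_divide)
    ultimately have u2: "c^2 / 2 \<le> (u x)^2" using zero_le_power2[of c] by linarith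
    have "\<bar>y x\<bar> \<le> \<kappa> * g x" by (rule y_bound[OF x])
    also have "\<dots> \<le> \<kappa> * 1" using \<kappa>_bounds gx by (intro mult_left_mono) auto
    finally have "\<bar>y x\<bar> / (u x)^2 \<le> \<kappa> / (c^2 / 2)"
      using u2 c \<kappa>_bounds by (intro frac_le) auto
    then have "\<bar>y x / (u x)^2\<bar> \<le> 2 * \<kappa> * (1 / c^2)" by (simp add: mult_ac)
    then have "\<bar>D x / r x\<bar> * \<bar>y x / (u x)^2\<bar> \<le> 1 * (2 * \<kappa> * (1 / c^2))"
      using 1 by (intro mult_mono) auto
    then show ?thesis by (simp add: abs_mult)
  qed
  moreover have "(q x * u x - v x * p x) / (u x)^2 + sqrt 2 * Y * ((1 - r x) / sqrt (r x)) =
      2 * Y / r x * (sqrt (r x / 2) * g x - e x) + D x / r x * (y x / (u x)^2)"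
    unfolding eq main by (simp add: algebra_simps)
  ultimately have A: "\<bar>(q x * u x - v x * p x) / (u x)^2 + sqrt 2 * Y * ((1 - r x) / sqrt (r x))\<bar> \<le> 4 * (96 / c0^3 * \<epsilon>)"
    using kc by linarith
  define r0 where "r0 = c0 * (Y + 1 / Y)"
  have rr: "r x = u x * v x * (Y + 1 / Y)"
    using up by (simp add: r_def Y_def field_simps power2_eq_square)
  have YY: "Y + 1 / Y \<le> 3 / c0" using ratio_sum_le[OF x] by (simp add: Y_def)
  have "2 \<le> Y + 1 / Y"
  proof -
    have "0 \<le> (Y - 1)^2 / Y" using Y by simp
    also have "(Y - 1)^2 / Y = Y + 1 / Y - 2" using Y by (simp add: power2_eq_square field_simps)
    finally show ?thesis by simp
  qed
  then have "c0 * 2 \<le> r0" unfolding r0_def using c0 by (intro mult_left_mono) auto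
  then have "\<bar>(1 - r x) / sqrt (r x) - (1 - r0) / sqrt r0\<bar> \<le> \<bar>r x - r0\<bar> / (c0 / 2)^2"
    using c0 cc r_ge[OF x] by (intro inv_sqrt_minus_sqrt_lipschitz) auto
  also have "\<dots> \<le> (C0 + 1) * \<epsilon> * (3 / c0) / (c0 / 2)^2"
  proof (rule divide_right_mono)
    have "r x - r0 = (u x * v x - c0) * (Y + 1 / Y)" unfolding rr r0_def by (simp add: algebra_simps)
    then show "\<bar>r x - r0\<bar> \<le> (C0 + 1) * \<epsilon> * (3 / c0)"
      using uv_c0[OF x] YY Y C0 \<epsilon> by (simp only: abs_mult) (intro mult_mono, auto)
  qed simp
  also have "\<dots> = 12 * (C0 + 1) / c0^3 * \<epsilon>"
    using c0 by (simp add: power2_eq_square power3_eq_cube field_simps)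
  finally have B: "\<bar>(1 - r x) / sqrt (r x) - (1 - r0) / sqrt r0\<bar> \<le> 12 * (C0 + 1) / c0^3 * \<epsilon>" .
  have "\<bar>sqrt 2 * Y * ((1 - r x) / sqrt (r x)) - slow_speed c0 Y\<bar> \<le> 2 * (12 * (C0 + 1) / c0^3 * \<epsilon>)"
  proof -
    have "sqrt 2 * Y * ((1 - r x) / sqrt (r x)) - slow_speed c0 Y = sqrt 2 * Y * ((1 - r x) / sqrt (r x) - (1 - r0) / sqrt r0)"
      by (simp add: slow_speed_def r0_def algebra_simps)
    moreover have "sqrt 2 * Y \<le> 2 * 1" using Y sqrt2_less_2 by (intro mult_mono) auto
    ultimately show ?thesis using B Y by (simp only: abs_mult[of "sqrt 2 * Y"]) (intro mult_mono, auto)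
  qed
  moreover have "\<bar>a + d\<bar> \<le> m + n" if "\<bar>a + b\<bar> \<le> m" "\<bar>b - d\<bar> \<le> n" for a b d m n :: real
    using that by linarith
  ultimately have "\<bar>(q x * u x - v x * p x) / (u x)^2 + slow_speed c0 Y\<bar> \<le> 4 * (96 / c0^3 * \<epsilon>) + 2 * (12 * (C0 + 1) / c0^3 * \<epsilon>)"
    using A by blast
  also have "\<dots> = C3 * \<epsilon>" by (simp add: C3_def add_divide_distrib algebra_simps)
  finally show ?thesis by (simp add: Y_def)
qed

lemma ratio_close:
  assumes Y0: "\<And>x. 0 \<le> x \<Longrightarrow> (Y0 has_real_derivative - slow_speed c0 (Y0 x)) (at x)" "Y0 0 = 1"
    and Y0r: "\<And>x. 0 \<le> x \<Longrightarrow> 0 < Y0 x \<and> Y0 x \<le> 1 \<and> c0 * (Y0 x + 1 / Y0 x) \<le> 1" and x: "0 \<le> x"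
  shows "\<bar>v x / u x - Y0 x\<bar> \<le> C3 * \<epsilon> / ((1 - 2 * c0) / 2)"
proof (rule exp_weight_comparison[OF _ _ _ _ _ x])
  show "((\<lambda>x. v x / u x - Y0 x) has_real_derivative (q t * u t - v t * p t) / (u t)^2 - (- slow_speed c0 (Y0 t))) (at t)"
    if "0 \<le> t" for t
    by (intro DERIV_diff dratio Y0 that)
  show "v 0 / u 0 - Y0 0 = 0" using sym[of 0] u0 Y0 by simp
  show "0 < (1 - 2 * c0) / 2" using c0 by simp
  show "0 \<le> C3 * \<epsilon>" using C0 c0 \<epsilon> by (simp add: C3_def)
  fix t :: real assume t: "0 \<le> t"
  define Y where "Y = v t / u t"
  have Y: "0 < Y" "Y \<le> 1" using u_pos[of t] v_pos[of t] ratio_le[OF t] by (auto simp: Y_def)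
  have "c0 * (Y + 1 / Y) \<le> c0 * (3 / c0)" using ratio_sum_le[OF t] c0 by (intro mult_left_mono) (auto simp: Y_def)
  then have Y4: "c0 * (Y + 1 / Y) \<le> 4" using c0 by simp
  note Z = Y0r[OF t]
  define \<mu> where "\<mu> = (1 - 2 * c0) / 2"
  have mono: "\<mu> * (Y - Y0 t)^2 \<le> (Y - Y0 t) * (slow_speed c0 Y - slow_speed c0 (Y0 t))"
  proof (cases "Y \<le> Y0 t")
    case True
    have "\<mu> * (Y0 t - Y) \<le> slow_speed c0 (Y0 t) - slow_speed c0 Y"
      unfolding \<mu>_def using True Y Z Y4 by (intro slow_speed_diff c0) auto
    from mult_left_mono[OF this, of "Y0 t - Y"] True show ?thesis
      by (simp add: power2_eq_square algebra_simps)
  next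
    case False
    have "(Y0 t + 1 / Y0 t) - (Y + 1 / Y) = (Y - Y0 t) * (1 / (Y0 t * Y) - 1)"
      using Y Z by (simp add: field_simps)
    also have "\<dots> \<ge> 0" using False Y Z by (intro mult_nonneg_nonneg) (auto simp: mult_le_one)
    finally have "c0 * (Y + 1 / Y) \<le> c0 * (Y0 t + 1 / Y0 t)" using c0 by (intro mult_left_mono) auto
    then have "\<mu> * (Y - Y0 t) \<le> slow_speed c0 Y - slow_speed c0 (Y0 t)"
      unfolding \<mu>_def using False Y Z by (intro slow_speed_diff c0) auto
    from mult_left_mono[OF this, of "Y - Y0 t"] False show ?thesis
      by (simp add: power2_eq_square algebra_simps)
  qed
  define E where "E = (q t * u t - v t * p t) / (u t)^2 + slow_speed c0 Y"
  have "(Y - Y0 t) * E \<le> \<bar>Y - Y0 t\<bar> * (C3 * \<epsilon>)"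
    using ratio_ode[OF t] by - (rule order_trans[OF abs_ge_self], simp add: abs_mult E_def Y_def mult_left_mono)
  moreover have "(Y - Y0 t) * ((q t * u t - v t * p t) / (u t)^2 - (- slow_speed c0 (Y0 t)))
      = (Y - Y0 t) * E - (Y - Y0 t) * (slow_speed c0 Y - slow_speed c0 (Y0 t))"
    by (simp add: E_def algebra_simps)
  ultimately show "(v t / u t - Y0 t) * ((q t * u t - v t * p t) / (u t)^2 - (- slow_speed c0 (Y0 t))) \<le>
         - ((1 - 2 * c0) / 2) * (v t / u t - Y0 t)^2 + C3 * \<epsilon> * \<bar>v t / u t - Y0 t\<bar>"
    using mono unfolding Y_def[symmetric] \<mu>_def[symmetric] by (simp add: mult_ac)
qed

lemma profile_close:
  assumes U: "limit_profile c0 U" "\<And>x. 0 < U x" "\<And>x. U x * U (- x) = c0"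
    and U2: "\<And>x. 0 \<le> x \<Longrightarrow> c0 \<le> (U x)^2" "\<And>x. c0^2 \<le> (U x)^2 - (U x)^4"
  shows "\<bar>u x - U x\<bar> \<le> C4 * \<epsilon>"
proof -
  define B where "B = C3 * \<epsilon> / ((1 - 2 * c0) / 2)"
  define Y0 where "Y0 x = c0 / (U x)^2" for x
  have C4: "C4 * \<epsilon> = 8 / c0^2 * ((C0 + 1) * \<epsilon> + B)"
    by (simp add: C4_def B_def algebra_simps)
  have U0: "(U 0)^2 = c0" using U(3)[of 0] by (simp add: power2_eq_square)
  have B: "\<bar>v x / u x - Y0 x\<bar> \<le> B" and Yr: "0 < Y0 x \<and> Y0 x \<le> 1 \<and> c0 * (Y0 x + 1 / Y0 x) \<le> 1" if "0 \<le> x" for x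
  proof -
    have Yr: "0 < Y0 x \<and> Y0 x \<le> 1 \<and> c0 * (Y0 x + 1 / Y0 x) \<le> 1" if "0 \<le> x" for x
    proof -
      have p: "0 < (U x)^2" using U(2)[of x] by simp
      have "c0 * (c0 / P + 1 / (c0 / P)) = (c0^2 + P^2) / P" if "0 < P" for P
        using c0 that by (simp add: power2_eq_square field_simps)
      from this[OF p] have "c0 * (Y0 x + 1 / Y0 x) = (c0^2 + (U x)^4) / (U x)^2"
        by (simp add: Y0_def flip: power_mult)
      also have "\<dots> \<le> 1" using U2(2)[of x] p by simp
      finally show ?thesis using U2(1)[OF that] p c0 by (simp add: Y0_def)
    qed
    then show "0 < Y0 x \<and> Y0 x \<le> 1 \<and> c0 * (Y0 x + 1 / Y0 x) \<le> 1" using that by blast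
    have dY0: "(Y0 has_real_derivative - slow_speed c0 (Y0 x)) (at x)" for x
    proof -
      define z where "z = U x"
      have z: "0 < z" using U(2) by (simp add: z_def)
      have "(Y0 has_real_derivative - (c0 * (2 * z * profile_rhs c0 z)) / (z^2 * z^2)) (at x)"
        unfolding Y0_def[abs_def] using U(1)[unfolded limit_profile_iff] z
        by (auto intro!: derivative_eq_intros simp: z_def)
      moreover have "(c0 * (2 * z * profile_rhs c0 z)) / (z^2 * z^2) = slow_speed c0 (Y0 x)"
      proof -
        have R: "c0 * (Y0 x + 1 / Y0 x) = (z^4 + c0^2) / z^2"
          using c0 z by (simp add: Y0_def z_def[symmetric] power2_eq_square power4_eq_xxxx field_simps)
        define t where "t = sqrt (z^4 + c0^2)"
        have t: "0 < t" "t^2 = z^4 + c0^2" using c0 z by (auto simp: t_def add_pos_pos)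
        have sR: "sqrt ((z^4 + c0^2) / z^2) = t / z" using z by (simp add: real_sqrt_divide t_def)
        have n: "1 - (z^4 + c0^2) / z^2 = (z^2 - z^4 - c0^2) / z^2" using z by (simp add: field_simps)
        have s2: "2 / sqrt 2 = sqrt 2" by (simp add: real_div_sqrt)
        define N where "N = z^2 - z^4 - c0^2"
        have "(c0 * (2 * z * profile_rhs c0 z)) / (z^2 * z^2) = (2 / sqrt 2) * c0 * N / (z^3 * t)"
          unfolding profile_rhs_def t_def[symmetric] N_def[symmetric]
          using z t by (simp add: field_simps power2_eq_square power3_eq_cube)
        also have "\<dots> = sqrt 2 * (c0 / z^2) * (N / z^2 / (t / z))"
          unfolding s2 using z t by (simp add: field_simps power2_eq_square power3_eq_cube)
        finally show ?thesis unfolding slow_speed_def R n sR N_def by (simp add: Y0_def z_def)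
      qed
      ultimately show ?thesis by simp
    qed
    show "\<bar>v x / u x - Y0 x\<bar> \<le> B"
      unfolding B_def by (rule ratio_close[OF dY0 _ Yr that]) (use U0 c0 in \<open>auto simp: Y0_def\<close>)
  qed
  have right: "\<bar>u x - U x\<bar> \<le> C4 * \<epsilon> \<and> \<bar>v x - U (- x)\<bar> \<le> C4 * \<epsilon>" if x: "0 \<le> x" for x
  proof -
    define Y where "Y = v x / u x"
    have up: "0 < u x" "0 < v x" by (rule u_pos v_pos)+
    have Y: "0 < Y" "Y \<le> 1" using up ratio_le[OF x] by (auto simp: Y_def)
    have BY: "\<bar>Y - Y0 x\<bar> \<le> B" using B[OF x] by (simp add: Y_def)
    have P: "\<bar>u x * v x - c0\<bar> \<le> (C0 + 1) * \<epsilon>" by (rule uv_c0[OF x])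
    have pos: "0 \<le> (C0 + 1) * \<epsilon>" "0 \<le> B" using P BY by auto
    have sumY: "1 / Y \<le> 3 / c0" using ratio_sum_le[OF x] Y by (simp add: Y_def)
    have Ux: "0 < U x" "0 < U (- x)" using U by auto
    have diff: "\<bar>a - b\<bar> \<le> C4 * \<epsilon>" if "\<bar>a^2 - b^2\<bar> \<le> 3 / c0 * ((C0 + 1) * \<epsilon> + B)" "3/4 * c \<le> a" "0 < b" for a b
    proof -
      have "\<bar>a - b\<bar> * (3/4 * (c0 / 2)) \<le> \<bar>a - b\<bar> * (a + b)"
        using that cc c0 by (intro mult_left_mono) auto
      also have "\<dots> = \<bar>(a - b) * (a + b)\<bar>" using that c by (simp add: abs_mult)
      also have "(a - b) * (a + b) = a^2 - b^2" by (simp add: power2_eq_square algebra_simps)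
      also have "\<bar>a^2 - b^2\<bar> \<le> 3 / c0 * ((C0 + 1) * \<epsilon> + B)" by (rule that)
      also have "\<dots> = C4 * \<epsilon> * (3/4 * (c0 / 2))" unfolding C4 using c0 by (simp add: field_simps power2_eq_square)
      finally show ?thesis using c0 by simp
    qed
    have Ueq: "(U x)^2 = c0 / Y0 x" "(U (- x))^2 = c0 * Y0 x"
    proof -
      show "(U x)^2 = c0 / Y0 x" using c0 Ux by (simp add: Y0_def)
      have "U (- x) = c0 / U x" using U(3)[of x] Ux by (simp add: field_simps)
      then show "(U (- x))^2 = c0 * Y0 x" by (simp add: Y0_def power2_eq_square)
    qed
    have ueq: "(u x)^2 = u x * v x / Y" "(v x)^2 = u x * v x * Y"
      using up by (simp_all add: Y_def power2_eq_square)
    have "\<bar>(u x)^2 - (U x)^2\<bar> \<le> 3 / c0 * ((C0 + 1) * \<epsilon> + B)"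
    proof -
      have "(u x)^2 - (U x)^2 = (u x * v x - c0) * (1 / Y) + (c0 / Y0 x) * ((Y0 x - Y) * (1 / Y))"
        unfolding ueq Ueq using Y Yr[OF x] by (simp add: field_simps)
      moreover have "\<bar>(u x * v x - c0) * (1 / Y)\<bar> \<le> (C0 + 1) * \<epsilon> * (3 / c0)"
        unfolding abs_mult using P sumY Y by (intro mult_mono) auto
      moreover have "\<bar>(c0 / Y0 x) * ((Y0 x - Y) * (1 / Y))\<bar> \<le> 1 * (B * (3 / c0))"
      proof -
        have "c0 / Y0 x \<le> c0 * (Y0 x + 1 / Y0 x)"
          using Yr[OF x] c0 by (simp add: distrib_left)
        moreover have "0 < c0 / Y0 x" using Yr[OF x] c0 by simp
        ultimately have "\<bar>c0 / Y0 x\<bar> \<le> 1" using Yr[OF x] by linarith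
        then show ?thesis unfolding abs_mult[of "c0 / Y0 x"] abs_mult[of "Y0 x - Y"]
          using BY sumY Y pos by (intro mult_mono) auto
      qed
      ultimately have "\<bar>(u x)^2 - (U x)^2\<bar> \<le> (C0 + 1) * \<epsilon> * (3 / c0) + 1 * (B * (3 / c0))" by linarith
      then show ?thesis by (simp add: algebra_simps)
    qed
    moreover have "\<bar>(v x)^2 - (U (- x))^2\<bar> \<le> 3 / c0 * ((C0 + 1) * \<epsilon> + B)"
    proof -
      have "(v x)^2 - (U (- x))^2 = (u x * v x - c0) * Y + c0 * (Y - Y0 x)"
        unfolding ueq Ueq by (simp add: algebra_simps)
      then have "\<bar>(v x)^2 - (U (- x))^2\<bar> \<le> \<bar>(u x * v x - c0) * Y\<bar> + \<bar>c0 * (Y - Y0 x)\<bar>"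
        by (metis abs_triangle_ineq)
      also have "\<dots> \<le> (C0 + 1) * \<epsilon> * 1 + 1 * B"
        unfolding abs_mult using P Y BY c0 by (intro add_mono mult_mono) auto
      also have "\<dots> = 1 * ((C0 + 1) * \<epsilon> + B)" by simp
      also have "\<dots> \<le> 3 / c0 * ((C0 + 1) * \<epsilon> + B)" using c0 pos by (intro mult_right_mono) auto
      finally show ?thesis .
    qed
    ultimately show ?thesis using diff uv_ge[OF x] Ux by blast
  qed
  show ?thesis
  proof (cases "0 \<le> x")
    case True then show ?thesis using right by blast
  next
    case False
    then show ?thesis using right[of "- x"] sym'[of x] by simp
  qed
qed

end

section \<open>The heteroclinic solution\<close>

lemma ubar_eq: "\<Lambda> \<noteq> 1 \<Longrightarrow> ubar \<Lambda> \<omega> = sqrt ((1 - sqrt (1 - 4 * (\<omega> / (\<Lambda> - 1))^2)) / 2)"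
  and vbar_eq: "\<Lambda> \<noteq> 1 \<Longrightarrow> vbar \<Lambda> \<omega> = sqrt ((1 + sqrt (1 - 4 * (\<omega> / (\<Lambda> - 1))^2)) / 2)"
  by (simp_all add: ubar_def vbar_def power_divide)

definition good_solution :: "real \<Rightarrow> (real \<Rightarrow> real) \<Rightarrow> real \<Rightarrow> real \<Rightarrow> real \<Rightarrow> (real \<Rightarrow> real) \<Rightarrow> (real \<Rightarrow> real) \<Rightarrow> bool" where
  "good_solution c0 U A \<Lambda> \<omega> u v \<longleftrightarrow>
     GP_solution \<Lambda> \<omega> u v \<and> (\<forall>x. u x > 0 \<and> v x > 0) \<and>
     (u \<longlongrightarrow> ubar \<Lambda> \<omega>) at_bot \<and> (v \<longlongrightarrow> vbar \<Lambda> \<omega>) at_bot \<and>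
     (u \<longlongrightarrow> vbar \<Lambda> \<omega>) at_top \<and> (v \<longlongrightarrow> ubar \<Lambda> \<omega>) at_top \<and>
     (\<forall>x. u (- x) = v x) \<and> (\<forall>x. deriv u x > 0) \<and>
     (\<forall>x. \<bar>u x - U x\<bar> \<le> A * (1 / sqrt \<Lambda>)) \<and>
     (\<forall>x. \<bar>\<bar>u x - ubar \<Lambda> \<omega>\<bar> * \<bar>u x - vbar \<Lambda> \<omega>\<bar> + \<bar>deriv u x\<bar>\<bar> \<le>
        A * 1 * exp (- (sqrt 2 * sqrt (1 - 4 * c0^2) - A * (1 / sqrt \<Lambda>)) * \<bar>x\<bar>)) \<and>
     (\<forall>x. \<bar>u x * v x - \<omega> / (\<Lambda> - 1)\<bar> \<le>
        A * (1 / \<Lambda>) * exp (- (sqrt 2 * sqrt (1 - 4 * c0^2) - A * (1 / sqrt \<Lambda>)) * \<bar>x\<bar>))"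

lemma good_solution_exists:
  fixes c0 C0 :: real
  assumes c0: "0 < c0" "c0 < 1/2" and C0: "0 \<le> C0"
    and U: "limit_profile c0 U" "\<And>x. 0 < U x" "\<And>x. U x * U (- x) = c0"
    and U2: "\<And>x. 0 \<le> x \<Longrightarrow> c0 \<le> (U x)^2" "\<And>x. c0^2 \<le> (U x)^2 - (U x)^4"
  shows "\<exists>A>0. \<exists>B>0. \<forall>\<Lambda> \<omega>. 2 < \<Lambda> \<and> \<bar>\<omega> / (\<Lambda> - 1) - c0\<bar> \<le> C0 * (1 / sqrt (\<Lambda> - 1)) \<and>
    c0 / 2 \<le> \<omega> / (\<Lambda> - 1) \<and> \<omega> / (\<Lambda> - 1) < 1/2 \<and> 1 / sqrt (\<Lambda> - 1) \<le> B \<longrightarrow>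
    (\<exists>u v. good_solution c0 U A \<Lambda> \<omega> u v)"
proof -
  define s1 where "s1 = sqrt (1 - 4 * c0^2)"
  have s1: "0 < s1"
  proof -
    have "c0^2 < (1/2)^2" using c0 by (intro power_strict_mono) auto
    then show ?thesis by (simp add: s1_def power_divide)
  qed
  define A1 where "A1 = 4 * sqrt 2 * (C0 + 1) / s1 + 96 / c0"
  define M1 where "M1 = 4 * sqrt 2 / (s1 * c0)"
  define A3 where "A3 = (384 + 24 * (C0 + 1)) / c0^3"
  define A4 where "A4 = 8 / c0^2 * ((C0 + 1) + A3 / ((1 - 2 * c0) / 2))"
  define A where "A = 2 * A1 + 2 * A4 + (16 / c0 + 1) * exp M1 + 48 / c0 * exp M1"
  define B where "B = min ((c0 / 2)^3 / 100) (sqrt 2 * s1 / (2 * A1))"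
  have pos: "0 < A1" "0 < A3" "0 < A4"
  proof -
    show "0 < A1" unfolding A1_def using c0 C0 s1 by (intro add_nonneg_pos) auto
    show A3: "0 < A3" unfolding A3_def using c0 C0 by simp
    have "0 < A3 / ((1 - 2 * c0) / 2)" using A3 c0 by simp
    then have "0 < C0 + 1 + A3 / ((1 - 2 * c0) / 2)" using C0 by linarith
    then show "0 < A4" unfolding A4_def using c0 by (intro mult_pos_pos) auto
  qed
  have A: "0 < A" "2 * A1 \<le> A" "2 * A4 \<le> A" "(16 / c0 + 1) * exp M1 \<le> A" "48 / c0 * exp M1 \<le> A"
  proof -
    have "0 \<le> (16 / c0 + 1) * exp M1" "0 \<le> 48 / c0 * exp M1" using c0 by auto
    then show "0 < A" "2 * A1 \<le> A" "2 * A4 \<le> A" "(16 / c0 + 1) * exp M1 \<le> A" "48 / c0 * exp M1 \<le> A"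
      using pos unfolding A_def by linarith+
  qed
  have B: "0 < B" using pos s1 c0 by (simp add: B_def)
  show ?thesis
  proof (rule exI[of _ A], rule conjI[OF A(1)], rule exI[of _ B], rule conjI[OF B], intro allI impI)
    fix \<Lambda> \<omega> :: real
    define \<epsilon> where "\<epsilon> = 1 / sqrt (\<Lambda> - 1)"
    define c where "c = \<omega> / (\<Lambda> - 1)"
    assume hyps: "2 < \<Lambda> \<and> \<bar>\<omega> / (\<Lambda> - 1) - c0\<bar> \<le> C0 * (1 / sqrt (\<Lambda> - 1)) \<and>
      c0 / 2 \<le> \<omega> / (\<Lambda> - 1) \<and> \<omega> / (\<Lambda> - 1) < 1/2 \<and> 1 / sqrt (\<Lambda> - 1) \<le> B"
    then have \<Lambda>: "2 < \<Lambda>" by blast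
    from hyps have h: "\<bar>c - c0\<bar> \<le> C0 * \<epsilon>" "c0 / 2 \<le> c" "c < 1/2" "\<epsilon> \<le> B" by (auto simp: c_def \<epsilon>_def)
    have e: "0 < \<epsilon>" "\<epsilon>^2 = 1 / (\<Lambda> - 1)" using \<Lambda> by (auto simp: \<epsilon>_def power_divide)
    have eL: "\<epsilon> \<le> 2 * (1 / sqrt \<Lambda>)"
    proof -
      have "sqrt \<Lambda> \<le> sqrt (4 * (\<Lambda> - 1))" using \<Lambda> by simp
      also have "\<dots> = 2 * sqrt (\<Lambda> - 1)" by (subst real_sqrt_mult) simp
      finally show ?thesis using \<Lambda> by (simp add: \<epsilon>_def field_simps)
    qed
    have eL2: "\<epsilon>^2 \<le> 2 * (1 / \<Lambda>)" using \<Lambda> by (simp add: e field_simps)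
    have "(c0 / 2)^3 \<le> c^3" using h c0 by (intro power_mono) auto
    then have "\<epsilon> \<le> c^3 / 100" using h(4) by (simp add: B_def)
    then interpret gp_block c \<epsilon>
      using h c0 e by unfold_locales auto
    obtain u v p q where "gp_orbit c \<epsilon> u v p q"
      using heteroclinic_exists by blast
    then interpret gp_orbit c \<epsilon> u v p q .
    interpret gp_orbit_near c \<epsilon> u v p q c0 C0
      by unfold_locales (use c0 C0 h in auto)
    have const_eqs: "s0 = s1" "C1 = A1" "M = M1" "C3 = A3" "C4 = A4"
      by (simp_all add: s0_def s1_def C1_def A1_def M_def M1_def C3_def A3_def C4_def A4_def)
    define E where "E x = exp (- (sqrt 2 * s1 - A * (1 / sqrt \<Lambda>)) * \<bar>x\<bar>)" for x
    have gE: "g \<bar>x\<bar> \<le> exp M1 * E x" for x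
    proof -
      have "A1 * \<epsilon> \<le> A1 * (2 * (1 / sqrt \<Lambda>))" using eL pos by (intro mult_left_mono) auto
      also have "\<dots> = 2 * A1 * (1 / sqrt \<Lambda>)" by simp
      also have "\<dots> \<le> A * (1 / sqrt \<Lambda>)" using A(2) \<Lambda> by (intro mult_right_mono) auto
      finally have "- (sqrt 2 * s1 - A1 * \<epsilon>) * \<bar>x\<bar> \<le> - (sqrt 2 * s1 - A * (1 / sqrt \<Lambda>)) * \<bar>x\<bar>"
        by (intro mult_right_mono) auto
      then have "exp M1 * exp (- (sqrt 2 * s1 - A1 * \<epsilon>) * \<bar>x\<bar>) \<le> exp M1 * E x"
        unfolding E_def by simp
      with g_decay[of "\<bar>x\<bar>", unfolded const_eqs, OF abs_ge_zero] show ?thesis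
        by (rule order_trans)
    qed
    have "A1 * \<epsilon> \<le> A1 * (sqrt 2 * s1 / (2 * A1))"
      using h(4) pos by (intro mult_left_mono) (auto simp: B_def)
    also have "\<dots> < sqrt 2 * s1" using pos s1 by simp
    finally have "(g \<longlongrightarrow> 0) at_top" using g_tendsto[unfolded const_eqs] by blast
    note lims = limits[OF this]
    have bars: "ubar \<Lambda> \<omega> = lo" "vbar \<Lambda> \<omega> = hi"
      using ubar_eq[of \<Lambda> \<omega>] vbar_eq[of \<Lambda> \<omega>] \<Lambda> unfolding lo_def hi_def by (simp_all add: c_def)
    have der: "deriv u = p" "deriv v = q"
      using du dv by (auto intro!: ext DERIV_imp_deriv)
    have acc: "accel a b = a^3 - a + \<Lambda> * b^2 * a - \<omega> * b" for a b
    proof -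
      have \<omega>: "\<omega> = c * (\<Lambda> - 1)" using \<Lambda> by (simp add: c_def)
      have "(a * b - c) * b / \<epsilon>^2 = (a * b - c) * b * (\<Lambda> - 1)" using \<Lambda> by (simp add: e)
      then show ?thesis unfolding accel_def \<omega> by (simp add: power2_eq_square power3_eq_cube algebra_simps)
    qed
    have solves: "GP_solution \<Lambda> \<omega> u v"
      unfolding GP_solution_def der
      using du dv dp dq by (auto simp: acc real_differentiable_def)
    have close: "\<bar>u x - U x\<bar> \<le> A * (1 / sqrt \<Lambda>)" for x
    proof -
      have "\<bar>u x - U x\<bar> \<le> A4 * \<epsilon>" using profile_close[OF U U2] by (simp only: const_eqs)
      also have "\<dots> \<le> A4 * (2 * (1 / sqrt \<Lambda>))" using eL pos by (intro mult_left_mono) auto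
      also have "\<dots> = 2 * A4 * (1 / sqrt \<Lambda>)" by simp
      also have "\<dots> \<le> A * (1 / sqrt \<Lambda>)" using A(3) \<Lambda> by (intro mult_right_mono) auto
      finally show ?thesis .
    qed
    have ci: "1 / c \<le> 2 / c0" using h c0 by (simp add: field_simps)
    have g0: "0 \<le> g \<bar>x\<bar>" for x using gp_orbit.gap_pos[OF gp_orbit_axioms, of "\<bar>x\<bar>"] by simp
    have E0: "0 \<le> E x" for x by (simp add: E_def)
    have dec: "\<bar>\<bar>u x - lo\<bar> * \<bar>u x - hi\<bar> + \<bar>p x\<bar>\<bar> \<le> A * 1 * E x" for x
    proof -
      have "\<bar>\<bar>u x - lo\<bar> * \<bar>u x - hi\<bar> + \<bar>p x\<bar>\<bar> = \<bar>u x - lo\<bar> * \<bar>u x - hi\<bar> + \<bar>p x\<bar>" by simp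
      also have "\<dots> \<le> (8 / c + 1) * g \<bar>x\<bar>" by (rule product_bound)
      also have "\<dots> \<le> (16 / c0 + 1) * g \<bar>x\<bar>" using ci g0[of x] by (intro mult_right_mono) auto
      also have "\<dots> \<le> (16 / c0 + 1) * (exp M1 * E x)" using gE c0 by (intro mult_left_mono) auto
      also have "\<dots> = (16 / c0 + 1) * exp M1 * E x" by simp
      also have "\<dots> \<le> A * E x" using A(4) E0 by (intro mult_right_mono) auto
      finally show ?thesis by simp
    qed
    have fast: "\<bar>u x * v x - c\<bar> \<le> A * (1 / \<Lambda>) * E x" for x
    proof -
      have "\<bar>u x * v x - c\<bar> \<le> 12 / c * \<epsilon>^2 * g \<bar>x\<bar>" using w_abs[of x] by (simp add: w_def)
      also have "\<dots> \<le> 24 / c0 * (2 * (1 / \<Lambda>)) * (exp M1 * E x)"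
        using ci eL2 gE g0[of x] c0 c \<Lambda> by (intro mult_mono) auto
      also have "\<dots> = (48 / c0 * exp M1) * (1 / \<Lambda>) * E x" by simp
      also have "\<dots> \<le> A * (1 / \<Lambda>) * E x" using A(5) E0 \<Lambda> by (intro mult_right_mono) auto
      finally show ?thesis .
    qed
    show "\<exists>u v. good_solution c0 U A \<Lambda> \<omega> u v"
      unfolding good_solution_def
      using solves u_pos v_pos lims sym p_pos close dec fast
      by (intro exI[of _ u] exI[of _ v]) (simp add: bars der E_def s1_def c_def[symmetric])
  qed
qed

lemma C2_halfline_linear_bound:
  assumes "C2_halfline f" "f 0 = 0"
  obtains C d where "0 \<le> C" "0 < d" "\<And>t. 0 < t \<Longrightarrow> t < d \<Longrightarrow> \<bar>f t\<bar> \<le> C * t"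
proof -
  obtain a where "(f has_real_derivative a) (at 0 within {0..})"
    using assms(1) unfolding C2_halfline_def by (metis order_refl)
  then have "((\<lambda>y. (f y - f 0) / (y - 0)) \<longlongrightarrow> a) (at 0 within {0..})"
    by (simp add: has_field_derivative_iff)
  then have "((\<lambda>y. \<bar>f y / y\<bar>) \<longlongrightarrow> \<bar>a\<bar>) (at 0 within {0..})"
    using assms(2) by (intro tendsto_intros) simp
  then have "\<forall>\<^sub>F y in at 0 within {0..}. \<bar>f y / y\<bar> < \<bar>a\<bar> + 1"
    by (rule order_tendstoD) simp
  then obtain d where d: "0 < d" "\<And>y. 0 \<le> y \<Longrightarrow> y \<noteq> 0 \<Longrightarrow> dist y 0 < d \<Longrightarrow> \<bar>f y / y\<bar> < \<bar>a\<bar> + 1"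
    unfolding eventually_at by auto
  show thesis
  proof (rule that[of "\<bar>a\<bar> + 1" d])
    fix t :: real assume "0 < t" "t < d"
    then show "\<bar>f t\<bar> \<le> (\<bar>a\<bar> + 1) * t"
      using d(2)[of t] by (simp add: abs_divide divide_less_eq)
  qed (use d in auto)
qed

lemma exp_decay_boundI:
  assumes "0 < C" "\<forall>\<^sub>F \<Lambda> in at_top. \<forall>x. \<bar>f \<Lambda> x\<bar> \<le> C * a \<Lambda> * exp (- (\<kappa> - C * \<delta> \<Lambda>) * \<bar>x\<bar>)"
  shows "exp_decay_bound f a \<kappa> \<delta>"
  using assms unfolding exp_decay_bound_def by blast

theorem theorem1p1:
  fixes c0 :: real and \<omega>t \<omega> :: "real \<Rightarrow> real"
  assumes "0 < c0" and "c0 < 1/2"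
    and "C2_halfline \<omega>t" and "\<omega>t 0 = 0"
    and "\<And>\<Lambda>. \<Lambda> > 1 \<Longrightarrow> \<omega> \<Lambda> / (\<Lambda> - 1) = c0 + \<omega>t (1 / sqrt (\<Lambda> - 1))"
  shows "\<exists>u0. limit_profile c0 u0 \<and> (\<forall>w. limit_profile c0 w \<longrightarrow> w = u0) \<and>
    (\<exists>u v :: real \<Rightarrow> real \<Rightarrow> real.
      (\<forall>\<^sub>F \<Lambda> in at_top.
         GP_solution \<Lambda> (\<omega> \<Lambda>) (u \<Lambda>) (v \<Lambda>) \<and>
         (\<forall>x. u \<Lambda> x > 0 \<and> v \<Lambda> x > 0) \<and>
         (u \<Lambda> \<longlongrightarrow> ubar \<Lambda> (\<omega> \<Lambda>)) at_bot \<and> (v \<Lambda> \<longlongrightarrow> vbar \<Lambda> (\<omega> \<Lambda>)) at_bot \<and>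
         (u \<Lambda> \<longlongrightarrow> vbar \<Lambda> (\<omega> \<Lambda>)) at_top \<and> (v \<Lambda> \<longlongrightarrow> ubar \<Lambda> (\<omega> \<Lambda>)) at_top \<and>
         (\<forall>x. u \<Lambda> (- x) = v \<Lambda> x) \<and>
         (\<forall>x. deriv (u \<Lambda>) x > 0)) \<and>
      (\<exists>C>0. \<forall>\<^sub>F \<Lambda> in at_top. \<forall>x. \<bar>u \<Lambda> x - u0 x\<bar> \<le> C * (1 / sqrt \<Lambda>)) \<and>
      exp_decay_bound
        (\<lambda>\<Lambda> x. \<bar>u \<Lambda> x - ubar \<Lambda> (\<omega> \<Lambda>)\<bar> * \<bar>u \<Lambda> x - vbar \<Lambda> (\<omega> \<Lambda>)\<bar> + \<bar>deriv (u \<Lambda>) x\<bar>)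
        (\<lambda>\<Lambda>. 1) (sqrt 2 * sqrt (1 - 4 * c0^2)) (\<lambda>\<Lambda>. 1 / sqrt \<Lambda>) \<and>
      exp_decay_bound
        (\<lambda>\<Lambda> x. u \<Lambda> x * v \<Lambda> x - \<omega> \<Lambda> / (\<Lambda> - 1))
        (\<lambda>\<Lambda>. 1 / \<Lambda>) (sqrt 2 * sqrt (1 - 4 * c0^2)) (\<lambda>\<Lambda>. 1 / sqrt \<Lambda>))"
proof -
  obtain U where U: "limit_profile c0 U" "\<And>x. 0 < U x" "\<And>x. U x * U (- x) = c0"
    "\<And>x. 0 \<le> x \<Longrightarrow> c0 \<le> (U x)^2" "\<And>x. c0^2 \<le> (U x)^2 - (U x)^4"
    using limit_profile_exists[OF assms(1,2)] by metis
  obtain C0 d where C0: "0 \<le> C0" "0 < d" "\<And>t. 0 < t \<Longrightarrow> t < d \<Longrightarrow> \<bar>\<omega>t t\<bar> \<le> C0 * t"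
    using C2_halfline_linear_bound[OF assms(3,4)] by blast
  obtain A B where AB: "0 < A" "0 < B" and ex:
    "\<And>\<Lambda> \<omega>. 2 < \<Lambda> \<and> \<bar>\<omega> / (\<Lambda> - 1) - c0\<bar> \<le> C0 * (1 / sqrt (\<Lambda> - 1)) \<and>
      c0 / 2 \<le> \<omega> / (\<Lambda> - 1) \<and> \<omega> / (\<Lambda> - 1) < 1/2 \<and> 1 / sqrt (\<Lambda> - 1) \<le> B \<Longrightarrow>
      \<exists>u v. good_solution c0 U A \<Lambda> \<omega> u v"
    using good_solution_exists[OF assms(1,2) C0(1) U] by blast
  define \<eta> where "\<eta> = min (min d B) (min (c0 / 2) ((1/2 - c0) / 2) / (C0 + 1))"
  have \<eta>: "0 < \<eta>" using C0 AB assms(1,2) by (simp add: \<eta>_def)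
  have "((\<lambda>\<Lambda>::real. 1 / sqrt (\<Lambda> - 1)) \<longlongrightarrow> 0) at_top" by real_asymp
  then have small: "\<forall>\<^sub>F \<Lambda> in at_top. 1 / sqrt (\<Lambda> - 1) < \<eta>" using \<eta> by (rule order_tendstoD)
  have ev: "\<forall>\<^sub>F \<Lambda> in at_top. \<exists>u v. good_solution c0 U A \<Lambda> (\<omega> \<Lambda>) u v"
    using small eventually_gt_at_top[of 2]
  proof eventually_elim
    case (elim \<Lambda>)
    define e where "e = 1 / sqrt (\<Lambda> - 1)"
    have e: "0 < e" "e < \<eta>" using elim by (auto simp: e_def)
    have w: "\<bar>\<omega> \<Lambda> / (\<Lambda> - 1) - c0\<bar> \<le> C0 * e"
      using assms(5)[of \<Lambda>] C0(3)[of e] elim e by (simp add: e_def \<eta>_def)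
    have "C0 * e \<le> (C0 + 1) * (min (c0 / 2) ((1/2 - c0) / 2) / (C0 + 1))"
      using e C0 by (intro mult_mono) (auto simp: \<eta>_def)
    also have "\<dots> = min (c0 / 2) ((1/2 - c0) / 2)" using C0 by simp
    finally have "C0 * e \<le> c0 / 2" "C0 * e \<le> (1/2 - c0) / 2" by auto
    moreover have "x < 1/2" if "x - c0 \<le> a" "a \<le> (1/2 - c0) / 2" for x a
      using that assms(2) by (simp add: field_simps)
    ultimately have "c0 / 2 \<le> \<omega> \<Lambda> / (\<Lambda> - 1)" "\<omega> \<Lambda> / (\<Lambda> - 1) < 1/2"
      using abs_le_D1[OF w] abs_le_D2[OF w] by (linarith, blast)
    moreover have "1 / sqrt (\<Lambda> - 1) \<le> B" using e(2) by (simp add: e_def \<eta>_def)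
    ultimately show ?case using w[unfolded e_def] elim(2) by (intro ex) blast
  qed
  have "\<exists>z. (\<exists>u v. good_solution c0 U A \<Lambda> (\<omega> \<Lambda>) u v) \<longrightarrow> good_solution c0 U A \<Lambda> (\<omega> \<Lambda>) (fst z) (snd z)" for \<Lambda>
    by (metis fst_conv snd_conv)
  then obtain z where z: "\<And>\<Lambda>. \<exists>u v. good_solution c0 U A \<Lambda> (\<omega> \<Lambda>) u v \<Longrightarrow>
      good_solution c0 U A \<Lambda> (\<omega> \<Lambda>) (fst (z \<Lambda>)) (snd (z \<Lambda>))"
    by metis
  define u v where "u \<Lambda> = fst (z \<Lambda>)" and "v \<Lambda> = snd (z \<Lambda>)" for \<Lambda>
  have good: "\<forall>\<^sub>F \<Lambda> in at_top. good_solution c0 U A \<Lambda> (\<omega> \<Lambda>) (u \<Lambda>) (v \<Lambda>)"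
    using ev unfolding u_def v_def by eventually_elim (rule z)
  have unique: "\<forall>w. limit_profile c0 w \<longrightarrow> w = U"
    using limit_profile_unique[OF assms(1)] U(1) by blast
  show ?thesis
  proof (rule exI[of _ U], rule conjI[OF U(1)], rule conjI[OF unique], rule exI[of _ u], rule exI[of _ v], intro conjI)
    show "\<exists>C>0. \<forall>\<^sub>F \<Lambda> in at_top. \<forall>x. \<bar>u \<Lambda> x - U x\<bar> \<le> C * (1 / sqrt \<Lambda>)"
      using good by (intro exI[of _ A] conjI AB(1)) (auto elim!: eventually_mono simp: good_solution_def)
  qed ((rule exp_decay_boundI[OF AB(1)])?, rule eventually_mono[OF good], unfold good_solution_def,
      elim conjE, (intro conjI)?, assumption+)+
qed

end
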